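(* Given a digraph $D=(V,A)$ with a designated node $r\in V$ and a cost function $c:A\to\mathbb{R}$, one can find in polynomial time a subset $A'\subseteq A$, a graphic matroid $M_1$ and a partition matroid $M_2$, both on ground set $A'$, such that $B\subseteq A$ is a minimum $c$-cost $r$-arborescence of $D$ if and only if $B\subseteq A'$ and $B$ is a common base of $M_1$ and $M_2$.
   Context: An $r$-arborescence of $D$ is a set $B\subseteq A$ which is a spanning tree in the undirected sense, in which $r$ has in-degree $0$ and every other node has in-degree exactly $1$; its $c$-cost is $\sum_{b\in B}c(b)$. A graphic matroid is the circuit (cycle) matroid of an undirected graph; a partition matroid is one whose independent sets are the sets containing at most a prescribed number of elements from each class of a partition of the ground set.
   Formalization: The formal theorem assumes that A is nonempty or V={r}; if A is empty and V has other nodes, the claim fails, because the empty set is then the common base of both matroids on A'=∅ but is not an r-arborescence. *)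

theory Defs
  imports Complex_Main "Graph_Theory.Digraph"
begin

section \<open>Undirected multigraphs\<close>

text \<open>
  An undirected multigraph has vertex set \<open>V\<close>, edge set \<open>E\<close> and an incidence map \<open>ends\<close> sending an
  edge to the set of its (one or two) end vertices. Loops and parallel edges are allowed.
  The notions of tree and forest in Graph_Theory are not used, since they exclude only directed
  cycles.
\<close>

definition ugraph :: "'v set \<Rightarrow> 'e set \<Rightarrow> ('e \<Rightarrow> 'v set) \<Rightarrow> bool" where
  "ugraph V E ends \<longleftrightarrow> finite V \<and> finite E \<and>
     (\<forall>e\<in>E. ends e \<subseteq> V \<and> card (ends e) \<in> {1, 2})"

text \<open>
  The closed walk \<open>ws ! 0, es ! 0, ws ! 1, es ! 1, \<dots>, ws ! 0\<close> without repeated vertices or edges.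
  A loop is a cycle of length 1, two parallel edges form a cycle of length 2.
\<close>

definition ucycle :: "('e \<Rightarrow> 'v set) \<Rightarrow> 'v list \<Rightarrow> 'e list \<Rightarrow> bool" where
  "ucycle ends ws es \<longleftrightarrow> es \<noteq> [] \<and> length ws = length es \<and> distinct ws \<and> distinct es \<and>
     (\<forall>i<length es. ends (es ! i) = {ws ! i, ws ! (Suc i mod length es)})"

definition uforest :: "('e \<Rightarrow> 'v set) \<Rightarrow> 'e set \<Rightarrow> bool" where
  "uforest ends F \<longleftrightarrow> \<not> (\<exists>ws es. ucycle ends ws es \<and> set es \<subseteq> F)"

definition uconnected :: "'v set \<Rightarrow> ('e \<Rightarrow> 'v set) \<Rightarrow> 'e set \<Rightarrow> bool" where
  "uconnected V ends F \<longleftrightarrow>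
     (\<forall>u\<in>V. \<forall>v\<in>V. (u, v) \<in> {(x, y). \<exists>e\<in>F. ends e = {x, y}}\<^sup>*)"

definition spanning_utree :: "'v set \<Rightarrow> ('e \<Rightarrow> 'v set) \<Rightarrow> 'e set \<Rightarrow> bool" where
  "spanning_utree V ends F \<longleftrightarrow> uconnected V ends F \<and> uforest ends F"


section \<open>Minimum cost arborescences\<close>

definition arborescence :: "('a, 'b) pre_digraph \<Rightarrow> 'a \<Rightarrow> 'b set \<Rightarrow> bool" where
  "arborescence D r B \<longleftrightarrow> B \<subseteq> arcs D \<and>
     spanning_utree (verts D) (\<lambda>a. {tail D a, head D a}) B \<and>
     card (in_arcs D r \<inter> B) = 0 \<and>
     (\<forall>v \<in> verts D - {r}. card (in_arcs D v \<inter> B) = 1)"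

definition min_cost_arborescence ::
  "('a, 'b) pre_digraph \<Rightarrow> 'a \<Rightarrow> ('b \<Rightarrow> real) \<Rightarrow> 'b set \<Rightarrow> bool" where
  "min_cost_arborescence D r c B \<longleftrightarrow> arborescence D r B \<and>
     (\<forall>B'. arborescence D r B' \<longrightarrow> sum c B \<le> sum c B')"


section \<open>Graphic matroids and partition matroids\<close>

text \<open>A matroid is given by the family of its independent sets.\<close>

definition cycle_matroid :: "'e set \<Rightarrow> ('e \<Rightarrow> 'v set) \<Rightarrow> 'e set set" where
  "cycle_matroid E ends = {I. I \<subseteq> E \<and> uforest ends I}"

text \<open>The classes of the partition are the nonempty sets \<open>{e \<in> E. cls e = k}\<close>.\<close>

definition partition_matroid :: "'e set \<Rightarrow> ('e \<Rightarrow> 'k) \<Rightarrow> ('k \<Rightarrow> nat) \<Rightarrow> 'e set set" where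
  "partition_matroid E cls d = {I. I \<subseteq> E \<and> (\<forall>k. card {e\<in>I. cls e = k} \<le> d k)}"

definition matroid_base :: "'e set set \<Rightarrow> 'e set \<Rightarrow> bool" where
  "matroid_base M B \<longleftrightarrow> B \<in> M \<and> (\<forall>I\<in>M. B \<subseteq> I \<longrightarrow> I = B)"


section \<open>The model of computation\<close>

text \<open>
  A random access machine, programmed in a structured language, with one kind of memory for natural
  numbers and one for real numbers. Memory is organised in named arrays; a program mentions only
  finitely many names. The only arithmetic operations are addition and subtraction, and there are no
  real constants. Within \<open>t\<close> steps the bit length of a number therefore grows by at most \<open>O(t)\<close>, so
  that unit cost is not an unrealistic measure (as it would be with multiplication). Since an
  expression in a fixed program has constant size, each assignment and each test counts as one step.
\<close>

type_synonym name = string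

record state =
  nats :: "name \<Rightarrow> nat \<Rightarrow> nat"
  reals :: "name \<Rightarrow> nat \<Rightarrow> real"

datatype nexp = NConst nat | NRead name nexp | NAdd nexp nexp | NSub nexp nexp
datatype rexp = RRead name nexp | RAdd rexp rexp | RSub rexp rexp
datatype bexp = NLess nexp nexp | RLess rexp rexp | BNot bexp | BAnd bexp bexp

datatype com =
    Skip
  | NAssign name nexp nexp
  | RAssign name nexp rexp
  | Seq com com
  | Cond bexp com com
  | While bexp com

fun nval :: "nexp \<Rightarrow> state \<Rightarrow> nat" where
  "nval (NConst k) s = k"
| "nval (NRead x i) s = nats s x (nval i s)"
| "nval (NAdd a b) s = nval a s + nval b s"
| "nval (NSub a b) s = nval a s - nval b s"

fun rval :: "rexp \<Rightarrow> state \<Rightarrow> real" where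
  "rval (RRead x i) s = reals s x (nval i s)"
| "rval (RAdd a b) s = rval a s + rval b s"
| "rval (RSub a b) s = rval a s - rval b s"

fun bval :: "bexp \<Rightarrow> state \<Rightarrow> bool" where
  "bval (NLess a b) s = (nval a s < nval b s)"
| "bval (RLess a b) s = (rval a s < rval b s)"
| "bval (BNot b) s = (\<not> bval b s)"
| "bval (BAnd a b) s = (bval a s \<and> bval b s)"

definition nupdate :: "name \<Rightarrow> nat \<Rightarrow> nat \<Rightarrow> state \<Rightarrow> state" where
  "nupdate x i k s = s\<lparr>nats := (nats s)(x := (nats s x)(i := k))\<rparr>"

definition rupdate :: "name \<Rightarrow> nat \<Rightarrow> real \<Rightarrow> state \<Rightarrow> state" where
  "rupdate x i z s = s\<lparr>reals := (reals s)(x := (reals s x)(i := z))\<rparr>"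

text \<open>\<open>exec C s t s'\<close>: started in \<open>s\<close>, the program \<open>C\<close> halts after \<open>t\<close> steps in \<open>s'\<close>.\<close>

inductive exec :: "com \<Rightarrow> state \<Rightarrow> nat \<Rightarrow> state \<Rightarrow> bool" where
  exec_Skip: "exec Skip s 1 s"
| exec_NAssign: "exec (NAssign x i a) s 1 (nupdate x (nval i s) (nval a s) s)"
| exec_RAssign: "exec (RAssign x i a) s 1 (rupdate x (nval i s) (rval a s) s)"
| exec_Seq: "exec C1 s1 t1 s2 \<Longrightarrow> exec C2 s2 t2 s3 \<Longrightarrow> exec (Seq C1 C2) s1 (t1 + t2) s3"
| exec_CondTrue: "bval b s \<Longrightarrow> exec C1 s t s' \<Longrightarrow> exec (Cond b C1 C2) s (t + 1) s'"
| exec_CondFalse: "\<not> bval b s \<Longrightarrow> exec C2 s t s' \<Longrightarrow> exec (Cond b C1 C2) s (t + 1) s'"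
| exec_WhileFalse: "\<not> bval b s \<Longrightarrow> exec (While b C) s 1 s"
| exec_WhileTrue: "bval b s1 \<Longrightarrow> exec C s1 t1 s2 \<Longrightarrow> exec (While b C) s2 t2 s3 \<Longrightarrow>
    exec (While b C) s1 (t1 + t2 + 1) s3"

inductive_cases exec_SkipE: "exec Skip s t s'"
inductive_cases exec_NAssignE: "exec (NAssign x i a) s t s'"
inductive_cases exec_RAssignE: "exec (RAssign x i a) s t s'"
inductive_cases exec_SeqE: "exec (Seq C1 C2) s t s'"
inductive_cases exec_CondE: "exec (Cond b C1 C2) s t s'"
inductive_cases exec_WhileE: "exec (While b C) s t s'"

lemma exec_deterministic:
  "exec C s t s' \<Longrightarrow> exec C s u s'' \<Longrightarrow> u = t \<and> s'' = s'"
proof (induction arbitrary: u s'' rule: exec.induct)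
  case (exec_Skip s)
  then show ?case by (auto elim: exec_SkipE)
next
  case (exec_NAssign x i a s)
  then show ?case by (auto elim: exec_NAssignE)
next
  case (exec_RAssign x i a s)
  then show ?case by (auto elim: exec_RAssignE)
next
  case (exec_Seq C1 s1 t1 s2 C2 t2 s3)
  from exec_Seq.prems obtain v1 v2 s where
    *: "u = v1 + v2" "exec C1 s1 v1 s" "exec C2 s v2 s''"
    by (auto elim: exec_SeqE)
  from exec_Seq.IH(1)[OF *(2)] have "v1 = t1" "s = s2" by auto
  with exec_Seq.IH(2) * show ?case by auto
next
  case (exec_CondTrue b s C1 t s' C2)
  from exec_CondTrue.prems exec_CondTrue.hyps obtain v where
    *: "u = v + 1" "exec C1 s v s''"
    by (auto elim: exec_CondE)
  from exec_CondTrue.IH[OF *(2)] * show ?case by simp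
next
  case (exec_CondFalse b s C2 t s' C1)
  from exec_CondFalse.prems exec_CondFalse.hyps obtain v where
    *: "u = v + 1" "exec C2 s v s''"
    by (auto elim: exec_CondE)
  from exec_CondFalse.IH[OF *(2)] * show ?case by simp
next
  case (exec_WhileFalse b s C)
  from exec_WhileFalse.prems exec_WhileFalse.hyps show ?case
    by (auto elim: exec_WhileE)
next
  case (exec_WhileTrue b s1 C t1 s2 t2 s3)
  from exec_WhileTrue.prems exec_WhileTrue.hyps(1) obtain v1 v2 s where
    *: "u = v1 + v2 + 1" "exec C s1 v1 s" "exec (While b C) s v2 s''"
    by (auto elim: exec_WhileE)
  from exec_WhileTrue.IH(1)[OF *(2)] have "v1 = t1" "s = s2" by auto
  with exec_WhileTrue.IH(2) * show ?case by auto
qed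


section \<open>Input and output\<close>

text \<open>
  The machine knows the nodes and arcs of a digraph by their positions in two lists enumerating
  them. All cells which do not hold the input are 0.
\<close>

definition enumerates :: "'x list \<Rightarrow> 'x set \<Rightarrow> bool" where
  "enumerates xs X \<longleftrightarrow> distinct xs \<and> set xs = X"

definition pos :: "'x list \<Rightarrow> 'x \<Rightarrow> nat" where
  "pos xs x = the_inv_into {..<length xs} ((!) xs) x"

lemma pos_nth:
  assumes "distinct xs" "i < length xs"
  shows "pos xs (xs ! i) = i"
  unfolding pos_def using assms
  by (intro the_inv_into_f_f) (auto simp: inj_on_def nth_eq_iff_index_eq)

definition input_state ::
  "('a, 'b) pre_digraph \<Rightarrow> 'a \<Rightarrow> ('b \<Rightarrow> real) \<Rightarrow> 'a list \<Rightarrow> 'b list \<Rightarrow> state" where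
  "input_state D r c vs as =
    \<lparr>nats = (\<lambda>x i. 0)
       (''nodes'' := (\<lambda>i. 0)(0 := length vs),
        ''arcs'' := (\<lambda>i. 0)(0 := length as),
        ''root'' := (\<lambda>i. 0)(0 := pos vs r),
        ''tail'' := (\<lambda>i. if i < length as then pos vs (tail D (as ! i)) else 0),
        ''head'' := (\<lambda>i. if i < length as then pos vs (head D (as ! i)) else 0)),
     reals = (\<lambda>x i. 0)
       (''cost'' := (\<lambda>i. if i < length as then c (as ! i) else 0))\<rparr>"

text \<open>
  The output consists of a characteristic vector of the ground set, an undirected graph with nodes
  \<open>0, 1, \<dots>\<close> whose edges are the elements of the ground set, given by their two ends, and a partition of
  the ground set, given by a class number for each element and a bound for each class.
\<close>

definition out_ground :: "'b list \<Rightarrow> state \<Rightarrow> 'b set" where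
  "out_ground as s = {a \<in> set as. nats s ''ground'' (pos as a) \<noteq> 0}"

definition out_vertices :: "state \<Rightarrow> nat set" where
  "out_vertices s = {..<nats s ''vertices'' 0}"

definition out_ends :: "'b list \<Rightarrow> state \<Rightarrow> 'b \<Rightarrow> nat set" where
  "out_ends as s a = {nats s ''end1'' (pos as a), nats s ''end2'' (pos as a)}"

definition out_class :: "'b list \<Rightarrow> state \<Rightarrow> 'b \<Rightarrow> nat" where
  "out_class as s a = nats s ''class'' (pos as a)"

definition out_bound :: "state \<Rightarrow> nat \<Rightarrow> nat" where
  "out_bound s k = nats s ''bound'' k"

end

theory Submission
  imports Defs
begin

text \<open>
  The program is Fulkerson's dual ascent. Among the sets \<open>R v\<close> of nodes from which \<open>v\<close> can be reached
  by arcs of reduced cost 0, and which avoid \<open>r\<close>, take a smallest one. It is strongly connected by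
  zero arcs and no zero arc enters it; lower the costs of the arcs entering it until one of them
  becomes 0, and repeat until \<open>r\<close> reaches every node. The chosen sets form a laminar family, and by
  complementary slackness the minimum cost arborescences are those which use zero arcs only and
  enter every chosen set exactly once. The latter condition is moved into the graph of \<open>M\<^sub>1\<close>: each arc
  is reattached to the representatives of the two maximal chosen sets that separate its ends just
  before both ends come to lie in a common chosen set. The arcs that do not lie inside a chosen set \<open>S\<close>
  then see \<open>S\<close> as a single node, so a spanning tree of the new graph has exactly \<open>|S| - 1\<close> arcs
  inside \<open>S\<close>, and as all \<open>|S|\<close> nodes of \<open>S\<close> have indegree 1, exactly one arc enters \<open>S\<close>.
\<close>

section \<open>Counting edges of forests\<close>

text \<open>A partition matroid controls indegrees only, and restricting to zero arcs is not enough: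
  an arborescence of zero arcs that enters a raised set twice is too expensive, since every raise is
  strictly positive. This is why the single-entry conditions have to be encoded in the graph.
  Slackness characterises the optima only because the dual bound is attained, hence the separate
  construction of an arborescence that enters each raised set once. Negative costs are removed by a
  uniform shift, harmless because all arborescences have \<open>card V - 1\<close> arcs. Each raise
  turns the cost of some arc into 0 and no zero arc becomes positive again, so there are at most as
  many raises as arcs. Trees are handled by counting: of being a forest, being connected and having
  \<open>card V - 1\<close> edges, any two imply the third, and this carries conditions from one
  graph to the other.\<close>

definition adj :: "('e \<Rightarrow> 'v set) \<Rightarrow> 'e set \<Rightarrow> ('v \<times> 'v) set" where
  "adj ends F = {(x, y). \<exists>e\<in>F. ends e = {x, y}}"

lemma adj_iff [simp]: "(x, y) \<in> adj ends F \<longleftrightarrow> (\<exists>e\<in>F. ends e = {x, y})"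
  by (simp add: adj_def)

lemma uconnected_iff: "uconnected V ends F \<longleftrightarrow> (\<forall>u\<in>V. \<forall>v\<in>V. (u, v) \<in> (adj ends F)\<^sup>*)"
  by (simp add: uconnected_def adj_def)

lemma sym_adj: "sym (adj ends F)"
  by (auto simp: sym_def insert_commute)

lemma adj_rtrancl_sym: "(x, y) \<in> (adj ends F)\<^sup>* \<Longrightarrow> (y, x) \<in> (adj ends F)\<^sup>*"
  using sym_rtrancl[OF sym_adj, of ends F] by (simp add: sym_def)

lemma adj_rtrancl_mono: "F \<subseteq> G \<Longrightarrow> (x, y) \<in> (adj ends F)\<^sup>* \<Longrightarrow> (x, y) \<in> (adj ends G)\<^sup>*"
  by (erule rtrancl_mono[THEN subsetD, rotated]) (auto simp: adj_def)

lemma uforest_subset: "uforest ends G \<Longrightarrow> F \<subseteq> G \<Longrightarrow> uforest ends F"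
  unfolding uforest_def by blast

section \<open>Simple paths and cycles\<close>

lemma rtrancl_imp_simple_path:
  assumes "(x, y) \<in> (adj ends F)\<^sup>*"
  shows "\<exists>ws es. length ws = Suc (length es) \<and> distinct ws \<and> ws ! 0 = x \<and> ws ! length es = y \<and>
    set es \<subseteq> F \<and> (\<forall>i<length es. ends (es ! i) = {ws ! i, ws ! Suc i})"
  using assms
proof induction
  case base
  show ?case by (rule exI[of _ "[x]"], rule exI[of _ "[]"]) simp
next
  case (step y z)
  then obtain ws es where p: "length ws = Suc (length es)" "distinct ws" "ws ! 0 = x"
    "ws ! length es = y" "set es \<subseteq> F" "\<forall>i<length es. ends (es ! i) = {ws ! i, ws ! Suc i}"
    by blast
  from step.hyps obtain e where e: "e \<in> F" "ends e = {y, z}" by auto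
  show ?case
  proof (cases "z \<in> set ws")
    \<comment> \<open>The walk returns to a vertex of the path. Cutting the path off there keeps its
      vertices distinct.\<close>
    case True
    then obtain k where k: "k < length ws" "ws ! k = z" by (auto simp: in_set_conv_nth)
    then have k': "min (length ws) (Suc k) = Suc k" "min (length es) k = k" using p(1) by auto
    show ?thesis
      by (rule exI[of _ "take (Suc k) ws"], rule exI[of _ "take k es"])
        (use p k k' in \<open>auto dest: in_set_takeD\<close>)
  next
    case False
    show ?thesis
      by (rule exI[of _ "ws @ [z]"], rule exI[of _ "es @ [e]"])
        (use p e False in \<open>auto simp: nth_append less_Suc_eq\<close>)
  qed
qed

text \<open>The edge \<open>e\<close> closes a simple path between its ends to a cycle. If
  \<open>x = y\<close>, the path has no edges and the cycle is the loop \<open>e\<close>.\<close>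

lemma ucycle_insert:
  assumes e: "ends e = {x, y}" "e \<notin> F" and xy: "(x, y) \<in> (adj ends F)\<^sup>*"
  shows "\<not> uforest ends (insert e F)"
proof -
  from rtrancl_imp_simple_path[OF xy] obtain ws es where p: "length ws = Suc (length es)"
    "distinct ws" "ws ! 0 = x" "ws ! length es = y" "set es \<subseteq> F"
    "\<forall>i<length es. ends (es ! i) = {ws ! i, ws ! Suc i}"
    by blast
  \<comment> \<open>Distinct vertices have distinct pairs of neighbours along the path, so the edges
    joining these pairs differ as well.\<close>
  have "distinct es"
    unfolding distinct_conv_nth
  proof (intro allI impI)
    fix i j assume ij: "i < length es" "j < length es" "i \<noteq> j"
    have "{ws ! i, ws ! Suc i} \<noteq> {ws ! j, ws ! Suc j}"
      using ij p(1,2) by (auto simp: doubleton_eq_iff nth_eq_iff_index_eq)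
    then show "es ! i \<noteq> es ! j" using p(6) ij by metis
  qed
  moreover have "ends ((es @ [e]) ! i) = {ws ! i, ws ! (Suc i mod length (es @ [e]))}"
    if "i < length (es @ [e])" for i
    using that p e by (cases "i = length es") (auto simp: nth_append insert_commute)
  ultimately have "ucycle ends ws (es @ [e])"
    unfolding ucycle_def using p e by auto
  moreover have "set (es @ [e]) \<subseteq> insert e F" using p(5) by auto
  ultimately show ?thesis unfolding uforest_def by blast
qed

text \<open>The last edge of the cycle is taken: the remaining edges still join its ends. For a loop
  nothing has to remain.\<close>

lemma ucycle_redundant_edge:
  assumes "ucycle ends ws es" "set es \<subseteq> F"
  shows "\<exists>e\<in>F. \<exists>x y. ends e = {x, y} \<and> (x, y) \<in> (adj ends (F - {e}))\<^sup>*"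
proof -
  define k where "k = length es - 1"
  have c: "length es = Suc k" "length ws = Suc k" "distinct es"
    "\<And>i. i < length es \<Longrightarrow> ends (es ! i) = {ws ! i, ws ! (Suc i mod length es)}"
    using assms(1) unfolding ucycle_def k_def by (cases es; auto)+
  have "(ws ! 0, ws ! i) \<in> (adj ends (F - {es ! k}))\<^sup>*" if "i \<le> k" for i
    using that
  proof (induction i)
    case (Suc i)
    have "es ! i \<noteq> es ! k" using c Suc.prems by (simp add: nth_eq_iff_index_eq)
    moreover have "es ! i \<in> F" using assms(2) c(1) Suc.prems by auto
    ultimately have "(ws ! i, ws ! Suc i) \<in> adj ends (F - {es ! k})"
      using c(4)[of i] c(1) Suc.prems by (auto intro!: bexI[of _ "es ! i"])
    with Suc show ?case by (meson Suc_leD rtrancl.rtrancl_into_rtrancl)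
  qed simp
  moreover have "ends (es ! k) = {ws ! 0, ws ! k}" using c(4)[of k] c(1) by auto
  moreover have "es ! k \<in> F" using assms(2) c(1) by auto
  ultimately show ?thesis by blast
qed

text \<open>Components are encoded by the values of a function instead of classes of a quotient:
  their number is then the size of an image, and merging two of them is a pointwise change.\<close>

definition component_label :: "('v \<Rightarrow> 'v) \<Rightarrow> 'v set \<Rightarrow> ('e \<Rightarrow> 'v set) \<Rightarrow> 'e set \<Rightarrow> bool" where
  "component_label f V ends F \<longleftrightarrow>
     (\<forall>x\<in>V. \<forall>y\<in>V. f x = f y \<longleftrightarrow> (x, y) \<in> (adj ends F)\<^sup>*)"

text \<open>A labelling of the components; merging two labels mirrors the insertion of an edge.\<close>

lemma component_labelling:
  fixes V :: "'v set"
  assumes "finite F" "finite V" "\<forall>e\<in>F. \<exists>x\<in>V. \<exists>y\<in>V. ends e = {x, y}"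
  shows "\<exists>f. component_label f V ends F \<and>
    card V \<le> card F + card (f ` V) \<and> (uforest ends F \<longrightarrow> card V = card F + card (f ` V))"
  using assms
proof (induction F)
  case empty
  show ?case by (rule exI[of _ id]) (auto simp: component_label_def adj_def)
next
  case (insert e F)
  then obtain f where f0: "component_label f V ends F"
    "card V \<le> card F + card (f ` V)" "uforest ends F \<longrightarrow> card V = card F + card (f ` V)"
    by auto
  then have f: "\<And>x y. x \<in> V \<Longrightarrow> y \<in> V \<Longrightarrow> f x = f y \<longleftrightarrow> (x, y) \<in> (adj ends F)\<^sup>*"
    by (simp add: component_label_def)
  note f = f f0(2,3)
  from insert.prems obtain a b where ab: "a \<in> V" "b \<in> V" "ends e = {a, b}" by auto
  \<comment> \<open>The component of \<open>a\<close> receives the label of \<open>b\<close>, so at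
    most one label disappears.\<close>
  define f' where "f' = (\<lambda>x. if f x = f a then f b else f x)"
  let ?R = "(adj ends (insert e F))\<^sup>*"
  have FR: "(x, y) \<in> ?R" if "(x, y) \<in> (adj ends F)\<^sup>*" for x y
    using that by (rule adj_rtrancl_mono[rotated]) auto
  have abR: "(a, b) \<in> ?R" using ab by auto
  have sound: "y \<in> V \<and> f' x = f' y" if "(x, y) \<in> ?R" "x \<in> V" for x y
    using that
  proof induction
    case (step y z)
    from step.hyps(2) consider "(y, z) \<in> adj ends F" | "{y, z} = {a, b}" using ab by auto
    then show ?case
    proof cases
      case 1
      then obtain g where g: "g \<in> F" "ends g = {y, z}" by auto
      then have "z \<in> V" using insert.prems(2) by (metis insertCI insertE singletonD)
      moreover have "f y = f z" using f(1)[of y z] 1 step \<open>z \<in> V\<close> by blast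
      ultimately show ?thesis using step unfolding f'_def by auto
    next
      case 2
      then show ?thesis using step ab unfolding f'_def by (auto simp: doubleton_eq_iff)
    qed
  qed simp
  have complete: "(x, y) \<in> ?R" if "x \<in> V" "y \<in> V" "f' x = f' y" for x y
  proof -
    have to: "\<exists>z\<in>V. (x, z) \<in> ?R \<and> f z = f' x" if "x \<in> V" for x
    proof (cases "f x = f a")
      case True
      then have "(x, a) \<in> ?R" using f(1) that ab FR by blast
      then show ?thesis using True abR ab unfolding f'_def by (auto intro: rtrancl_trans)
    qed (use that in \<open>auto simp: f'_def\<close>)
    from to that obtain z w where "z \<in> V" "(x, z) \<in> ?R" "f z = f' x" "w \<in> V" "(y, w) \<in> ?R"
        "f w = f' y"
      by meson
    then have "(z, w) \<in> ?R" "(w, y) \<in> ?R" using f(1)[of z w] FR[of z w] that(3) adj_rtrancl_sym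
        by metis+
    with \<open>(x, z) \<in> ?R\<close> show ?thesis by (meson rtrancl_trans)
  qed
  have img: "f' ` V = (if f a = f b then f ` V else f ` V - {f a})"
    unfolding f'_def using ab by (auto simp: image_iff)
  have cardf: "card (f' ` V) = (if f a = f b then card (f ` V) else card (f ` V) - 1)"
    unfolding img using ab insert.prems by auto
  have pos: "card (f ` V) > 0" using ab insert.prems by (auto simp: card_gt_0_iff)
  \<comment> \<open>If \<open>a\<close> and \<open>b\<close> already had the same label,
    \<open>e\<close> would close a cycle. So in a forest each edge costs exactly one label and
    equality is kept.\<close>
  have forest: "card V = card (insert e F) + card (f' ` V)" if "uforest ends (insert e F)"
  proof -
    have "f a \<noteq> f b" using ucycle_insert[of ends e a b F] ab insert.hyps(2) that f(1) by auto
    moreover have "uforest ends F" using that by (rule uforest_subset) auto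
    ultimately show ?thesis using f cardf insert.hyps pos by auto
  qed
  have "card V \<le> card (insert e F) + card (f' ` V)"
    using f(2) cardf insert.hyps pos by (auto split: if_splits)
  moreover have "component_label f' V ends (insert e F)"
    unfolding component_label_def using sound complete by blast
  ultimately show ?case using forest by blast
qed

text \<open>In a forest, edges and components add up to \<open>card V\<close>. There is at least one
  component, and exactly one if the number of edges is largest possible.\<close>

lemma uforest_card:
  assumes "uforest ends F" "finite V" "V \<noteq> {}" "\<forall>e\<in>F. \<exists>x\<in>V. \<exists>y\<in>V. ends e = {x, y}" "finite F"
  shows "card F \<le> card V - 1" and "card F = card V - 1 \<Longrightarrow> uconnected V ends F"
proof -
  obtain f where f: "component_label f V ends F"
    "uforest ends F \<longrightarrow> card V = card F + card (f ` V)"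
    using component_labelling[OF assms(5,2,4)] by blast
  note f = f(1)[unfolded component_label_def] f(2)[rule_format, OF assms(1)]
  have pos: "card (f ` V) > 0" using assms by (auto simp: card_gt_0_iff)
  then show "card F \<le> card V - 1" using f by simp
  show "uconnected V ends F" if "card F = card V - 1"
  proof -
    have "card (f ` V) = 1" using that f(2) pos by simp
    then obtain z where "f ` V = {z}" by (auto simp: card_1_singleton_iff)
    then have "f x = f y" if "x \<in> V" "y \<in> V" for x y using that by (metis imageI singletonD)
    then show ?thesis unfolding uconnected_iff using f(1) by (intro ballI) (rule iffD1; blast)
  qed
qed

lemma uconnected_card:
  assumes "uconnected V ends F" "finite V" "\<forall>e\<in>F. \<exists>x\<in>V. \<exists>y\<in>V. ends e = {x, y}" "finite F"
  shows "card V \<le> Suc (card F)"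
proof -
  obtain f where f: "component_label f V ends F"
    "card V \<le> card F + card (f ` V)"
    using component_labelling[OF assms(4,2,3)] by blast
  note f = f(1)[unfolded component_label_def] f(2)
  have "f x = f y" if "x \<in> V" "y \<in> V" for x y
    using f(1)[rule_format, OF that] assms(1)[unfolded uconnected_iff, rule_format, OF that]
        by blast
  then have "\<forall>a\<in>f ` V. \<forall>b\<in>f ` V. a = b" by blast
  then have "card (f ` V) \<le> Suc 0" using assms(2) card_le_Suc0_iff_eq[of "f ` V"] by blast
  with f(2) show ?thesis by simp
qed

text \<open>A cycle contains an edge whose removal keeps the graph connected, but then fewer than
  \<open>card V - 1\<close> edges would connect \<open>V\<close>.\<close>

lemma uconnected_imp_uforest:
  assumes "uconnected V ends F" "finite V" "\<forall>e\<in>F. \<exists>x\<in>V. \<exists>y\<in>V. ends e = {x, y}" "finite F"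
    and "card F \<le> card V - 1"
  shows "uforest ends F"
  unfolding uforest_def
proof (rule notI, elim exE conjE)
  fix ws es assume "ucycle ends ws es" "set es \<subseteq> F"
  then obtain e x y where e: "e \<in> F" "ends e = {x, y}" "(x, y) \<in> (adj ends (F - {e}))\<^sup>*"
    using ucycle_redundant_edge by blast
  have "adj ends F \<subseteq> (adj ends (F - {e}))\<^sup>*"
  proof (rule subrelI)
    fix u v assume "(u, v) \<in> adj ends F"
    then obtain g where g: "g \<in> F" "ends g = {u, v}" by auto
    show "(u, v) \<in> (adj ends (F - {e}))\<^sup>*"
    proof (cases "g = e")
      case True
      then have "u = x \<and> v = y \<or> u = y \<and> v = x" using g e by (auto simp: doubleton_eq_iff)
      then show ?thesis using e(3) adj_rtrancl_sym[OF e(3)] by blast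
    next
      case False
      then have "(u, v) \<in> adj ends (F - {e})" using g by auto
      then show ?thesis by blast
    qed
  qed
  then have "uconnected V ends (F - {e})"
    using assms(1) unfolding uconnected_iff by (meson rtrancl_subset_rtrancl subsetD)
  then have "card V \<le> Suc (card (F - {e}))"
    using assms by (intro uconnected_card) auto
  moreover have "card F > 0" "V \<noteq> {}" using e(1) assms(3,4) by (auto simp: card_gt_0_iff)
  moreover have "card V > 0" using \<open>V \<noteq> {}\<close> assms(2) by (simp add: card_gt_0_iff)
  ultimately show False using e(1) assms(4,5) by (simp add: card_Diff_singleton)
qed

text \<open>Trades the acyclicity in \<open>arborescence\<close> for a number of edges, which the
  indegrees supply.\<close>

lemma spanning_utree_iff_card:
  assumes "finite V" "V \<noteq> {}" "\<forall>e\<in>F. \<exists>x\<in>V. \<exists>y\<in>V. ends e = {x, y}" "finite F"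
  shows "spanning_utree V ends F \<longleftrightarrow> uconnected V ends F \<and> card F = card V - 1"
proof
  assume "spanning_utree V ends F"
  then show "uconnected V ends F \<and> card F = card V - 1"
    using uconnected_card[of V ends F] uforest_card(1)[of ends F V] assms
    unfolding spanning_utree_def by auto
qed (use assms uconnected_imp_uforest[of V ends F] in \<open>simp add: spanning_utree_def\<close>)

section \<open>Arborescences and the dual ascent\<close>

locale rooted_network =
  fixes V :: "'v set" and A :: "'e set" and t h :: "'e \<Rightarrow> 'v" and r :: 'v
  assumes finite_V: "finite V" and finite_A: "finite A" and r_in_V: "r \<in> V"
    and tail_in_V: "a \<in> A \<Longrightarrow> t a \<in> V" and head_in_V: "a \<in> A \<Longrightarrow> h a \<in> V"
begin

abbreviation arc_ends :: "'e \<Rightarrow> 'v set" where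
  "arc_ends a \<equiv> {t a, h a}"

definition enters :: "'e \<Rightarrow> 'v set \<Rightarrow> bool" where
  "enters a S \<longleftrightarrow> t a \<notin> S \<and> h a \<in> S"

definition inside :: "'v set \<Rightarrow> 'e set \<Rightarrow> 'e set" where
  "inside S B = {a \<in> B. t a \<in> S \<and> h a \<in> S}"

definition indegree_one :: "'e set \<Rightarrow> bool" where
  "indegree_one B \<longleftrightarrow> B \<subseteq> A \<and> (\<forall>a\<in>B. h a \<noteq> r) \<and> (\<forall>v\<in>V - {r}. card {a\<in>B. h a = v} = 1)"

text \<open>Acyclicity is implicit: the indegrees force \<open>card V - 1\<close> arcs, and a
  connected graph with that many edges is a tree.\<close>

definition arb :: "'e set \<Rightarrow> bool" where
  "arb B \<longleftrightarrow> indegree_one B \<and> uconnected V arc_ends B"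

definition min_arb :: "('e \<Rightarrow> real) \<Rightarrow> 'e set \<Rightarrow> bool" where
  "min_arb c B \<longleftrightarrow> arb B \<and> (\<forall>B'. arb B' \<longrightarrow> sum c B \<le> sum c B')"

definition tight :: "('e \<Rightarrow> real) \<Rightarrow> 'v set \<Rightarrow> ('v \<times> 'v) set" where
  "tight z S = {(t a, h a) |a. a \<in> A \<and> z a = 0 \<and> t a \<in> S \<and> h a \<in> S}"

lemma indegree_one_finite: "indegree_one B \<Longrightarrow> finite B"
  unfolding indegree_one_def using finite_A finite_subset by blast

lemma indegree_one_card_heads:
  assumes "indegree_one B" "S \<subseteq> V - {r}"
  shows "card {a\<in>B. h a \<in> S} = card S"
proof -
  have "{a\<in>B. h a \<in> S} = (\<Union>v\<in>S. {a\<in>B. h a = v})" by auto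
  also have "card \<dots> = (\<Sum>v\<in>S. card {a\<in>B. h a = v})"
    using indegree_one_finite[OF assms(1)] finite_subset[OF assms(2)] finite_V
    by (intro card_UN_disjoint) auto
  also have "\<dots> = (\<Sum>v\<in>S. 1)"
    using assms unfolding indegree_one_def by (intro sum.cong) auto
  finally show ?thesis by simp
qed

lemma indegree_one_card:
  assumes "indegree_one B"
  shows "card B = card V - 1"
proof -
  have "B = {a\<in>B. h a \<in> V - {r}}"
    using assms head_in_V unfolding indegree_one_def by blast
  with indegree_one_card_heads[OF assms order_refl] show ?thesis
    using finite_V r_in_V by (simp add: card_Diff_singleton)
qed

text \<open>Each node of \<open>S\<close> is the head of one arc, which either enters
  \<open>S\<close> or lies inside. Hence a single entering arc is the same as
  \<open>card S - 1\<close> arcs inside; this turns cut conditions into forest conditions.\<close>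

lemma indegree_one_enters_inside:
  assumes "indegree_one B" "S \<subseteq> V - {r}"
  shows "card {a\<in>B. enters a S} + card (inside S B) = card S"
proof -
  have "{a\<in>B. h a \<in> S} = {a\<in>B. enters a S} \<union> inside S B"
    by (auto simp: enters_def inside_def)
  moreover have "{a\<in>B. enters a S} \<inter> inside S B = {}"
    by (auto simp: enters_def inside_def)
  ultimately show ?thesis
    using indegree_one_card_heads[OF assms] indegree_one_finite[OF assms(1)]
    by (simp add: card_Un_disjoint inside_def)
qed

lemma arb_uforest:
  assumes "arb B"
  shows "uforest arc_ends B"
proof (rule uconnected_imp_uforest)
  show "\<forall>e\<in>B. \<exists>x\<in>V. \<exists>y\<in>V. arc_ends e = {x, y}"
    using assms tail_in_V head_in_V unfolding arb_def indegree_one_def by blast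
qed (use assms finite_V indegree_one_finite indegree_one_card in \<open>auto simp: arb_def\<close>)

text \<open>The incidence map is left free, so that the lemma serves the digraph as well as the
  output graph, while \<open>inside\<close> is read off from \<open>t\<close> and \<open>h\<close>
  in both cases.\<close>

lemma uforest_inside_card:
  assumes B: "uforest ends B" "finite B" and S: "S \<subseteq> V" "S \<noteq> {}"
    and e: "\<And>a. a \<in> inside S B \<Longrightarrow> \<exists>x\<in>S. \<exists>y\<in>S. ends a = {x, y}"
  shows "card (inside S B) \<le> card S - 1"
    and "card (inside S B) = card S - 1 \<Longrightarrow> uconnected S ends (inside S B)"
proof -
  have f: "uforest ends (inside S B)" using B(1) by (rule uforest_subset) (auto simp: inside_def)
  have fin: "finite S" "finite (inside S B)"
    using S B finite_V finite_subset by (auto simp: inside_def)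
  note * = uforest_card[OF f fin(1) S(2) _ fin(2)]
  show "card (inside S B) \<le> card S - 1" using e by (intro *(1)) blast
  show "uconnected S ends (inside S B)" if "card (inside S B) = card S - 1"
    using that e by (intro *(2)) blast
qed

text \<open>A forest has at most \<open>card S - 1\<close> arcs inside \<open>S\<close>, too few to
  supply all nodes of \<open>S\<close> with an arc. If only one arc enters, the arcs inside reach
  the bound and therefore form a spanning tree of \<open>S\<close>.\<close>

lemma arb_enters:
  assumes "arb B" "S \<subseteq> V - {r}" "S \<noteq> {}"
  shows "1 \<le> card {a\<in>B. enters a S}"
    and "card {a\<in>B. enters a S} = 1 \<Longrightarrow> uconnected S arc_ends (inside S B)"
proof -
  note d = assms(1)[unfolded arb_def, THEN conjunct1]
  have i: "\<exists>x\<in>S. \<exists>y\<in>S. arc_ends a = {x, y}" if "a \<in> inside S B" for a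
    using that by (auto simp: inside_def)
  have S: "S \<subseteq> V" using assms(2) by auto
  note * = uforest_inside_card[OF arb_uforest[OF assms(1)] indegree_one_finite[OF d] S assms(3) i]
  have "card S > 0" using S assms(3) finite_V finite_subset by (auto simp: card_gt_0_iff)
  with *(1) indegree_one_enters_inside[OF d assms(2)]
  show "1 \<le> card {a\<in>B. enters a S}" by linarith
  show "uconnected S arc_ends (inside S B)" if "card {a\<in>B. enters a S} = 1"
    using *(2) indegree_one_enters_inside[OF d assms(2)] that by simp
qed

lemma no_arb_if_not_entered:
  assumes "S \<subseteq> V" "S \<noteq> {}" "r \<notin> S" "\<And>a. a \<in> A \<Longrightarrow> \<not> enters a S"
  shows "\<not> arb B"
proof
  assume a: "arb B"
  then have "1 \<le> card {a\<in>B. enters a S}" using assms by (intro arb_enters(1)) auto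
  moreover have "{a\<in>B. enters a S} = {}"
    using a assms(4) unfolding arb_def indegree_one_def by auto
  ultimately show False by simp
qed

lemma tight_mono: "S \<subseteq> T \<Longrightarrow> (\<And>a. a \<in> A \<Longrightarrow> t a \<in> S \<Longrightarrow> h a \<in> S \<Longrightarrow> z a = 0 \<Longrightarrow> z' a = 0) \<Longrightarrow>
    tight z S \<subseteq> tight z' T"
  unfolding tight_def by blast

lemma tight_exit:
  assumes "(u, v) \<in> (tight z S)\<^sup>*" "u \<in> X" "v \<notin> X"
  shows "\<exists>a\<in>A. z a = 0 \<and> t a \<in> S \<and> h a \<in> S \<and> t a \<in> X \<and> h a \<notin> X"
  using assms by (induction) (auto simp: tight_def)

lemma tight_entry_closed:
  assumes "(u, v) \<in> (tight z S)\<^sup>*" "v \<in> X" "\<And>a. a \<in> A \<Longrightarrow> z a = 0 \<Longrightarrow> h a \<in> X \<Longrightarrow> t a \<in> X"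
  shows "u \<in> X"
  using assms(1,2) by (induction rule: converse_rtrancl_induct) (auto simp: tight_def assms(3))

end

text \<open>
  The state of the dual ascent: \<open>z\<close> are the reduced costs, \<open>F\<close> the sets that were raised, by \<open>y\<close>,
  and \<open>M\<close> the amount by which all costs were shifted. \<open>rep\<close> names for each node a representative
  of the maximal member of \<open>F\<close> around it, and \<open>e1\<close>, \<open>e2\<close> are the ends in the output graph.
\<close>

locale dual_state = rooted_network V A t h r
  for V :: "'v set" and A :: "'e set" and t h :: "'e \<Rightarrow> 'v" and r :: 'v +
  fixes c z :: "'e \<Rightarrow> real" and rep :: "'v \<Rightarrow> 'v" and e1 e2 :: "'e \<Rightarrow> 'v"
    and F :: "'v set set" and y :: "'v set \<Rightarrow> real" and M :: real and \<rho> :: "'v set \<Rightarrow> 'v"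
  assumes z_nonneg: "a \<in> A \<Longrightarrow> 0 \<le> z a"
    and cost_eq: "a \<in> A \<Longrightarrow> c a = z a + M + (\<Sum>S\<in>F. if enters a S then y S else 0)"
    and F_subset: "S \<in> F \<Longrightarrow> S \<subseteq> V - {r}"
    and F_nonempty: "S \<in> F \<Longrightarrow> S \<noteq> {}"
    and y_pos: "S \<in> F \<Longrightarrow> 0 < y S"
    and strong: "S \<in> F \<Longrightarrow> u \<in> S \<Longrightarrow> v \<in> S \<Longrightarrow> (u, v) \<in> (tight z S)\<^sup>*"
    and entered: "S \<in> F \<Longrightarrow> \<exists>a\<in>A. z a = 0 \<and> enters a S"
    and laminar: "S \<in> F \<Longrightarrow> T \<in> F \<Longrightarrow> S \<subseteq> T \<or> T \<subseteq> S \<or> S \<inter> T = {}"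
    and rep_in_V: "v \<in> V \<Longrightarrow> rep v \<in> V"
    and rep_idem: "v \<in> V \<Longrightarrow> rep (rep v) = rep v"
    and block: "v \<in> V \<Longrightarrow> {w\<in>V. rep w = rep v} \<in> F \<union> (\<lambda>v. {v}) ` V"
    and rep_const: "S \<in> F \<Longrightarrow> u \<in> S \<Longrightarrow> v \<in> S \<Longrightarrow> rep u = rep v"
    and rho_in: "S \<in> F \<Longrightarrow> \<rho> S \<in> S"
    and rep_rho: "S \<in> F \<Longrightarrow> v \<in> V \<Longrightarrow> rep v \<in> S \<Longrightarrow> rep v = \<rho> S"
    and ends_in_V: "a \<in> A \<Longrightarrow> e1 a \<in> V \<and> e2 a \<in> V"
    and ends_loop: "a \<in> A \<Longrightarrow> t a = h a \<Longrightarrow> e1 a = e2 a"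
    and ends_sep: "a \<in> A \<Longrightarrow> t a \<noteq> h a \<Longrightarrow>
      \<exists>C1 \<in> F \<union> (\<lambda>v. {v}) ` V. \<exists>C2 \<in> F \<union> (\<lambda>v. {v}) ` V. C1 \<inter> C2 = {} \<and>
        {t a, e1 a} \<subseteq> C1 \<and> {h a, e2 a} \<subseteq> C2 \<and> (\<forall>S\<in>F. t a \<in> S \<and> h a \<in> S \<longrightarrow> C1 \<union> C2 \<subseteq> S)"
    and ends_rho: "S \<in> F \<Longrightarrow> a \<in> A \<Longrightarrow> t a \<noteq> h a \<Longrightarrow> \<not> (t a \<in> S \<and> h a \<in> S) \<Longrightarrow>
      (e1 a \<in> S \<longrightarrow> e1 a = \<rho> S) \<and> (e2 a \<in> S \<longrightarrow> e2 a = \<rho> S)"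
begin

abbreviation new_ends :: "'e \<Rightarrow> 'v set" where
  "new_ends a \<equiv> {e1 a, e2 a}"

text \<open>With the singletons added, every block of \<open>rep\<close> is a member; they are also
  the trivial case of inductions over the family.\<close>

abbreviation Fs :: "'v set set" where
  "Fs \<equiv> F \<union> (\<lambda>v. {v}) ` V"

definition single_entry :: "'e set \<Rightarrow> bool" where
  "single_entry B \<longleftrightarrow> (\<forall>S\<in>F. card {a\<in>B. enters a S} = 1)"

lemma finite_F: "finite F"
  using F_subset finite_V by (intro finite_subset[of F "Pow V"]) auto

lemma Fs_subset: "C \<in> Fs \<Longrightarrow> C \<subseteq> V"
  using F_subset by auto

section \<open>An arborescence attaining the dual bound\<close>

text \<open>
  A search from \<open>r\<close> over zero arcs which always continues inside the smallest partly explored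
  member of \<open>F\<close> enters every member of \<open>F\<close> only once.
\<close>

lemma next_search_arc:
  assumes reach: "\<And>v. v \<in> V \<Longrightarrow> (r, v) \<in> (tight z V)\<^sup>*"
    and X: "r \<in> X" "X \<subseteq> V" "X \<noteq> V"
  shows "\<exists>a\<in>A. z a = 0 \<and> t a \<in> X \<and> h a \<in> V - X \<and> (\<forall>S\<in>F. enters a S \<longrightarrow> X \<inter> S = {})"
proof -
  define P where "P = {S\<in>F. X \<inter> S \<noteq> {} \<and> \<not> S \<subseteq> X}"
  show ?thesis
  proof (cases "P = {}")
    case True
    from X obtain v where "v \<in> V" "v \<notin> X" by auto
    from tight_exit[OF reach[OF this(1)] X(1) this(2)] obtain a where
      a: "a \<in> A" "z a = 0" "t a \<in> X" "h a \<in> V" "h a \<notin> X" by auto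
    \<comment> \<open>No member is partly explored: a member that meets \<open>X\<close> is
      contained in \<open>X\<close>, so an arc leaving \<open>X\<close> cannot enter it.\<close>
    have "X \<inter> S = {}" if "S \<in> F" "enters a S" for S
      using that True a unfolding P_def enters_def by blast
    with a show ?thesis by blast
  next
    case False
    define S where "S = arg_min_on card P"
    have finP: "finite P" unfolding P_def using finite_F by simp
    have S: "S \<in> P" "\<And>T. T \<in> P \<Longrightarrow> card S \<le> card T"
      using arg_min_if_finite[OF finP False, of card] unfolding S_def by (auto simp: not_less)
    then have SF: "S \<in> F" unfolding P_def by simp
    from S(1) obtain u v where "u \<in> S" "u \<in> X" "v \<in> S" "v \<notin> X" unfolding P_def by auto
    from tight_exit[OF strong[OF SF this(1,3)] this(2,4)] obtain a where
      a: "a \<in> A" "z a = 0" "t a \<in> S" "h a \<in> S" "t a \<in> X" "h a \<notin> X" by auto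
    have "X \<inter> T = {}" if T: "T \<in> F" "enters a T" for T
    proof (rule ccontr)
      assume "X \<inter> T \<noteq> {}"
      then have "T \<in> P" using T a unfolding P_def enters_def by auto
      \<comment> \<open>The head of \<open>a\<close> lies in both sets, its tail only in
        \<open>S\<close>. Laminarity leaves proper inclusion, against the choice of \<open>S\<close>
        as a smallest partly explored member.\<close>
      have "T \<subset> S" using laminar[OF SF T(1)] T(2) a(3,4) unfolding enters_def by blast
      then have "card T < card S"
        using F_subset[OF SF] finite_V by (meson finite_Diff finite_subset psubset_card_mono)
      with S(2)[OF \<open>T \<in> P\<close>] show False by simp
    qed
    moreover have "h a \<in> V" using a head_in_V by blast
    ultimately show ?thesis using a by blast
  qed
qed

text \<open>Grows a tree from \<open>r\<close> by the arcs of \<open>next_search_arc\<close>. Its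
  result shows that the lower bound used for slackness is actually a minimum.\<close>

lemma tight_arb_exists:
  assumes reach: "\<And>v. v \<in> V \<Longrightarrow> (r, v) \<in> (tight z V)\<^sup>*"
  shows "\<exists>B. arb B \<and> (\<forall>a\<in>B. z a = 0) \<and> single_entry B"
proof -
  define P where "P X B \<longleftrightarrow> r \<in> X \<and> X \<subseteq> V \<and> B \<subseteq> A \<and>
    (\<forall>a\<in>B. z a = 0 \<and> t a \<in> X \<and> h a \<in> X \<and> h a \<noteq> r) \<and>
    (\<forall>v\<in>X - {r}. card {a\<in>B. h a = v} = 1) \<and> (\<forall>v\<in>X. (r, v) \<in> (adj arc_ends B)\<^sup>*) \<and>
    (\<forall>S\<in>F. card {a\<in>B. enters a S} \<le> 1)" for X B
  have "k < card V \<Longrightarrow> \<exists>X B. P X B \<and> card X = Suc k" for k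
  proof (induction k)
    case 0
    have "P {r} {}" unfolding P_def using r_in_V by auto
    then show ?case by force
  next
    case (Suc k)
    then obtain X B where XB: "P X B" "card X = Suc k" by auto
    note p = XB(1)[unfolded P_def]
    have "X \<noteq> V" using XB Suc.prems by auto
    with next_search_arc[OF reach, of X] p obtain a where
      a: "a \<in> A" "z a = 0" "t a \<in> X" "h a \<in> V" "h a \<notin> X" "\<And>S. S \<in> F \<Longrightarrow> enters a S \<Longrightarrow> X \<inter> S = {}"
      by (metis DiffE)
    have finB: "finite B" using p finite_A finite_subset by blast
    have aB: "a \<notin> B" using a p by blast
    let ?X = "insert (h a) X" and ?B = "insert a B"
    have deg: "card {b\<in>?B. h b = v} = 1" if "v \<in> ?X - {r}" for v
    proof (cases "v = h a")
      case True
      then have "{b\<in>?B. h b = v} = {a}" using p a by auto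
      then show ?thesis by simp
    next
      case False
      then have "{b\<in>?B. h b = v} = {b\<in>B. h b = v}" by auto
      then show ?thesis using p that False by auto
    qed
    have old: "(r, v) \<in> (adj arc_ends ?B)\<^sup>*" if "v \<in> X" for v
      using p that by (meson adj_rtrancl_mono subset_insertI)
    have "(t a, h a) \<in> adj arc_ends ?B" by auto
    with old[OF a(3)] have "(r, h a) \<in> (adj arc_ends ?B)\<^sup>*" by (rule rtrancl.rtrancl_into_rtrancl)
    with old have con: "\<forall>v\<in>?X. (r, v) \<in> (adj arc_ends ?B)\<^sup>*" by blast
    have ent: "card {b\<in>?B. enters b S} \<le> 1" if S: "S \<in> F" for S
    proof (cases "enters a S")
      case True
      \<comment> \<open>If \<open>a\<close> enters \<open>S\<close>, then \<open>S\<close> is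
        unexplored, so no earlier arc has its head in \<open>S\<close>.\<close>
      then have "{b\<in>?B. enters b S} = {a}" using a(6)[OF S] p unfolding enters_def by auto
      then show ?thesis by simp
    next
      case False
      then have "{b\<in>?B. enters b S} = {b\<in>B. enters b S}" by auto
      then show ?thesis using p S by auto
    qed
    have "P ?X ?B" unfolding P_def
      using p a deg con ent by auto
    moreover have "card ?X = Suc (Suc k)"
      using XB(2) a(5) p finite_V finite_subset by (subst card_insert_disjoint) auto
    ultimately show ?case by blast
  qed
  moreover have "card V > 0" using r_in_V finite_V by (auto simp: card_gt_0_iff)
  ultimately obtain X B where XB: "P X B" "card X = Suc (card V - 1)"
    by (metis diff_less zero_less_one)
  then have "X = V" using finite_V \<open>card V > 0\<close> card_subset_eq[of V X] unfolding P_def by auto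
  note p = XB(1)[unfolded P_def \<open>X = V\<close>]
  have "uconnected V arc_ends B" unfolding uconnected_iff
    using p by (meson adj_rtrancl_sym rtrancl_trans)
  then have arb: "arb B" unfolding arb_def indegree_one_def using p by blast
  \<comment> \<open>The search guarantees at most one entry; that there is one holds for every
    arborescence.\<close>
  have "card {a\<in>B. enters a S} = 1" if S: "S \<in> F" for S
    using arb_enters(1)[OF arb F_subset[OF S] F_nonempty[OF S]] p S by (meson le_antisym)
  then have "single_entry B" by (simp add: single_entry_def)
  with arb p show ?thesis by blast
qed

section \<open>Complementary slackness\<close>

lemma cost_decomposition:
  assumes "B \<subseteq> A"
  shows "sum c B = sum z B + M * card B + (\<Sum>S\<in>F. y S * card {a\<in>B. enters a S})"
proof -
  have finB: "finite B" using assms finite_A finite_subset by blast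
  have "sum c B = (\<Sum>a\<in>B. z a + M + (\<Sum>S\<in>F. if enters a S then y S else 0))"
    using assms cost_eq by (intro sum.cong) auto
  also have "\<dots> = sum z B + M * card B + (\<Sum>a\<in>B. \<Sum>S\<in>F. if enters a S then y S else 0)"
    by (simp add: sum.distrib)
  also have "(\<Sum>a\<in>B. \<Sum>S\<in>F. if enters a S then y S else 0) =
      (\<Sum>S\<in>F. \<Sum>a\<in>B. if enters a S then y S else 0)" by (rule sum.swap)
  also have "\<dots> = (\<Sum>S\<in>F. y S * card {a\<in>B. enters a S})"
    using finB by (intro sum.cong) (auto simp: sum.If_cases Int_def)
  finally show ?thesis .
qed

lemma min_arb_iff:
  assumes reach: "\<And>v. v \<in> V \<Longrightarrow> (r, v) \<in> (tight z V)\<^sup>*"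
  shows "min_arb c B \<longleftrightarrow> arb B \<and> (\<forall>a\<in>B. z a = 0) \<and> single_entry B"
proof -
  \<comment> \<open>The dual value: \<open>M\<close> for each of the \<open>card V - 1\<close> arcs
    and \<open>y S\<close> for the one unavoidable entry into \<open>S\<close>.\<close>
  define \<beta> where "\<beta> = M * real (card V - 1) + (\<Sum>S\<in>F. y S)"
  have gap: "sum c B = \<beta> + sum z B + (\<Sum>S\<in>F. y S * (real (card {a\<in>B. enters a S}) - 1))"
    if "arb B" for B
    using cost_decomposition[of B] indegree_one_card[of B] that
    unfolding arb_def indegree_one_def \<beta>_def by (simp add: algebra_simps sum_subtractf)
  have z0: "0 \<le> sum z B" if "arb B" for B
    using that z_nonneg unfolding arb_def indegree_one_def by (intro sum_nonneg) auto
  have y0: "0 \<le> y S * (real (card {a\<in>B. enters a S}) - 1)" if "arb B" "S \<in> F" for B S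
    using arb_enters(1)[OF that(1) F_subset[OF that(2)] F_nonempty[OF that(2)]] y_pos[OF that(2)]
    by simp
  have ys0: "0 \<le> (\<Sum>S\<in>F. y S * (real (card {a\<in>B. enters a S}) - 1))" if "arb B" for B
    using y0[OF that] by (rule sum_nonneg)
  have lower: "\<beta> \<le> sum c B" if "arb B" for B
    using gap[OF that] z0[OF that] ys0[OF that] by linarith
  have attained: "sum c B = \<beta> \<longleftrightarrow> (\<forall>a\<in>B. z a = 0) \<and> single_entry B" if B: "arb B" for B
  proof -
    have finB: "finite B" using B indegree_one_finite by (simp add: arb_def)
    have "sum c B = \<beta> \<longleftrightarrow> sum z B = 0 \<and> (\<Sum>S\<in>F. y S * (real (card {a\<in>B. enters a S}) - 1)) = 0"
      using gap[OF B] z0[OF B] ys0[OF B] by linarith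
    also have "sum z B = 0 \<longleftrightarrow> (\<forall>a\<in>B. z a = 0)"
      using B z_nonneg finB unfolding arb_def indegree_one_def
      by (intro sum_nonneg_eq_0_iff) auto
    also have "(\<Sum>S\<in>F. y S * (real (card {a\<in>B. enters a S}) - 1)) = 0 \<longleftrightarrow> single_entry B"
      using y0[OF B] finite_F y_pos unfolding single_entry_def
      by (subst sum_nonneg_eq_0_iff) (auto simp: less_imp_neq[THEN not_sym])
    finally show ?thesis .
  qed
  obtain B0 where "arb B0" "sum c B0 = \<beta>"
    using tight_arb_exists[OF reach] attained by auto
  then show ?thesis using lower attained unfolding min_arb_def by (metis order_antisym)
qed

section \<open>Moving connectivity between the digraph and the output graph\<close>

text \<open>
  Both ends of an arc, in the digraph as well as in the output graph, lie in the same two disjoint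
  members of \<open>Fs\<close>. Hence connectivity of all members of \<open>F\<close> carries over from one graph to the
  other by induction on their size.
\<close>

lemma uconnected_transfer:
  assumes BA: "B \<subseteq> A" and L: "L \<in> insert V F"
    and sep: "\<And>a. a \<in> B \<Longrightarrow> \<exists>C1\<in>Fs. \<exists>C2\<in>Fs. C1 \<inter> C2 = {} \<and> {f1 a, g1 a} \<subseteq> C1 \<and> {f2 a, g2 a} \<subseteq> C2 \<and>
      (\<forall>S\<in>F. t a \<in> S \<and> h a \<in> S \<longrightarrow> C1 \<union> C2 \<subseteq> S)"
    and con: "\<And>L. L \<in> insert V F \<Longrightarrow> uconnected L (\<lambda>a. {f1 a, f2 a}) (inside L B)"
  shows "uconnected L (\<lambda>a. {g1 a, g2 a}) (inside L B)"
  using L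
proof (induction "card L" arbitrary: L rule: less_induct)
  case less
  have LV: "L \<subseteq> V" using less.prems F_subset by auto
  let ?g = "\<lambda>a. {g1 a, g2 a}"
  \<comment> \<open>Smaller members are connected by the induction hypothesis; in a singleton there
    is nothing to connect.\<close>
  have sub: "(u, v) \<in> (adj ?g (inside L B))\<^sup>*" if C: "C \<in> Fs" "C \<subset> L" "u \<in> C" "v \<in> C" for C u v
  proof (cases "C \<in> F")
    case True
    have "card C < card L" using C(2) LV finite_V by (meson finite_subset psubset_card_mono)
    from less.hyps[OF this] True C(3,4) have "(u, v) \<in> (adj ?g (inside C B))\<^sup>*"
      by (simp add: uconnected_iff)
    moreover have "inside C B \<subseteq> inside L B" using C(2) by (auto simp: inside_def)
    ultimately show ?thesis by (metis adj_rtrancl_mono)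
  qed (use C in auto)
  have "adj (\<lambda>a. {f1 a, f2 a}) (inside L B) \<subseteq> (adj ?g (inside L B))\<^sup>*"
  proof (rule subrelI)
    fix u v assume "(u, v) \<in> adj (\<lambda>a. {f1 a, f2 a}) (inside L B)"
    then obtain a where a: "a \<in> inside L B" "{f1 a, f2 a} = {u, v}" by auto
    then have aB: "a \<in> B" by (simp add: inside_def)
    from sep[OF aB] obtain C1 C2 where C: "C1 \<in> Fs" "C2 \<in> Fs" "C1 \<inter> C2 = {}"
      "f1 a \<in> C1" "g1 a \<in> C1" "f2 a \<in> C2" "g2 a \<in> C2" "\<forall>S\<in>F. t a \<in> S \<and> h a \<in> S \<longrightarrow> C1 \<union> C2 \<subseteq> S"
      by auto
    have CL': "C1 \<union> C2 \<subseteq> L"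
      using less.prems C(8) a(1) Fs_subset[OF C(1)] Fs_subset[OF C(2)] by (auto simp: inside_def)
    \<comment> \<open>Each of the two sets misses the other, nonempty one, so both are proper
      subsets of \<open>L\<close> and the induction hypothesis applies.\<close>
    have CL: "C1 \<subset> L" "C2 \<subset> L" using CL' C(3,4,6) by blast+
    \<comment> \<open>An edge of the first graph becomes a detour: within \<open>C1\<close> to
      \<open>g1 a\<close>, across the new edge, and within \<open>C2\<close> to
      \<open>f2 a\<close>.\<close>
    have "(f1 a, g1 a) \<in> (adj ?g (inside L B))\<^sup>*" "(g2 a, f2 a) \<in> (adj ?g (inside L B))\<^sup>*"
      using sub[OF C(1) CL(1) C(4,5)] sub[OF C(2) CL(2) C(7,6)] .
    moreover have "(g1 a, g2 a) \<in> (adj ?g (inside L B))\<^sup>*" using a(1) by (intro r_into_rtrancl) auto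
    ultimately have "(f1 a, f2 a) \<in> (adj ?g (inside L B))\<^sup>*"
      by (meson rtrancl_trans)
    moreover from this have "(f2 a, f1 a) \<in> (adj ?g (inside L B))\<^sup>*" by (rule adj_rtrancl_sym)
    moreover have "u = f1 a \<and> v = f2 a \<or> u = f2 a \<and> v = f1 a"
      using a(2) by (auto simp: doubleton_eq_iff)
    ultimately show "(u, v) \<in> (adj ?g (inside L B))\<^sup>*" by (elim disjE conjE) simp_all
  qed
  then show ?case
    using con[OF less.prems] unfolding uconnected_iff by (meson rtrancl_subset_rtrancl subsetD)
qed

lemma new_ends_inside:
  assumes "a \<in> A" "t a \<noteq> h a" "S \<in> F" "t a \<in> S" "h a \<in> S"
  shows "e1 a \<in> S \<and> e2 a \<in> S"
  using ends_sep[OF assms(1,2)] assms(3-5) by blast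

text \<open>Single entry makes the arborescence connected inside every raised set, which is what the
  transfer needs. The output graph is then connected with \<open>card V - 1\<close> edges, hence
  acyclic.\<close>

lemma min_arb_imp_new_forest:
  assumes B: "arb B" "single_entry B"
  shows "uforest new_ends B"
proof -
  have d: "indegree_one B" using B by (simp add: arb_def)
  then have BA: "B \<subseteq> A" by (simp add: indegree_one_def)
  have noloop: "t a \<noteq> h a" if "a \<in> B" for a
  proof
    assume l: "t a = h a"
    have "ucycle arc_ends [t a] [a]" using l by (simp add: ucycle_def)
    moreover have "set [a] \<subseteq> B" using that by simp
    ultimately show False using arb_uforest[OF B(1)] unfolding uforest_def by blast
  qed
  have inV: "inside V B = B" using BA tail_in_V head_in_V by (auto simp: inside_def)
  have con: "uconnected L arc_ends (inside L B)" if "L \<in> insert V F" for L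
  proof (cases "L = V")
    case True
    then show ?thesis using B(1) inV by (simp add: arb_def)
  next
    case False
    then have L: "L \<in> F" using that by simp
    show ?thesis using arb_enters(2)[OF B(1) F_subset[OF L] F_nonempty[OF L]] B(2) L
      by (simp add: single_entry_def)
  qed
  have "uconnected V new_ends (inside V B)"
  proof (rule uconnected_transfer[OF BA _ _ con])
    fix a assume a: "a \<in> B"
    show "\<exists>C1\<in>Fs. \<exists>C2\<in>Fs. C1 \<inter> C2 = {} \<and> {t a, e1 a} \<subseteq> C1 \<and> {h a, e2 a} \<subseteq> C2 \<and>
      (\<forall>S\<in>F. t a \<in> S \<and> h a \<in> S \<longrightarrow> C1 \<union> C2 \<subseteq> S)"
      using ends_sep[OF _ noloop[OF a]] a BA by blast
  qed simp_all
  then have "uconnected V new_ends B" by (simp only: inV)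
  moreover have "\<forall>e\<in>B. \<exists>x\<in>V. \<exists>y\<in>V. new_ends e = {x, y}"
    using BA ends_in_V by blast
  ultimately show ?thesis
    using uconnected_imp_uforest[of V new_ends B] finite_V indegree_one_finite[OF d]
      indegree_one_card[OF d] by simp
qed

text \<open>The converse: the forest is first shown to be connected within every raised set of the
  output graph, by counting, and then connectivity is transferred back to the digraph.\<close>

lemma new_forest_imp_arb:
  assumes d: "indegree_one B" and f: "uforest new_ends B"
  shows "arb B" and "single_entry B"
proof -
  have BA: "B \<subseteq> A" using d by (simp add: indegree_one_def)
  have finB: "finite B" using d by (rule indegree_one_finite)
  have noloop: "t a \<noteq> h a" if "a \<in> B" for a
  proof
    assume l: "t a = h a"
    \<comment> \<open>A loop of the digraph is kept as a loop of the output graph precisely so that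
      no forest contains it.\<close>
    have "ucycle new_ends [e1 a] [a]" using ends_loop[OF _ l] BA that by (auto simp: ucycle_def)
    moreover have "set [a] \<subseteq> B" using that by simp
    ultimately show False using f unfolding uforest_def by blast
  qed
  have inV: "inside V B = B" using BA tail_in_V head_in_V by (auto simp: inside_def)
  have ends_V: "\<exists>x\<in>V. \<exists>y\<in>V. new_ends a = {x, y}" if "a \<in> B" for a
    using that BA ends_in_V by blast
  have conV: "uconnected V new_ends B"
    using uforest_card(2)[OF f finite_V _ _ finB] r_in_V ends_V indegree_one_card[OF d] by blast
  have S_inside: "card (inside S B) = card S - 1" "uconnected S new_ends (inside S B)"
      if S: "S \<in> F" for S
  proof -
    have SV: "S \<subseteq> V" "S \<noteq> {}" using F_subset[OF S] F_nonempty[OF S] by auto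
    have finS: "finite S" using SV finite_V finite_subset by blast
    have e: "\<exists>x\<in>S. \<exists>y\<in>S. new_ends a = {x, y}" if "a \<in> inside S B" for a
      using that new_ends_inside[OF _ _ S] noloop BA unfolding inside_def by blast
    note * = uforest_inside_card[OF f finB SV e]
    \<comment> \<open>The remaining arcs form a forest in the graph where \<open>S\<close> is shrunk to \<open>\<rho> S\<close>.\<close>
    let ?O = "B - inside S B" and ?W = "insert (\<rho> S) (V - S)"
    have "uforest new_ends ?O" using f by (rule uforest_subset) auto
    moreover have "\<exists>x\<in>?W. \<exists>y\<in>?W. new_ends a = {x, y}" if "a \<in> ?O" for a
    proof -
      have a: "a \<in> A" "t a \<noteq> h a" "\<not> (t a \<in> S \<and> h a \<in> S)"
        using that BA noloop by (auto simp: inside_def)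
      then have "e1 a \<in> ?W" "e2 a \<in> ?W" using ends_rho[OF S a] ends_in_V[OF a(1)] by auto
      then show ?thesis by blast
    qed
    ultimately have "card ?O \<le> card ?W - 1"
      using finite_V finB by (intro uforest_card(1)[where ends = new_ends]) auto
    also have "card ?W = Suc (card V - card S)"
      using finite_V rho_in[OF S] SV finS by (simp add: card_Diff_subset)
    finally have "card ?O \<le> card V - card S" by simp
    moreover have "card ?O = card B - card (inside S B)"
      using finB by (intro card_Diff_subset) (auto simp: inside_def)
    moreover have "card (inside S B) \<le> card B"
      using finB by (intro card_mono) (auto simp: inside_def)
    moreover have "card S \<le> card V" "card S > 0"
      using SV finite_V finS by (auto intro: card_mono simp: card_gt_0_iff)
    \<comment> \<open>At most \<open>card S - 1\<close> arcs lie inside and at most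
      \<open>card V - card S\<close> outside. The bounds add up to \<open>card B\<close>, so both
      are attained.\<close>
    ultimately show "card (inside S B) = card S - 1"
      using *(1) indegree_one_card[OF d] by linarith
    then show "uconnected S new_ends (inside S B)" using *(2) by blast
  qed
  have con: "uconnected L new_ends (inside L B)" if "L \<in> insert V F" for L
    using that S_inside(2) conV inV by auto
  have "uconnected V arc_ends (inside V B)"
  proof (rule uconnected_transfer[OF BA _ _ con])
    fix a assume a: "a \<in> B"
    show "\<exists>C1\<in>Fs. \<exists>C2\<in>Fs. C1 \<inter> C2 = {} \<and> {e1 a, t a} \<subseteq> C1 \<and> {e2 a, h a} \<subseteq> C2 \<and>
      (\<forall>S\<in>F. t a \<in> S \<and> h a \<in> S \<longrightarrow> C1 \<union> C2 \<subseteq> S)"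
      using ends_sep[OF _ noloop[OF a]] a BA by (simp only: insert_commute) blast
  qed simp_all
  then show "arb B" using d inV by (simp add: arb_def)
  show "single_entry B"
    unfolding single_entry_def
  proof
    fix S assume S: "S \<in> F"
    then have "card S > 0" using F_subset[OF S] F_nonempty[OF S] finite_V
      by (meson card_gt_0_iff finite_Diff finite_subset)
    then show "card {a\<in>B. enters a S} = 1"
      using indegree_one_enters_inside[OF d F_subset[OF S]] S_inside(1)[OF S] by linarith
  qed
qed

text \<open>The cut conditions are gone: what remains is expressible by the ground set (zero arcs),
  by a partition matroid (indegrees) and by a cycle matroid.\<close>

theorem min_arb_iff_new_forest:
  assumes reach: "\<And>v. v \<in> V \<Longrightarrow> (r, v) \<in> (tight z V)\<^sup>*"
  shows "min_arb c B \<longleftrightarrow> indegree_one B \<and> (\<forall>a\<in>B. z a = 0) \<and> uforest new_ends B"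
  using min_arb_iff[OF reach] min_arb_imp_new_forest new_forest_imp_arb arb_def by blast

end

section \<open>One raise preserves the dual state\<close>

context dual_state
begin

text \<open>Everything rests on \<open>closed\<close>: since no zero arc enters \<open>L\<close>,
  older members either lie in \<open>L\<close> or avoid it, and the raise is positive. The node
  \<open>rep b\<close> of one of the swallowed blocks becomes the representative of
  \<open>L\<close>. The second claim bounds the number of raises.\<close>

lemma dual_state_step:
  assumes L: "L \<subseteq> V - {r}" "b \<in> L"
    and closed: "\<And>a. a \<in> A \<Longrightarrow> z a = 0 \<Longrightarrow> h a \<in> L \<Longrightarrow> t a \<in> L"
    and strong_L: "\<And>u v. u \<in> L \<Longrightarrow> v \<in> L \<Longrightarrow> (u, v) \<in> (tight z L)\<^sup>*"
    and \<epsilon>_le: "\<And>a. a \<in> A \<Longrightarrow> enters a L \<Longrightarrow> \<epsilon> \<le> z a"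
    and \<epsilon>_att: "a\<^sub>0 \<in> A" "enters a\<^sub>0 L" "z a\<^sub>0 = \<epsilon>"
    and z': "\<And>a. a \<in> A \<Longrightarrow> z' a = (if enters a L then z a - \<epsilon> else z a)"
    and rep': "\<And>v. v \<in> V \<Longrightarrow> rep' v = (if v \<in> L then rep b else rep v)"
    and e': "\<And>a. a \<in> A \<Longrightarrow> e1' a = (if rep' (t a) \<noteq> rep' (h a) then rep' (t a) else e1 a)"
      "\<And>a. a \<in> A \<Longrightarrow> e2' a = (if rep' (t a) \<noteq> rep' (h a) then rep' (h a) else e2 a)"
  shows "dual_state V A t h r c z' rep' e1' e2' (insert L F) (y(L := \<epsilon>)) M (\<rho>(L := rep b))"
    and "card {a\<in>A. 0 < z' a} < card {a\<in>A. 0 < z a}"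
proof -
  have LV: "L \<subseteq> V" using L by auto
  have bV: "b \<in> V" using L by auto
  \<comment> \<open>An entering arc cannot have reduced cost 0, by \<open>closed\<close>; this holds
    in particular for the one attaining the minimum.\<close>
  have \<epsilon>_pos: "0 < \<epsilon>"
    using z_nonneg[OF \<epsilon>_att(1)] closed[OF \<epsilon>_att(1)] \<epsilon>_att(2,3) unfolding enters_def by fastforce
  \<comment> \<open>Members are strongly connected by zero arcs, so a single node in
    \<open>L\<close> pulls all nodes of the member into \<open>L\<close>.\<close>
  have meets: "C \<subseteq> L" if "C \<in> Fs" "C \<inter> L \<noteq> {}" for C
  proof (cases "C \<in> F")
    case True
    from that obtain v where v: "v \<in> C" "v \<in> L" by auto
    have "u \<in> L" if "u \<in> C" for u
      using tight_entry_closed[OF strong[OF True that v(1)] v(2) closed] .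
    then show ?thesis by auto
  qed (use that in auto)
  have block_L: "{w\<in>V. rep w = rep v} \<subseteq> L" if "v \<in> L" for v
    using meets[OF block[of v]] that LV by blast
  have rep_L: "rep v \<in> L \<longleftrightarrow> v \<in> L" if "v \<in> V" for v
  proof
    assume "rep v \<in> L"
    with block_L[of "rep v"] show "v \<in> L" using that rep_idem[OF that] by auto
  next
    assume "v \<in> L"
    with block_L[of v] show "rep v \<in> L" using that rep_idem[OF that] rep_in_V[OF that] by auto
  qed
  \<comment> \<open>Every old member has an entering zero arc and \<open>L\<close> has none. Hence
    changing \<open>y\<close> and \<open>\<rho>\<close> at \<open>L\<close> overwrites no older
    value.\<close>
  have new: "L \<notin> F" using entered closed unfolding enters_def by blast
  have cb: "rep b \<in> L" using rep_L bV L by blast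
  have rep'_on_L: "rep' v = rep b" if "v \<in> L" for v
    using that rep' LV by auto
  have rep'_in: "rep' v \<in> V" if "v \<in> V" for v
    using that rep' rep_in_V bV by auto
  have idem: "rep' (rep' v) = rep' v" if "v \<in> V" for v
  proof (cases "v \<in> L")
    case True
    then show ?thesis using rep'_on_L cb by simp
  next
    case False
    then have "rep v \<notin> L" using rep_L[OF that] by simp
    then show ?thesis using False rep'[OF that] rep'[OF rep_in_V[OF that]] rep_idem[OF that] by simp
  qed
  have rep'_eq: "rep' u = rep' v" if "u \<in> V" "v \<in> V" "rep u = rep v" for u v
    using that rep' rep_L by metis
  have rep'_L: "rep' v \<in> L \<longleftrightarrow> v \<in> L" if "v \<in> V" for v
    using that rep' rep_L cb by auto
  \<comment> \<open>The blocks that meet \<open>L\<close> are swallowed by it and merge into one;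
    all other blocks stay.\<close>
  have block': "{w\<in>V. rep' w = rep' v} = (if v \<in> L then L else {w\<in>V. rep w = rep v})"
      if "v \<in> V" for v
  proof (cases "v \<in> L")
    case True
    have "w \<in> L" if "w \<in> V" "rep' w = rep' v" for w
      using rep'_L[of w] rep'_L[of v] that True \<open>v \<in> V\<close> by metis
    then show ?thesis using True LV rep'_on_L by auto
  next
    case False
    have "w \<notin> L" if "w \<in> V" "rep' w = rep' v \<or> rep w = rep v" for w
      using rep'_L[of w] rep'_L[of v] rep_L[of w] rep_L[of v] that False \<open>v \<in> V\<close> by metis
    then have "rep' w = rep' v \<longleftrightarrow> rep w = rep v" if "w \<in> V" for w
      using rep'[OF that] rep'[OF \<open>v \<in> V\<close>] that False by metis
    then show ?thesis using False by auto
  qed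
  have block'_in: "{w\<in>V. rep' w = rep' v} \<in> insert L F \<union> (\<lambda>v. {v}) ` V" if "v \<in> V" for v
    using block'[OF that] block[OF that] by auto
  have const': "rep' u = rep' v" if "S \<in> insert L F" "u \<in> S" "v \<in> S" for S u v
  proof (cases "S = L")
    case True
    then show ?thesis using that rep'_on_L by simp
  next
    case False
    then have "S \<in> F" using that(1) by simp
    moreover from this have "u \<in> V" "v \<in> V" using F_subset that(2,3) by auto
    ultimately show ?thesis using rep_const that(2,3) rep'_eq by metis
  qed
  \<comment> \<open>Every new representative is an old one, \<open>rep b\<close> or
    \<open>rep v\<close>; inside an older member \<open>S\<close> it can therefore only be
    \<open>\<rho> S\<close>.\<close>
  have rho': "rep' v = (\<rho>(L := rep b)) S" if "S \<in> insert L F" "v \<in> V" "rep' v \<in> S" for S v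
  proof (cases "S = L")
    case True
    then show ?thesis using that rep'_L rep' by auto
  next
    case False
    then have "S \<in> F" using that by simp
    then show ?thesis using that(2,3) rep' rep_rho[of S] bV new False by auto
  qed
  have z'_zero: "z' a = 0" if "a \<in> A" "z a = 0" for a
    using that z' closed unfolding enters_def by auto
  \<comment> \<open>The ends follow the representatives while these differ, and are frozen from the
    moment the representatives agree.\<close>
  have not_cross: "e1' a = e1 a \<and> e2' a = e2 a" if "a \<in> A" "rep' (t a) = rep' (h a)" for a
    using that e' by simp
  have cross: "e1' a = rep' (t a) \<and> e2' a = rep' (h a)" if "a \<in> A" "rep' (t a) \<noteq> rep' (h a)" for a
    using that e' by simp
  show "dual_state V A t h r c z' rep' e1' e2' (insert L F) (y(L := \<epsilon>)) M (\<rho>(L := rep b))"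
  proof unfold_locales
    fix a assume a: "a \<in> A"
    show "0 \<le> z' a" using a z' z_nonneg \<epsilon>_le by auto
    have "(\<Sum>S\<in>F. if enters a S then (y(L := \<epsilon>)) S else 0) = (\<Sum>S\<in>F. if enters a S then y S else 0)"
      using new by (intro sum.cong) auto
    then show "c a = z' a + M + (\<Sum>S\<in>insert L F. if enters a S then (y(L := \<epsilon>)) S else 0)"
      using cost_eq[OF a] z'[OF a] new finite_F by auto
  next
    fix S assume S: "S \<in> insert L F"
    show "S \<subseteq> V - {r}" "S \<noteq> {}" using S L F_subset F_nonempty by auto
    show "0 < (y(L := \<epsilon>)) S" using S y_pos \<epsilon>_pos by auto
    show "\<exists>a\<in>A. z' a = 0 \<and> enters a S"
    proof (cases "S = L")
      case True
      then show ?thesis using \<epsilon>_att z' by (intro bexI[of _ a\<^sub>0]) auto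
    next
      case False
      then show ?thesis using S entered z'_zero by blast
    qed
    show "(\<rho>(L := rep b)) S \<in> S" using S rho_in cb by auto
    fix T assume T: "T \<in> insert L F"
    show "S \<subseteq> T \<or> T \<subseteq> S \<or> S \<inter> T = {}"
      using S T laminar[of S T] meets[of S] meets[of T] by auto
  next
    fix S u v assume S: "S \<in> insert L F" "u \<in> S" "v \<in> S"
    have "(u, v) \<in> (tight z S)\<^sup>*" using S strong strong_L by auto
    moreover have "tight z S \<subseteq> tight z' S" using z'_zero by (intro tight_mono) auto
    ultimately show "(u, v) \<in> (tight z' S)\<^sup>*" using rtrancl_mono by blast
    show "rep' u = rep' v" using const' S .
  next
    fix v assume v: "v \<in> V"
    show "rep' v \<in> V" using rep'_in[OF v] .
    show "rep' (rep' v) = rep' v" using idem[OF v] .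
    show "{w\<in>V. rep' w = rep' v} \<in> insert L F \<union> (\<lambda>v. {v}) ` V" using block'_in[OF v] .
  next
    fix S v assume "S \<in> insert L F" "v \<in> V" "rep' v \<in> S"
    then show "rep' v = (\<rho>(L := rep b)) S" by (rule rho')
  next
    fix a assume a: "a \<in> A"
    show "e1' a \<in> V \<and> e2' a \<in> V"
      using e'[OF a] ends_in_V[OF a] rep'_in tail_in_V[OF a] head_in_V[OF a] by auto
  next
    fix a assume a: "a \<in> A" "t a = h a"
    then show "e1' a = e2' a" using e' ends_loop by auto
  next
    fix a assume a: "a \<in> A" "t a \<noteq> h a"
    let ?Fs = "insert L F \<union> (\<lambda>v. {v}) ` V"
    have tV: "t a \<in> V" and hV: "h a \<in> V" using a tail_in_V head_in_V by auto
    show "\<exists>C1\<in>?Fs. \<exists>C2\<in>?Fs. C1 \<inter> C2 = {} \<and> {t a, e1' a} \<subseteq> C1 \<and> {h a, e2' a} \<subseteq> C2 \<and>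
        (\<forall>S\<in>insert L F. t a \<in> S \<and> h a \<in> S \<longrightarrow> C1 \<union> C2 \<subseteq> S)"
    proof (cases "rep' (t a) = rep' (h a)")
      case True
      from ends_sep[OF a] obtain C1 C2 where C: "C1 \<in> Fs" "C2 \<in> Fs" "C1 \<inter> C2 = {}"
        "{t a, e1 a} \<subseteq> C1" "{h a, e2 a} \<subseteq> C2" "\<forall>S\<in>F. t a \<in> S \<and> h a \<in> S \<longrightarrow> C1 \<union> C2 \<subseteq> S"
        by (elim bexE conjE)
      have "C1 \<union> C2 \<subseteq> L" if "t a \<in> L" "h a \<in> L"
        using meets[OF C(1)] meets[OF C(2)] C(4,5) that by blast
      then have "\<forall>S\<in>insert L F. t a \<in> S \<and> h a \<in> S \<longrightarrow> C1 \<union> C2 \<subseteq> S" using C(6) by blast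
      moreover have C': "C1 \<in> ?Fs" "C2 \<in> ?Fs" using C(1,2) by auto
      ultimately show ?thesis
        using C(3-5) not_cross[OF a(1) True] by - (rule bexI[OF _ C'(1)], rule bexI[OF _ C'(2)],
            simp)
    next
      case False
      let ?C = "\<lambda>v. {w\<in>V. rep' w = rep' v}"
      have "?C (t a) \<inter> ?C (h a) = {}" using False by auto
      moreover have "{t a, e1' a} \<subseteq> ?C (t a)" "{h a, e2' a} \<subseteq> ?C (h a)"
        using cross[OF a(1) False] tV hV rep'_in idem by auto
      moreover have "\<forall>S\<in>insert L F. t a \<in> S \<and> h a \<in> S \<longrightarrow> ?C (t a) \<union> ?C (h a) \<subseteq> S"
        using const'[of _ "t a" "h a"] False by blast
      ultimately show ?thesis
        by - (rule bexI[OF _ block'_in[OF tV]], rule bexI[OF _ block'_in[OF hV]], simp)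
    qed
  next
    fix S a assume a: "S \<in> insert L F" "a \<in> A" "t a \<noteq> h a" "\<not> (t a \<in> S \<and> h a \<in> S)"
    have tV: "t a \<in> V" and hV: "h a \<in> V" using a tail_in_V head_in_V by auto
    show "(e1' a \<in> S \<longrightarrow> e1' a = (\<rho>(L := rep b)) S) \<and> (e2' a \<in> S \<longrightarrow> e2' a = (\<rho>(L := rep b)) S)"
    proof (cases "rep' (t a) = rep' (h a)")
      case False
      then show ?thesis using cross[OF a(2) False] rho'[OF a(1)] tV hV by auto
    next
      case True
      note e = not_cross[OF a(2) True]
      show ?thesis
      proof (cases "S = L")
        case False
        then show ?thesis using a e ends_rho[of S a] by auto
      next
        case SL: True
        have nL: "t a \<notin> L" "h a \<notin> L"
          using a(4) SL rep'_L[OF tV] rep'_L[OF hV] True by auto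
        have "rep (t a) = rep (h a)" using nL True rep' tV hV by simp
        define K where "K = {w\<in>V. rep w = rep (t a)}"
        with \<open>rep (t a) = rep (h a)\<close> have K: "t a \<in> K" "h a \<in> K" using tV hV by auto
        have KFs: "K \<in> Fs" using block[OF tV] by (simp only: K_def)
        have "K \<in> F" using KFs K a(3) by auto
        moreover have "K \<inter> L = {}" using meets[OF KFs] nL(1) K by blast
        ultimately have "e1 a \<notin> L" "e2 a \<notin> L" using new_ends_inside[OF a(2,3) _ K] by blast+
        then show ?thesis using e SL by auto
      qed
    qed
  qed
  \<comment> \<open>Reduced costs only fall, and that of the attaining arc falls to 0.\<close>
  have "{a\<in>A. 0 < z' a} \<subseteq> {a\<in>A. 0 < z a}" using z' \<epsilon>_pos by (auto split: if_splits)
  moreover have "a\<^sub>0 \<in> {a\<in>A. 0 < z a}" "a\<^sub>0 \<notin> {a\<in>A. 0 < z' a}"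
    using \<epsilon>_att \<epsilon>_pos z' by auto
  ultimately show "card {a\<in>A. 0 < z' a} < card {a\<in>A. 0 < z a}"
    using finite_A by (intro psubset_card_mono) auto
qed

end

text \<open>With nothing raised, blocks are single nodes and the output graph is the digraph, except
  that loops may sit at any node: the program leaves both their end cells at 0.\<close>

lemma (in rooted_network) dual_state_init:
  assumes z: "\<And>a. a \<in> A \<Longrightarrow> 0 \<le> z a" "\<And>a. a \<in> A \<Longrightarrow> c a = z a + M"
    and rep: "\<And>v. v \<in> V \<Longrightarrow> rep v = v"
    and e: "\<And>a. a \<in> A \<Longrightarrow> t a \<noteq> h a \<Longrightarrow> e1 a = t a \<and> e2 a = h a"
      "\<And>a. a \<in> A \<Longrightarrow> t a = h a \<Longrightarrow> e1 a = e2 a \<and> e1 a \<in> V"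
  shows "dual_state V A t h r c z rep e1 e2 {} y M \<rho>"
proof unfold_locales
  fix a assume a: "a \<in> A" "t a \<noteq> h a"
  show "\<exists>C1\<in>{} \<union> (\<lambda>v. {v}) ` V. \<exists>C2\<in>{} \<union> (\<lambda>v. {v}) ` V. C1 \<inter> C2 = {} \<and>
      {t a, e1 a} \<subseteq> C1 \<and> {h a, e2 a} \<subseteq> C2 \<and> (\<forall>S\<in>{}. t a \<in> S \<and> h a \<in> S \<longrightarrow> C1 \<union> C2 \<subseteq> S)"
    using a e tail_in_V head_in_V by auto
next
  fix a assume a: "a \<in> A"
  then show "e1 a \<in> V \<and> e2 a \<in> V" using e tail_in_V head_in_V by (cases "t a = h a") metis+
next
  fix v assume v: "v \<in> V"
  have "{w \<in> V. rep w = rep v} = {v}" using rep v by auto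
  then show "{w \<in> V. rep w = rep v} \<in> {} \<union> (\<lambda>v. {v}) ` V" using v by auto
qed (use z rep e tail_in_V head_in_V in auto)

text \<open>
  A smallest set of ancestors avoiding \<open>r\<close> is strongly connected, since the set of ancestors of
  any of its elements is contained in it.
\<close>

lemma (in rooted_network) smallest_ancestors:
  assumes b: "b \<in> V" and R: "\<And>v. v \<in> V \<Longrightarrow> R v = {u\<in>V. (u, v) \<in> (tight z V)\<^sup>*}"
    and r: "r \<notin> R b" and least: "\<And>v. v \<in> V \<Longrightarrow> r \<notin> R v \<Longrightarrow> card (R b) \<le> card (R v)"
  shows "R b \<subseteq> V - {r}" "b \<in> R b"
    and "\<And>a. a \<in> A \<Longrightarrow> z a = 0 \<Longrightarrow> h a \<in> R b \<Longrightarrow> t a \<in> R b"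
    and "\<And>u v. u \<in> R b \<Longrightarrow> v \<in> R b \<Longrightarrow> (u, v) \<in> (tight z (R b))\<^sup>*"
proof -
  show "R b \<subseteq> V - {r}" "b \<in> R b" using b R r by auto
  show closed: "t a \<in> R b" if "a \<in> A" "z a = 0" "h a \<in> R b" for a
  proof -
    have "(t a, h a) \<in> tight z V" using that tail_in_V head_in_V unfolding tight_def by blast
    then show ?thesis using that R[OF b] tail_in_V by (auto intro: converse_rtrancl_into_rtrancl)
  qed
  \<comment> \<open>By closure, a zero walk that ends in \<open>R b\<close> lies in
    \<open>R b\<close> entirely, so it is also a walk of the restricted relation.\<close>
  have stay: "(u, v) \<in> (tight z (R b))\<^sup>*" if "(u, v) \<in> (tight z V)\<^sup>*" "v \<in> R b" for u v
    using that
  proof (induction rule: converse_rtrancl_induct)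
    case (step u w)
    have "w \<in> R b" using tight_entry_closed[OF step.hyps(2) step.prems closed] .
    then have "(u, w) \<in> tight z (R b)" using step.hyps(1) closed unfolding tight_def by blast
    then show ?case using step by (meson converse_rtrancl_into_rtrancl)
  qed simp
  show "(u, v) \<in> (tight z (R b))\<^sup>*" if uv: "u \<in> R b" "v \<in> R b" for u v
  proof -
    have vV: "v \<in> V" "(v, b) \<in> (tight z V)\<^sup>*" using uv R[OF b] by auto
    have sub: "R v \<subseteq> R b" using R[OF vV(1)] R[OF b] vV(2) by auto
    then have "r \<notin> R v" using r by blast
    then have "card (R b) \<le> card (R v)" using least vV by blast
    moreover have "finite (R b)" using R[OF b] finite_V by simp
    ultimately have "R v = R b" using sub by (meson card_seteq)
    then have "(u, v) \<in> (tight z V)\<^sup>*" using uv(1) R[OF vV(1)] by auto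
    then show ?thesis using stay uv(2) by blast
  qed
qed

section \<open>Time-bounded program correctness\<close>

text \<open>Total correctness with a step bound, as a predicate of the start state. Because
  \<open>exec\<close> is deterministic, the asserted run is the only one.\<close>

definition wt :: "com \<Rightarrow> nat \<Rightarrow> (state \<Rightarrow> bool) \<Rightarrow> state \<Rightarrow> bool" where
  "wt C T Q s \<longleftrightarrow> (\<exists>t s'. exec C s t s' \<and> t \<le> T \<and> Q s')"

text \<open>The arrays that a program may write, read off its syntax. Together with
  \<open>agree\<close> they give frame conditions, so that assertions need not list what stays
  unchanged.\<close>

fun nwrites :: "com \<Rightarrow> name set" where
  "nwrites (NAssign x i a) = {x}"
| "nwrites (Seq C1 C2) = nwrites C1 \<union> nwrites C2"
| "nwrites (Cond b C1 C2) = nwrites C1 \<union> nwrites C2"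
| "nwrites (While b C) = nwrites C"
| "nwrites _ = {}"

fun rwrites :: "com \<Rightarrow> name set" where
  "rwrites (RAssign x i a) = {x}"
| "rwrites (Seq C1 C2) = rwrites C1 \<union> rwrites C2"
| "rwrites (Cond b C1 C2) = rwrites C1 \<union> rwrites C2"
| "rwrites (While b C) = rwrites C"
| "rwrites _ = {}"

definition agree :: "name set \<Rightarrow> name set \<Rightarrow> state \<Rightarrow> state \<Rightarrow> bool" where
  "agree W R s s' \<longleftrightarrow> (\<forall>x. x \<notin> W \<longrightarrow> nats s' x = nats s x) \<and> (\<forall>x. x \<notin> R \<longrightarrow> reals s' x = reals s x)"

lemma nats_nupdate [simp]: "nats (nupdate x i k s) = (nats s)(x := (nats s x)(i := k))"
  and reals_nupdate [simp]: "reals (nupdate x i k s) = reals s"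
  and nats_rupdate [simp]: "nats (rupdate x i z s) = nats s"
  and reals_rupdate [simp]: "reals (rupdate x i z s) = (reals s)(x := (reals s x)(i := z))"
  by (simp_all add: nupdate_def rupdate_def)

lemma agree_refl [simp]: "agree W R s s"
  by (simp add: agree_def)

lemma agree_trans: "agree W R s s' \<Longrightarrow> agree W' R' s' s'' \<Longrightarrow> W \<subseteq> W'' \<Longrightarrow> W' \<subseteq> W'' \<Longrightarrow> R \<subseteq> R'' \<Longrightarrow>
    R' \<subseteq> R'' \<Longrightarrow> agree W'' R'' s s''"
  unfolding agree_def by (metis subsetD)

lemma exec_agree: "exec C s t s' \<Longrightarrow> agree (nwrites C) (rwrites C) s s'"
  by (induction rule: exec.induct) (auto simp: agree_def)

lemma wt_frame: "wt C T Q s \<Longrightarrow> wt C T (\<lambda>s'. Q s' \<and> agree (nwrites C) (rwrites C) s s') s"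
  unfolding wt_def using exec_agree by blast

lemma wt_mono: "wt C T Q s \<Longrightarrow> T \<le> T' \<Longrightarrow> (\<And>s'. Q s' \<Longrightarrow> agree (nwrites C) (rwrites C) s s' \<Longrightarrow> Q' s') \<Longrightarrow>
    wt C T' Q' s"
  using wt_frame[of C T Q s] unfolding wt_def by (meson le_trans)

lemma wt_SeqI:
  assumes "wt C1 T1 P s" "\<And>s'. P s' \<Longrightarrow> agree (nwrites C1) (rwrites C1) s s' \<Longrightarrow>
      wt C2 T2 Q s'" "T1 + T2 \<le> T"
  shows "wt (Seq C1 C2) T Q s"
proof -
  from assms(1) obtain t s' where 1: "exec C1 s t s'" "t \<le> T1" "P s'" by (auto simp: wt_def)
  with assms(2) obtain u s'' where "exec C2 s' u s''" "u \<le> T2" "Q s''"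
    using exec_agree by (metis wt_def)
  with 1 assms(3) show ?thesis unfolding wt_def by (meson exec_Seq add_mono le_trans)
qed

lemma exec_Skip_iff: "exec Skip s t s' \<longleftrightarrow> t = 1 \<and> s' = s"
  and exec_NAssign_iff: "exec (NAssign x i a) s t s' \<longleftrightarrow> t = 1 \<and>
      s' = nupdate x (nval i s) (nval a s) s"
  and exec_RAssign_iff: "exec (RAssign x i z) s t s' \<longleftrightarrow> t = 1 \<and>
      s' = rupdate x (nval i s) (rval z s) s"
  and exec_Seq_iff: "exec (Seq C1 C2) s t s' \<longleftrightarrow> (\<exists>u v s''. t = u + v \<and> exec C1 s u s'' \<and>
      exec C2 s'' v s')"
  and exec_Cond_iff: "exec (Cond b C1 C2) s t s' \<longleftrightarrow>
    (\<exists>u. t = u + 1 \<and> (if bval b s then exec C1 s u s' else exec C2 s u s'))"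
  by (subst exec.simps; auto)+

lemma wt_Suc_time:
  fixes T :: nat
  shows "(\<exists>t s'. (\<exists>u. t = u + 1 \<and> P u s') \<and> t \<le> T \<and> Q s') \<longleftrightarrow> 1 \<le> T \<and> (\<exists>t s'. P t s' \<and> t \<le> T - 1 \<and>
      Q s')"
proof -
  have "u + 1 \<le> T \<longleftrightarrow> 1 \<le> T \<and> u \<le> T - 1" for u by auto
  then show ?thesis by metis
qed

lemma wt_Skip [simp]: "wt Skip T Q s \<longleftrightarrow> 1 \<le> T \<and> Q s"
  unfolding wt_def by (simp add: exec_Skip_iff)

lemma wt_NAssign [simp]: "wt (NAssign x i a) T Q s \<longleftrightarrow> 1 \<le> T \<and> Q (nupdate x (nval i s) (nval a s) s)"
  unfolding wt_def by (simp add: exec_NAssign_iff)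

lemma wt_RAssign [simp]: "wt (RAssign x i a) T Q s \<longleftrightarrow> 1 \<le> T \<and> Q (rupdate x (nval i s) (rval a s) s)"
  unfolding wt_def by (simp add: exec_RAssign_iff)

lemma wt_Cond [simp]:
  "wt (Cond b C1 C2) T Q s \<longleftrightarrow> 1 \<le> T \<and> (if bval b s then wt C1 (T - 1) Q s else wt C2 (T - 1) Q s)"
  unfolding wt_def exec_Cond_iff wt_Suc_time by auto

text \<open>As an equivalence this lets the simplifier run straight-line code symbolically. Only a
  sequence that starts with a compound command needs an intermediate assertion.\<close>

lemma wt_Seq_NAssign [simp]:
  "wt (Seq (NAssign x i a) C) T Q s \<longleftrightarrow> 1 \<le> T \<and> wt C (T - 1) Q (nupdate x (nval i s) (nval a s) s)"
proof -
  have "exec (Seq (NAssign x i a) C) s t s' \<longleftrightarrow> (\<exists>u. t = u + 1 \<and>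
      exec C (nupdate x (nval i s) (nval a s) s) u s')" for t s'
    by (auto simp: exec_Seq_iff exec_NAssign_iff)
  then show ?thesis unfolding wt_def by (simp only: wt_Suc_time)
qed

lemma wt_Seq_RAssign [simp]:
  "wt (Seq (RAssign x i a) C) T Q s \<longleftrightarrow> 1 \<le> T \<and> wt C (T - 1) Q (rupdate x (nval i s) (rval a s) s)"
proof -
  have "exec (Seq (RAssign x i a) C) s t s' \<longleftrightarrow> (\<exists>u. t = u + 1 \<and>
      exec C (rupdate x (nval i s) (rval a s) s) u s')" for t s'
    by (auto simp: exec_Seq_iff exec_RAssign_iff)
  then show ?thesis unfolding wt_def by (simp only: wt_Suc_time)
qed

text \<open>There are at most \<open>\<mu> s\<close> rounds, each costing the body and one test; the
  leading 1 is the failing test. The frame relative to the first state is carried along, so the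
  invariant can omit unchanged arrays.\<close>

lemma wt_While:
  assumes "I s"
    and step: "\<And>s'. I s' \<Longrightarrow> agree (nwrites C) (rwrites C) s s' \<Longrightarrow> bval b s' \<Longrightarrow>
        wt C T (\<lambda>s''. I s'' \<and> \<mu> s'' < (\<mu> s' :: nat)) s'"
    and K: "1 + \<mu> s * (T + 1) \<le> K"
  shows "wt (While b C) K (\<lambda>s'. I s' \<and> \<not> bval b s') s"
proof -
  have "wt (While b C) (1 + \<mu> s' * (T + 1)) (\<lambda>s'. I s' \<and> \<not> bval b s') s'"
    if "I s'" "agree (nwrites C) (rwrites C) s s'" for s'
    using that
  proof (induction "\<mu> s'" arbitrary: s' rule: less_induct)
    case less
    show ?case
    proof (cases "bval b s'")
      case True
      from step[OF less.prems True] obtain t s'' where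
        1: "exec C s' t s''" "t \<le> T" "I s''" "\<mu> s'' < \<mu> s'" by (auto simp: wt_def)
      have "agree (nwrites C) (rwrites C) s s''"
        using agree_trans[OF less.prems(2) exec_agree[OF 1(1)]] by simp
      from less.hyps[OF 1(4,3) this] obtain u s3 where
        2: "exec (While b C) s'' u s3" "u \<le> 1 + \<mu> s'' * (T + 1)" "I s3" "\<not> bval b s3"
        by (auto simp: wt_def)
      have "(\<mu> s'' + 1) * (T + 1) \<le> \<mu> s' * (T + 1)" using 1(4) by (intro mult_right_mono) auto
      with 1(2) 2(2) have "t + u + 1 \<le> 1 + \<mu> s' * (T + 1)" by (simp add: algebra_simps)
      then show ?thesis using exec_WhileTrue[OF True 1(1) 2(1)] 2(3,4) unfolding wt_def by blast
    next
      case False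
      then show ?thesis using less.prems exec_WhileFalse[of b s' C] unfolding wt_def
        by (intro exI[of _ 1] exI[of _ s']) auto
    qed
  qed
  from this[OF \<open>I s\<close>] K show ?thesis by (auto simp: wt_def intro: order_trans)
qed

section \<open>Counting loops\<close>

abbreviation NVar :: "name \<Rightarrow> nexp" where
  "NVar x \<equiv> NRead x (NConst 0)"

abbreviation NSet :: "name \<Rightarrow> nexp \<Rightarrow> com" where
  "NSet x a \<equiv> NAssign x (NConst 0) a"

abbreviation NPos :: "nexp \<Rightarrow> bexp" where
  "NPos a \<equiv> NLess (NConst 0) a"

abbreviation NNeq :: "nexp \<Rightarrow> nexp \<Rightarrow> bexp" where
  "NNeq a b \<equiv> BNot (BAnd (BNot (NLess a b)) (BNot (NLess b a)))"

definition For :: "name \<Rightarrow> name \<Rightarrow> com \<Rightarrow> com" where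
  "For x y C = Seq (NSet x (NConst 0))
     (While (NLess (NVar x) (NVar y)) (Seq C (NSet x (NAdd (NVar x) (NConst 1)))))"

lemma nwrites_For [simp]: "nwrites (For x y C) = insert x (nwrites C)"
  and rwrites_For [simp]: "rwrites (For x y C) = rwrites C"
  by (auto simp: For_def)

text \<open>A round costs the body, a test and an increment; the extra 2 is the initialisation and
  the failing test. The counter is changed after the body, hence \<open>I\<close> must ignore its
  cell and gets the round as an argument. Bounding \<open>n\<close> by \<open>N\<close> allows a
  single size parameter in all time bounds.\<close>

lemma wt_For:
  assumes xy: "x \<notin> nwrites C" "y \<notin> nwrites C" "x \<noteq> y"
    and n: "nats s y 0 = n" "n \<le> N"
    and indep: "\<And>k j s'. I k s' \<Longrightarrow> I k (nupdate x 0 j s')"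
    and init: "I 0 s"
    and step: "\<And>k s'. k < n \<Longrightarrow> I k s' \<Longrightarrow> nats s' x 0 = k \<Longrightarrow>
      agree (insert x (nwrites C)) (rwrites C) s s' \<Longrightarrow> wt C T (I (Suc k)) s'"
    and K: "2 + N * (T + 2) \<le> K"
  shows "wt (For x y C) K (I n) s"
proof -
  let ?body = "Seq C (NSet x (NAdd (NVar x) (NConst 1)))"
  let ?I = "\<lambda>s'. \<exists>k\<le>n. nats s' x 0 = k \<and> I k s'"
  let ?\<mu> = "\<lambda>s'. n - nats s' x 0"
  let ?s = "nupdate x 0 0 s"
  have agree_s: "agree (insert x (nwrites C)) (rwrites C) s ?s" by (simp add: agree_def)
  have "wt (While (NLess (NVar x) (NVar y)) ?body) (1 + n * ((T + 1) + 1))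
      (\<lambda>s'. ?I s' \<and> \<not> bval (NLess (NVar x) (NVar y)) s') ?s"
  proof (rule wt_While[where \<mu> = ?\<mu>])
    show "?I ?s" using init indep by auto
    fix s' assume I: "?I s'" and a: "agree (nwrites ?body) (rwrites ?body) ?s s'"
      and b: "bval (NLess (NVar x) (NVar y)) s'"
    have a': "agree (insert x (nwrites C)) (rwrites C) s s'"
      using agree_s a by (auto simp: agree_def)
    then have y: "nats s' y 0 = n" using xy n unfolding agree_def by auto
    from I obtain k where k: "nats s' x 0 = k" "I k s'" by blast
    then have kn: "k < n" using b y by simp
    from step[OF kn k(2,1) a'] show "wt ?body (T + 1) (\<lambda>s''. ?I s'' \<and> ?\<mu> s'' < ?\<mu> s') s'"
    proof (rule wt_SeqI)
      fix s'' assume I': "I (Suc k) s''" and "agree (nwrites C) (rwrites C) s' s''"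
      then have "nats s'' x 0 = k" using xy k unfolding agree_def by auto
      then show "wt (NSet x (NAdd (NVar x) (NConst 1))) 1 (\<lambda>s''. ?I s'' \<and> ?\<mu> s'' < ?\<mu> s') s''"
        using indep[OF I'] kn k by auto
    qed simp
  qed simp
  then have "wt (While (NLess (NVar x) (NVar y)) ?body) (1 + n * (T + 2)) (I n) ?s"
  proof (rule wt_mono)
    fix s' assume I: "?I s' \<and> \<not> bval (NLess (NVar x) (NVar y)) s'"
      and a: "agree (nwrites (While (NLess (NVar x) (NVar y)) ?body))
          (rwrites (While (NLess (NVar x) (NVar y)) ?body)) ?s s'"
    then have "agree (insert x (nwrites C)) (rwrites C) s s'"
      using agree_s by (auto simp: agree_def)
    then have "nats s' y 0 = n" using xy n unfolding agree_def by auto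
    with I show "I n s'" by (metis bval.simps(1) nval.simps(1,2) le_neq_implies_less)
  qed simp
  moreover have "n * (T + 2) \<le> N * (T + 2)" using n by (intro mult_right_mono) auto
  ultimately show ?thesis
    unfolding For_def using K by (auto elim!: wt_mono)
qed

section \<open>The program\<close>

text \<open>Makes all costs non-negative. If there are no arcs, the first assignment reads a default
  0 and the loops do nothing.\<close>

definition shift_prog :: com where
  "shift_prog =
     Seq (RAssign ''min'' (NConst 0) (RRead ''cost'' (NConst 0)))
    (Seq (For ''i'' ''arcs''
       (Cond (RLess (RRead ''cost'' (NVar ''i'')) (RRead ''min'' (NConst 0)))
         (RAssign ''min'' (NConst 0) (RRead ''cost'' (NVar ''i''))) Skip))
       (For ''i'' ''arcs''
         (RAssign ''cost'' (NVar ''i'') (RSub (RRead ''cost'' (NVar ''i''))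
             (RRead ''min'' (NConst 0))))))"

definition init_rep_prog :: com where
  "init_rep_prog = For ''i'' ''nodes'' (NAssign ''rep'' (NVar ''i'') (NVar ''i''))"

abbreviation tail_rep :: nexp where
  "tail_rep \<equiv> NRead ''rep'' (NRead ''tail'' (NVar ''i''))"

abbreviation head_rep :: nexp where
  "head_rep \<equiv> NRead ''rep'' (NRead ''head'' (NVar ''i''))"

definition ends_prog :: com where
  "ends_prog = For ''i'' ''arcs''
     (Cond (NNeq tail_rep head_rep)
       (Seq (NAssign ''end1'' (NVar ''i'') tail_rep) (NAssign ''end2'' (NVar ''i'') head_rep))
           Skip)"

text \<open>There are no real constants, so zero is written as a difference.\<close>

abbreviation zero_cost :: bexp where
  "zero_cost \<equiv> BNot (RLess (RSub (RRead ''cost'' (NVar ''i'')) (RRead ''cost'' (NVar ''i'')))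
      (RRead ''cost'' (NVar ''i'')))"

abbreviation relax :: com where
  "relax \<equiv> Cond (BAnd zero_cost (NPos (NRead ''reach'' (NRead ''head'' (NVar ''i'')))))
     (NAssign ''reach'' (NRead ''tail'' (NVar ''i'')) (NConst 1)) Skip"

text \<open>Backward search from \<open>v\<close> in the manner of Bellman and Ford: after
  \<open>k\<close> passes all nodes with a zero walk of at most \<open>k\<close> arcs to
  \<open>v\<close> are marked. As many passes as arcs suffice.\<close>

definition reach_prog :: com where
  "reach_prog =
     Seq (For ''i'' ''nodes'' (NAssign ''reach'' (NVar ''i'') (NConst 0)))
    (Seq (NAssign ''reach'' (NVar ''v'') (NConst 1))
    (For ''k'' ''arcs'' (For ''i'' ''arcs'' relax)))"

definition count_prog :: com where
  "count_prog =
     Seq (NSet ''count'' (NConst 0))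
    (For ''i'' ''nodes'' (NSet ''count'' (NAdd (NVar ''count'') (NRead ''reach'' (NVar ''i'')))))"

text \<open>The value \<open>nodes + 1\<close> of \<open>size\<close> stands for: no suitable set found yet.\<close>

definition search_prog :: com where
  "search_prog =
     Seq (NSet ''size'' (NAdd (NVar ''nodes'') (NConst 1)))
    (For ''v'' ''nodes''
      (Seq reach_prog (Seq count_prog
        (Cond (BAnd (BNot (NPos (NRead ''reach'' (NVar ''root'')))) (NLess (NVar ''count'')
            (NVar ''size'')))
          (Seq (NSet ''size'' (NVar ''count'')) (NSet ''best'' (NVar ''v''))) Skip))))"

abbreviation entering :: bexp where
  "entering \<equiv> BAnd (BNot (NPos (NRead ''reach'' (NRead ''tail'' (NVar ''i'')))))
     (NPos (NRead ''reach'' (NRead ''head'' (NVar ''i''))))"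

text \<open>The search has overwritten \<open>reach\<close>, so it is computed again for the chosen
  node. The flag \<open>found\<close> stands in for an infinite initial value of
  \<open>eps\<close>.\<close>

definition select_prog :: com where
  "select_prog =
     Seq (NSet ''v'' (NVar ''best''))
    (Seq reach_prog
    (Seq (NSet ''found'' (NConst 0))
    (For ''i'' ''arcs'' (Cond (BAnd entering (BNot (BAnd (NPos (NVar ''found''))
         (BNot (RLess (RRead ''cost'' (NVar ''i'')) (RRead ''eps'' (NConst 0)))))))
       (Seq (RAssign ''eps'' (NConst 0) (RRead ''cost'' (NVar ''i'')))
           (NSet ''found'' (NConst 1))) Skip))))"

definition update_prog :: com where
  "update_prog =
     Seq (For ''i'' ''arcs'' (Cond entering
       (RAssign ''cost'' (NVar ''i'') (RSub (RRead ''cost'' (NVar ''i''))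
           (RRead ''eps'' (NConst 0)))) Skip))
    (Seq (NSet ''x'' (NRead ''rep'' (NVar ''best'')))
    (Seq (For ''i'' ''nodes'' (Cond (NPos (NRead ''reach'' (NVar ''i'')))
       (NAssign ''rep'' (NVar ''i'') (NVar ''x'')) Skip))
     ends_prog))"

definition loop_body :: com where
  "loop_body =
     Seq search_prog
    (Cond (NLess (NVar ''nodes'') (NVar ''size''))
       (NSet ''go'' (NConst 0))
       (Seq select_prog
         (Cond (NPos (NVar ''found''))
            update_prog
            (Seq (NSet ''go'' (NConst 0)) (NSet ''bad'' (NConst 1))))))"

text \<open>
  If \<open>bad\<close> is set there is no arborescence. The ground set is then a single arc which is not a loop,
  with bound 0, so that the matroids have no common base.
\<close>

definition output_prog :: com where
  "output_prog =
     Seq (NSet ''vertices'' (NVar ''nodes''))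
    (Seq (For ''i'' ''arcs'' (NAssign ''class'' (NVar ''i'') (NRead ''head'' (NVar ''i''))))
    (Cond (NPos (NVar ''bad''))
      (Seq (NSet ''ground'' (NConst 1)) (Seq (NSet ''end1'' (NConst 0)) (NSet ''end2'' (NConst 1))))
      (Seq (For ''i'' ''arcs'' (Cond (BAnd zero_cost (NNeq (NRead ''head'' (NVar ''i''))
          (NVar ''root'')))
             (NAssign ''ground'' (NVar ''i'') (NConst 1)) Skip))
        (For ''i'' ''nodes'' (NAssign ''bound'' (NVar ''i'') (NConst 1))))))"

definition main_prog :: com where
  "main_prog = Seq shift_prog (Seq init_rep_prog (Seq ends_prog (Seq (NSet ''go'' (NConst 1))
     (Seq (While (NPos (NVar ''go'')) loop_body) output_prog))))"

lemma nwrites_ends [simp]: "nwrites ends_prog = {''i'', ''end1'', ''end2''}"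
    "rwrites ends_prog = {}"
  and nwrites_shift [simp]: "nwrites shift_prog = {''i''}" "rwrites shift_prog = {''min'',
      ''cost''}"
  and nwrites_init_rep [simp]: "nwrites init_rep_prog = {''i'', ''rep''}"
      "rwrites init_rep_prog = {}"
  and nwrites_reach [simp]: "nwrites reach_prog = {''i'', ''k'', ''reach''}"
      "rwrites reach_prog = {}"
  and nwrites_count [simp]: "nwrites count_prog = {''i'', ''count''}" "rwrites count_prog = {}"
  by (auto simp: ends_prog_def shift_prog_def init_rep_prog_def reach_prog_def count_prog_def)

lemma nwrites_search [simp]:
  "nwrites search_prog = {''i'', ''k'', ''reach'', ''v'', ''count'', ''size'', ''best''}"
      "rwrites search_prog = {}"
  and nwrites_select [simp]: "nwrites select_prog = {''i'', ''k'', ''reach'', ''v'', ''found''}"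
      "rwrites select_prog = {''eps''}"
  and nwrites_update [simp]: "nwrites update_prog = {''i'', ''x'', ''rep'', ''end1'', ''end2''}"
      "rwrites update_prog = {''cost''}"
  by (auto simp: search_prog_def select_prog_def update_prog_def)

lemma nwrites_loop_body [simp]: "nwrites loop_body = {''i'', ''k'', ''reach'', ''v'', ''count'',
    ''size'', ''best'',
    ''found'', ''x'', ''rep'', ''end1'', ''end2'', ''go'', ''bad''}"
  "rwrites loop_body = {''eps'', ''cost''}"
  by (auto simp: loop_body_def)

section \<open>Correctness and running time of the program\<close>

locale network_program = rooted_network "{..<n}" "{..<m}" t h r
  for n m :: nat and t h :: "nat \<Rightarrow> nat" and r :: nat +
  fixes N :: nat
  assumes n_le: "n \<le> N" and m_le: "m \<le> N"
begin

definition input :: "state \<Rightarrow> bool" where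
  "input s \<longleftrightarrow> nats s ''nodes'' 0 = n \<and> nats s ''arcs'' 0 = m \<and> nats s ''root'' 0 = r \<and>
     nats s ''tail'' = t \<and> nats s ''head'' = h"

lemma t_less: "a < m \<Longrightarrow> t a < n" and h_less: "a < m \<Longrightarrow> h a < n" and r_less: "r < n"
  using tail_in_V head_in_V r_in_V by auto

definition anc :: "(nat \<Rightarrow> real) \<Rightarrow> nat \<Rightarrow> nat set" where
  "anc z v = {u\<in>{..<n}. (u, v) \<in> (tight z {..<n})\<^sup>*}"

lemma wt_shift:
  assumes i: "input s"
  shows "wt shift_prog (5 + 9 * N) (\<lambda>s'. \<forall>a<m. 0 \<le> reals s' ''cost'' a \<and>
    reals s ''cost'' a = reals s' ''cost'' a + reals s' ''min'' 0) s"
proof -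
  let ?c = "reals s ''cost''"
  let ?I = "\<lambda>k s'. \<forall>a<k. reals s' ''min'' 0 \<le> ?c a"
  have m: "nats s ''arcs'' 0 = m" using i by (simp add: input_def)
  show ?thesis
    unfolding shift_prog_def
    apply (simp add: One_nat_def[symmetric] del: One_nat_def)
    apply (rule wt_SeqI[where P = "?I m" and ?T1.0 = "2 + N * (2 + 2)" and ?T2.0 =
        "2 + N * (1 + 2)"])
    subgoal
      apply (rule wt_For[where T = 2 and N = N and I = ?I and n = m])
      using m m_le by (auto simp: agree_def less_Suc_eq)
    subgoal for s1
      apply (rule wt_mono[OF wt_For[where T = 1 and N = N and n = m and
         I = "\<lambda>k s'. \<forall>a. reals s' ''cost'' a =
             (if a < k then ?c a - reals s1 ''min'' 0 else ?c a)"]])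
      using m m_le by (auto simp: agree_def less_Suc_eq)
    by simp
qed

lemma wt_init_rep:
  assumes i: "input s"
  shows "wt init_rep_prog (2 + 3 * N) (\<lambda>s'. \<forall>v<n. nats s' ''rep'' v = v) s"
proof -
  have "nats s ''nodes'' 0 = n" using i by (simp add: input_def)
  then show ?thesis
    unfolding init_rep_prog_def
    apply (intro wt_For[where T = 1 and N = N and I = "\<lambda>k s'. \<forall>v<k. nats s' ''rep'' v = v"])
    using n_le by (auto simp: less_Suc_eq)
qed

definition ends_updated :: "state \<Rightarrow> state \<Rightarrow> bool" where
  "ends_updated s s' \<longleftrightarrow> (\<forall>a<m.
     nats s' ''end1'' a = (if nats s ''rep'' (t a) \<noteq> nats s ''rep'' (h a)
         then nats s ''rep'' (t a) else nats s ''end1'' a) \<and>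
     nats s' ''end2'' a = (if nats s ''rep'' (t a) \<noteq> nats s ''rep'' (h a)
         then nats s ''rep'' (h a) else nats s ''end2'' a))"

lemma wt_ends:
  assumes i: "input s"
  shows "wt ends_prog (2 + 5 * N) (ends_updated s) s"
proof -
  let ?R = "nats s ''rep''"
  have m: "nats s ''arcs'' 0 = m" "nats s ''tail'' = t" "nats s ''head'' = h"
    using i by (simp_all add: input_def)
  have "wt ends_prog (2 + 5 * N) (\<lambda>s'. \<forall>a.
     nats s' ''end1'' a = (if a < m \<and> ?R (t a) \<noteq> ?R (h a) then ?R (t a) else nats s ''end1'' a) \<and>
     nats s' ''end2'' a = (if a < m \<and> ?R (t a) \<noteq> ?R (h a) then ?R (h a) else nats s ''end2'' a)) s"
    unfolding ends_prog_def
    apply (rule wt_For[where T = 3 and N = N and I = "\<lambda>k s'. \<forall>a.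
     nats s' ''end1'' a = (if a < k \<and> ?R (t a) \<noteq> ?R (h a) then ?R (t a) else nats s ''end1'' a) \<and>
     nats s' ''end2'' a = (if a < k \<and> ?R (t a) \<noteq> ?R (h a) then ?R (h a) else nats s ''end2'' a)"])
    using m m_le by (auto simp: agree_def less_Suc_eq)
  then show ?thesis by (rule wt_mono) (auto simp: ends_updated_def)
qed

lemma card_tight: "finite (tight z {..<n})" "card (tight z {..<n}) \<le> m"
proof -
  have sub: "tight z {..<n} \<subseteq> (\<lambda>a. (t a, h a)) ` {..<m}" by (auto simp: tight_def)
  then show "finite (tight z {..<n})" by (rule finite_subset) simp
  have "card (tight z {..<n}) \<le> card ((\<lambda>a. (t a, h a)) ` {..<m})" using sub
      by (intro card_mono) auto
  also have "\<dots> \<le> m" using card_image_le[of "{..<m}"] by simp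
  finally show "card (tight z {..<n}) \<le> m" .
qed

lemma wt_reach:
  assumes i: "input s" and v: "nats s ''v'' 0 < n" and z: "\<And>a. a < m \<Longrightarrow> 0 \<le> reals s ''cost'' a"
  shows "wt reach_prog (5 + 7 * N + 4 * N * N)
    (\<lambda>s'. \<forall>u<n. nats s' ''reach'' u = (if u \<in> anc (reals s ''cost'') (nats s ''v'' 0)
        then 1 else 0)) s"
proof -
  let ?E = "tight (reals s ''cost'') {..<n}" and ?v = "nats s ''v'' 0"
  have m: "nats s ''arcs'' 0 = m" "nats s ''nodes'' 0 = n" "nats s ''tail'' = t"
      "nats s ''head'' = h"
    using i by (simp_all add: input_def)
  \<comment> \<open>Soundness of the marks. They are kept in {0, 1} because
    \<open>count_prog\<close> adds them up.\<close>
  define Snd where "Snd s' \<longleftrightarrow> (\<forall>u<n. nats s' ''reach'' u \<in> {0, 1} \<and> (nats s' ''reach'' u \<noteq> 0 \<longrightarrow>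
      (u, ?v) \<in> ?E\<^sup>*))" for s' :: state
  define I where "I k s' \<longleftrightarrow> Snd s' \<and> (\<forall>u<n. \<forall>j\<le>k. (u, ?v) \<in> ?E ^^ j \<longrightarrow>
      nats s' ''reach'' u \<noteq> 0)" for k s'
  have Eiff: "(t a, h a) \<in> ?E" if "a < m" "\<not> 0 < reals s ''cost'' a" for a
    using that z[of a] t_less h_less unfolding tight_def by fastforce
  have inner: "wt (For ''i'' ''arcs'' relax) (2 + 4 * N) (I (Suc k)) s'"
    if I: "I k s'" and a: "agree {''k'', ''i'', ''reach''} {} s s'" for k s'
  proof -
    \<comment> \<open>Compared with the state \<open>s'\<close> at the start of the pass: marks made
      during the pass may spread further, which only helps.\<close>
    let ?J = "\<lambda>i s''. Snd s'' \<and> (\<forall>u. nats s' ''reach'' u \<noteq> 0 \<longrightarrow> nats s'' ''reach'' u \<noteq> 0) \<and>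
      (\<forall>a<i. reals s ''cost'' a = 0 \<longrightarrow> nats s' ''reach'' (h a) \<noteq> 0 \<longrightarrow> nats s'' ''reach'' (t a) \<noteq> 0)"
    have "wt (For ''i'' ''arcs'' relax) (2 + 4 * N) (?J m) s'"
    proof (rule wt_For[where T = 2 and N = N and I = ?J and n = m])
      show "?J 0 s'" using I by (simp add: I_def)
      show "nats s' ''arcs'' 0 = m" using a m by (simp add: agree_def)
      fix i s'' assume im: "i < m" and J: "?J i s''" and i: "nats s'' ''i'' 0 = i"
        and a': "agree (insert ''i'' (nwrites relax)) (rwrites relax) s' s''"
      have rd: "nats s'' ''tail'' = t" "nats s'' ''head'' = h" "reals s'' ''cost'' =
          reals s ''cost''"
        using a a' m by (simp_all add: agree_def)
      show "wt relax 2 (?J (Suc i)) s''"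
      proof (cases "\<not> 0 < reals s ''cost'' i \<and> nats s'' ''reach'' (h i) \<noteq> 0")
        case True
        then have "(t i, ?v) \<in> ?E\<^sup>*"
          using Eiff[OF im] J h_less[OF im] unfolding Snd_def
              by (meson converse_rtrancl_into_rtrancl)
        then show ?thesis using True J rd i by (auto simp: Snd_def less_Suc_eq)
      next
        case False
        then have "nats s' ''reach'' (h i) = 0" if "\<not> 0 < reals s ''cost'' i" using J that by blast
        then show ?thesis using False J rd i by (auto simp: less_Suc_eq)
      qed
    qed (use m_le in \<open>auto simp: Snd_def\<close>)
    then show ?thesis
    proof (rule wt_mono)
      fix s'' assume J: "?J m s''"
      have "nats s'' ''reach'' u \<noteq> 0" if "u < n" "j \<le> Suc k" "(u, ?v) \<in> ?E ^^ j" for u j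
      proof (cases j)
        case 0
        then have "(u, ?v) \<in> ?E ^^ 0" using that by simp
        then show ?thesis using I J that(1) unfolding I_def by (metis le0)
      next
        case (Suc j')
        with that(3) obtain w where w: "(u, w) \<in> ?E" "(w, ?v) \<in> ?E ^^ j'" by (meson relpow_Suc_D2)
        from w(1) obtain b where b: "b < m" "reals s ''cost'' b = 0" "u = t b" "w = h b"
          by (auto simp: tight_def)
        then have "nats s' ''reach'' (h b) \<noteq> 0"
          using I w(2) h_less[OF b(1)] that(2) Suc unfolding I_def by (metis Suc_le_mono)
        then show ?thesis using J b by auto
      qed
      then show "I (Suc k) s''" using J by (simp add: I_def)
    qed simp
  qed
  have final: "I m s' \<Longrightarrow> \<forall>u<n. nats s' ''reach'' u = (if u \<in> anc (reals s ''cost'')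
      ?v then 1 else 0)" for s'
  proof (intro allI impI)
    fix u assume I: "I m s'" and u: "u < n"
    show "nats s' ''reach'' u = (if u \<in> anc (reals s ''cost'') ?v then 1 else 0)"
    proof (cases "(u, ?v) \<in> ?E\<^sup>*")
      case True
      \<comment> \<open>A shortest walk repeats no pair of the relation, and there are at most
        \<open>m\<close> pairs.\<close>
      then obtain j where "j \<le> card ?E" "(u, ?v) \<in> ?E ^^ j"
        using rtrancl_finite_eq_relpow[OF card_tight(1)] by auto
      then have "nats s' ''reach'' u \<noteq> 0" using I u card_tight(2) unfolding I_def
          by (meson le_trans)
      moreover have "nats s' ''reach'' u \<in> {0, 1}" using I u unfolding I_def Snd_def by blast
      ultimately show ?thesis using True u unfolding anc_def by auto
    next
      case False
      then have "nats s' ''reach'' u = 0" using I u unfolding I_def Snd_def by blast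
      then show ?thesis using False unfolding anc_def by auto
    qed
  qed
  have first: "wt (For ''i'' ''nodes'' (NAssign ''reach'' (NVar ''i'') (NConst 0))) (2 + 3 * N)
      (\<lambda>s'. \<forall>u<n. nats s' ''reach'' u = 0) s"
    apply (rule wt_For[where T = 1 and N = N and I = "\<lambda>k s'. \<forall>u<k. nats s' ''reach'' u = 0"])
    using m n_le by (auto simp: less_Suc_eq)
  show ?thesis
    unfolding reach_prog_def
  proof (rule wt_SeqI[OF first, where ?T2.0 = "3 + (4 * N + 4 * N * N)"])
    fix s1 assume z1: "\<forall>u<n. nats s1 ''reach'' u = 0"
      and "agree (nwrites (For ''i'' ''nodes'' (NAssign ''reach'' (NVar ''i'') (NConst 0))))
        (rwrites (For ''i'' ''nodes'' (NAssign ''reach'' (NVar ''i'') (NConst 0)))) s s1"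
    then have a1: "agree {''i'', ''reach''} {} s s1" by simp
    let ?s = "nupdate ''reach'' ?v 1 s1"
    have v1: "nats s1 ''v'' 0 = ?v" using a1 by (simp add: agree_def)
    have a2: "agree {''i'', ''reach''} {} s ?s" using a1 by (simp add: agree_def)
    have I0: "I 0 ?s" using z1 by (auto simp: I_def Snd_def)
    have "wt (For ''k'' ''arcs'' (For ''i'' ''arcs'' relax)) (2 + (4 * N + 4 * N * N)) (I m) ?s"
    proof (rule wt_For[where T = "2 + 4 * N" and N = N and I = I and n = m])
      show "nats ?s ''arcs'' 0 = m" using a2 m by (simp add: agree_def)
      show "I 0 ?s" by (rule I0)
      show "2 + N * (2 + 4 * N + 2) \<le> 2 + (4 * N + 4 * N * N)" by (simp add: algebra_simps)
      show "I k (nupdate ''k'' 0 j s')" if "I k s'" for k j s'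
        using that by (simp add: I_def Snd_def)
      fix k s' assume I: "I k s'" and "agree (insert ''k'' (nwrites (For ''i'' ''arcs'' relax)))
          (rwrites (For ''i'' ''arcs'' relax)) ?s s'"
      then have "agree {''k'', ''i'', ''reach''} {} s s'" using a2 by (simp add: agree_def)
      from inner[OF I this] show "wt (For ''i'' ''arcs'' relax) (2 + 4 * N) (I (Suc k)) s'" .
    qed (use m_le in auto)
    then show "wt (Seq (NAssign ''reach'' (NVar ''v'') (NConst 1))
    (For ''k'' ''arcs'' (For ''i'' ''arcs'' relax))) (3 + (4 * N + 4 * N * N)) 
       (\<lambda>s'. \<forall>u<n. nats s' ''reach'' u = (if u \<in> anc (reals s ''cost'') (nats s ''v'' 0)
           then 1 else 0)) s1"
      using v1 final by (auto elim: wt_mono)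
  qed simp
qed

lemma wt_count:
  assumes i: "input s" and R: "R \<subseteq> {..<n}" "\<forall>u<n. nats s ''reach'' u = (if u \<in> R then 1 else 0)"
  shows "wt count_prog (3 + 3 * N) (\<lambda>s'. nats s' ''count'' 0 = card R) s"
proof -
  have "nats s ''nodes'' 0 = n" using i by (simp add: input_def)
  then have "wt count_prog (3 + 3 * N) (\<lambda>s'. nats s' ''count'' 0 = (\<Sum>u<n. nats s ''reach'' u)) s"
    unfolding count_prog_def
    apply simp
    apply (rule wt_For[where T = 1 and N = N and I = "\<lambda>k s'. nats s' ''count'' 0 =
        (\<Sum>u<k. nats s ''reach'' u)"])
    using n_le by (auto simp: agree_def)
  moreover have "(\<Sum>u<n. nats s ''reach'' u) = (\<Sum>u<n. if u \<in> R then 1 else 0)"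
    using R(2) by (intro sum.cong) auto
  moreover have "\<dots> = card R" using R(1) by (simp add: sum.If_cases Int_absorb1)
  ultimately show ?thesis by simp
qed

lemma anc_subset: "anc z v \<subseteq> {..<n}"
  by (auto simp: anc_def)

lemma card_anc_le: "card (anc z v) \<le> n"
  using card_mono[OF _ anc_subset] by simp

lemma input_agree: "agree W R s s' \<Longrightarrow> input s \<Longrightarrow>
    W \<inter> {''nodes'', ''arcs'', ''root'', ''tail'', ''head''} = {} \<Longrightarrow> input s'"
  unfolding agree_def input_def by auto

definition found_smallest :: "(nat \<Rightarrow> real) \<Rightarrow> nat \<Rightarrow> bool" where
  "found_smallest z b \<longleftrightarrow> b < n \<and> r \<notin> anc z b \<and> (\<forall>v<n. r \<notin> anc z v \<longrightarrow> card (anc z b) \<le> card (anc z v))"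

lemma wt_search:
  assumes i: "input s" and z: "\<And>a. a < m \<Longrightarrow> 0 \<le> reals s ''cost'' a"
  shows "wt search_prog (3 + 13 * N + 10 * N * N + 4 * N * N * N)
    (\<lambda>s'. if n < nats s' ''size'' 0 then \<forall>v<n. r \<in> anc (reals s ''cost'') v
      else found_smallest (reals s ''cost'') (nats s' ''best'' 0)) s"
proof -
  let ?R = "anc (reals s ''cost'')"
  define I where "I k s' \<longleftrightarrow> (\<forall>v<k. r \<notin> ?R v \<longrightarrow> nats s' ''size'' 0 \<le> card (?R v)) \<and>
    (nats s' ''size'' 0 = Suc n \<or> nats s' ''best'' 0 < n \<and> r \<notin> ?R (nats s' ''best'' 0) \<and>
      nats s' ''size'' 0 = card (?R (nats s' ''best'' 0)))" for k and s' :: state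
  let ?test = "Cond (BAnd (BNot (NPos (NRead ''reach'' (NVar ''root''))))
      (NLess (NVar ''count'') (NVar ''size'')))
          (Seq (NSet ''size'' (NVar ''count'')) (NSet ''best'' (NVar ''v''))) Skip"
  let ?body = "Seq reach_prog (Seq count_prog ?test)"
  let ?s = "nupdate ''size'' 0 (Suc n) s"
  have inp: "input ?s" using i by (simp add: input_def)
  have body: "wt ?body (11 + 10 * N + 4 * N * N) (I (Suc k)) s'"
    if k: "k < n" "I k s'" "nats s' ''v'' 0 = k" and a: "agree (insert ''v'' (nwrites ?body))
        (rwrites ?body) ?s s'" for k s'
  proof -
    have inp': "input s'" using a inp by (rule input_agree) simp
    have zs': "reals s' ''cost'' = reals s ''cost''" using a by (simp add: agree_def)
    show ?thesis
    proof (rule wt_SeqI[OF wt_reach[OF inp'], where ?T2.0 = "6 + 3 * N"])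
      show "nats s' ''v'' 0 < n" using k by simp
      show "0 \<le> reals s' ''cost'' b" if "b < m" for b using z[OF that] zs' by simp
      fix s1 assume r1: "\<forall>u<n. nats s1 ''reach'' u = (if u \<in> anc (reals s' ''cost'')
          (nats s' ''v'' 0) then 1 else 0)"
        and a1: "agree (nwrites reach_prog) (rwrites reach_prog) s' s1"
      have r1': "\<forall>u<n. nats s1 ''reach'' u = (if u \<in> ?R k then 1 else 0)"
        using r1 k(3) zs' by simp
      have inp1: "input s1" using a1 inp' by (rule input_agree) simp
      show "wt (Seq count_prog ?test) (6 + 3 * N) (I (Suc k)) s1"
      proof (rule wt_SeqI[OF wt_count[OF inp1 anc_subset r1'], where ?T2.0 = 3])
        fix s2 assume c: "nats s2 ''count'' 0 = card (?R k)"
          and a2: "agree (nwrites count_prog) (rwrites count_prog) s1 s2"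
        have *: "nats s2 ''root'' 0 = r" "nats s2 ''reach'' r = (if r \<in> ?R k then 1 else 0)"
            "nats s2 ''v'' 0 = k"
            "nats s2 ''size'' 0 = nats s' ''size'' 0" "nats s2 ''best'' 0 = nats s' ''best'' 0"
          using a2 a1 inp1 r1' r_less k(3) by (auto simp: agree_def input_def)
        show "wt ?test 3 (I (Suc k)) s2"
        proof (cases "r \<notin> ?R k \<and> card (?R k) < nats s' ''size'' 0")
          case True
          have "\<forall>v<Suc k. r \<notin> ?R v \<longrightarrow> card (?R k) \<le> card (?R v)"
          proof (intro allI impI)
            fix v assume v: "v < Suc k" "r \<notin> ?R v"
            show "card (?R k) \<le> card (?R v)"
            proof (cases "v = k")
              case False
              then have "nats s' ''size'' 0 \<le> card (?R v)" using k(2) v unfolding I_def by simp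
              then show ?thesis using True by linarith
            qed simp
          qed
          then show ?thesis using True k(1) * c by (auto simp: I_def)
        next
          case False
          then have "I (Suc k) s2" using k(2) * unfolding I_def by (auto simp: less_Suc_eq not_less)
          then show ?thesis using False * c by auto
        qed
      qed simp
    qed simp
  qed
  have "wt (For ''v'' ''nodes'' ?body) (2 + N * (13 + 10 * N + 4 * N * N)) (I n) ?s"
  proof (rule wt_For[where T = "11 + 10 * N + 4 * N * N" and N = N and I = I and n = n])
    show "nats ?s ''nodes'' 0 = n" using i by (simp add: input_def)
    show "I 0 ?s" by (simp add: I_def)
    show "I k (nupdate ''v'' 0 j s')" if "I k s'" for k j s' using that by (simp add: I_def)
    show "wt ?body (11 + 10 * N + 4 * N * N) (I (Suc k)) s'"
        if "k < n" "I k s'" "nats s' ''v'' 0 = k"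
      "agree (insert ''v'' (nwrites ?body)) (rwrites ?body) ?s s'" for k s'
      using body[OF that] .
  qed (use n_le in auto)
  moreover have "nats s ''nodes'' 0 = n" using i by (simp add: input_def)
  ultimately have "wt search_prog (1 + (2 + N * (13 + 10 * N + 4 * N * N))) (I n) s"
    unfolding search_prog_def by simp
  then show ?thesis
  proof (rule wt_mono)
    show "1 + (2 + N * (13 + 10 * N + 4 * N * N)) \<le> 3 + 13 * N + 10 * N * N + 4 * N * N * N"
      by (simp add: algebra_simps)
    fix s' assume I: "I n s'"
    show "if n < nats s' ''size'' 0 then \<forall>v<n. r \<in> ?R v else found_smallest (reals s ''cost'')
        (nats s' ''best'' 0)"
    proof (cases "n < nats s' ''size'' 0")
      case True
      \<comment> \<open>The initial value of \<open>size\<close> exceeds the size of every ancestor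
        set, so it survives only if no set avoids \<open>r\<close>.\<close>
      have "r \<in> ?R v" if "v < n" for v
      proof (rule ccontr)
        assume "r \<notin> ?R v"
        then have "nats s' ''size'' 0 \<le> card (?R v)" using I that unfolding I_def by simp
        with card_anc_le[of "reals s ''cost''" v] True show False by linarith
      qed
      then show ?thesis using True by simp
    next
      case False
      then have "nats s' ''size'' 0 \<noteq> Suc n" by simp
      then show ?thesis using False I unfolding I_def found_smallest_def by auto
    qed
  qed
qed

text \<open>Attainment is included because the attaining arc is the one that becomes a zero
  arc.\<close>

definition min_entering :: "(nat \<Rightarrow> real) \<Rightarrow> nat set \<Rightarrow> nat \<Rightarrow> real \<Rightarrow> bool" where
  "min_entering z L k \<epsilon> \<longleftrightarrow> (\<exists>a<k. enters a L \<and> z a = \<epsilon>) \<and> (\<forall>a<k. enters a L \<longrightarrow> \<epsilon> \<le> z a)"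

lemma min_entering_Suc:
  "min_entering z L k \<epsilon> \<Longrightarrow> \<not> enters k L \<or> \<epsilon> \<le> z k \<Longrightarrow> min_entering z L (Suc k) \<epsilon>"
  "min_entering z L k \<epsilon> \<Longrightarrow> enters k L \<Longrightarrow> z k < \<epsilon> \<Longrightarrow> min_entering z L (Suc k) (z k)"
  "\<forall>a<k. \<not> enters a L \<Longrightarrow> enters k L \<Longrightarrow> min_entering z L (Suc k) (z k)"
  unfolding min_entering_def by (force simp: less_Suc_eq)+

lemma wt_select:
  assumes i: "input s" and z: "\<And>a. a < m \<Longrightarrow> 0 \<le> reals s ''cost'' a" and b: "nats s ''best'' 0 < n"
    and L: "L = anc (reals s ''cost'') (nats s ''best'' 0)"
  shows "wt select_prog (9 + 12 * N + 4 * N * N)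
    (\<lambda>s'. (\<forall>u<n. nats s' ''reach'' u = (if u \<in> L then 1 else 0)) \<and>
      (if 0 < nats s' ''found'' 0 then min_entering (reals s ''cost'') L m (reals s' ''eps'' 0)
       else \<forall>a<m. \<not> enters a L)) s"
proof -
  let ?z = "reals s ''cost''" and ?s = "nupdate ''v'' 0 (nats s ''best'' 0) s"
  define I where "I k s' \<longleftrightarrow> (if 0 < nats s' ''found'' 0 then min_entering ?z L k (reals s' ''eps'' 0)
       else \<forall>a<k. \<not> enters a L)" for k and s' :: state
  have inp: "input ?s" using i by (simp add: input_def)
  let ?C = "Cond (BAnd entering (BNot (BAnd (NPos (NVar ''found''))
       (BNot (RLess (RRead ''cost'' (NVar ''i'')) (RRead ''eps'' (NConst 0)))))))
     (Seq (RAssign ''eps'' (NConst 0) (RRead ''cost'' (NVar ''i'')))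
         (NSet ''found'' (NConst 1))) Skip"
  let ?Q = "\<lambda>s'. (\<forall>u<n. nats s' ''reach'' u = (if u \<in> L then 1 else 0)) \<and> I m s'"
  have "wt (Seq reach_prog (Seq (NSet ''found'' (NConst 0)) (For ''i'' ''arcs'' ?C)))
      (8 + (12 * N + 4 * N * N)) ?Q ?s"
  proof (rule wt_SeqI[OF wt_reach[OF inp], where ?T2.0 = "3 + 5 * N"])
    show "nats ?s ''v'' 0 < n" using b by simp
    show "0 \<le> reals ?s ''cost'' a" if "a < m" for a using z[OF that] by simp
    fix s1 assume "\<forall>u<n. nats s1 ''reach'' u = (if u \<in> anc (reals ?s ''cost'') (nats ?s ''v'' 0)
        then 1 else 0)"
      and "agree (nwrites reach_prog) (rwrites reach_prog) ?s s1"
    then have r1: "\<forall>u<n. nats s1 ''reach'' u = (if u \<in> L then 1 else 0)"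
      and a1: "agree {''i'', ''k'', ''reach''} {} ?s s1" by (simp_all add: L)
    let ?s1 = "nupdate ''found'' 0 0 s1"
    have inp1: "input ?s1" using input_agree[OF a1 inp] by (simp add: input_def)
    have z1: "reals s1 ''cost'' = ?z" using a1 by (simp add: agree_def)
    have "wt (For ''i'' ''arcs'' ?C) (2 + 5 * N) (I m) ?s1"
    proof (rule wt_For[where T = 3 and N = N and I = I and n = m])
      show "nats ?s1 ''arcs'' 0 = m" using inp1 by (simp add: input_def)
      show "I 0 ?s1" by (simp add: I_def)
      show "I k (nupdate ''i'' 0 j s')" if "I k s'" for k j s' using that by (simp add: I_def)
      fix k s' assume k: "k < m" "I k s'" "nats s' ''i'' 0 = k"
        and a: "agree (insert ''i'' (nwrites ?C)) (rwrites ?C) ?s1 s'"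
      have *: "nats s' ''tail'' = t" "nats s' ''head'' = h" "reals s' ''cost'' = ?z"
          "nats s' ''reach'' = nats s1 ''reach''"
        using a inp1 z1 by (simp_all add: agree_def input_def)
      have e: "nats s1 ''reach'' (t k) = 0 \<and> 0 < nats s1 ''reach'' (h k) \<longleftrightarrow> enters k L"
        using r1 t_less[OF k(1)] h_less[OF k(1)] unfolding enters_def
            by (metis neq0_conv zero_less_one)
      show "wt ?C 3 (I (Suc k)) s'"
      proof (cases "enters k L \<and> (nats s' ''found'' 0 = 0 \<or> ?z k < reals s' ''eps'' 0)")
        case True
        then have "min_entering ?z L (Suc k) (?z k)"
          using k(2) min_entering_Suc(2,3) unfolding I_def by (auto split: if_splits)
        then show ?thesis using True * e k(3) by (auto simp: I_def)
      next
        case False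
        then have "I (Suc k) s'"
          using k(2) min_entering_Suc(1) unfolding I_def
              by (auto simp: less_Suc_eq split: if_splits)
        then show ?thesis using False * e k(3) by auto
      qed
    qed (use m_le in auto)
    then have "wt (For ''i'' ''arcs'' ?C) (2 + 5 * N) ?Q ?s1"
      by (rule wt_mono) (use r1 in \<open>auto simp: agree_def\<close>)
    then show "wt (Seq (NSet ''found'' (NConst 0)) (For ''i'' ''arcs'' ?C)) (3 + 5 * N) ?Q s1"
      by simp
  qed simp
  then have "wt select_prog (9 + 12 * N + 4 * N * N) ?Q s"
    unfolding select_prog_def by (simp del: One_nat_def)
  then show ?thesis by (rule wt_mono) (simp_all add: I_def)
qed

text \<open>The hypotheses of \<open>dual_state_step\<close> in terms of memory cells; the ends are
  compared by means of the new representatives.\<close>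

definition updated :: "nat set \<Rightarrow> state \<Rightarrow> state \<Rightarrow> bool" where
  "updated L s s' \<longleftrightarrow>
    (\<forall>a<m. reals s' ''cost'' a =
        (if enters a L then reals s ''cost'' a - reals s ''eps'' 0 else reals s ''cost'' a)) \<and>
    (\<forall>v<n. nats s' ''rep'' v = (if v \<in> L then nats s ''rep'' (nats s ''best'' 0)
        else nats s ''rep'' v)) \<and>
    (\<forall>a<m. nats s' ''end1'' a =
      (if nats s' ''rep'' (t a) \<noteq> nats s' ''rep'' (h a) then nats s' ''rep'' (t a)
          else nats s ''end1'' a)) \<and>
    (\<forall>a<m. nats s' ''end2'' a =
      (if nats s' ''rep'' (t a) \<noteq> nats s' ''rep'' (h a) then nats s' ''rep'' (h a)
          else nats s ''end2'' a))"

lemma wt_update: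
  assumes i: "input s" and L: "L \<subseteq> {..<n}"
    and reach: "\<forall>u<n. nats s ''reach'' u = (if u \<in> L then 1 else 0)"
  shows "wt update_prog (7 + 13 * N)
    (updated L s) s"
proof -
  let ?z = "reals s ''cost''" and ?\<epsilon> = "reals s ''eps'' 0" and ?b =
      "nats s ''rep'' (nats s ''best'' 0)"
  let ?I = "\<lambda>k s'. \<forall>a<m. reals s' ''cost'' a = (if a < k \<and> enters a L then ?z a - ?\<epsilon> else ?z a)"
  let ?C = "Cond entering
       (RAssign ''cost'' (NVar ''i'') (RSub (RRead ''cost'' (NVar ''i''))
           (RRead ''eps'' (NConst 0)))) Skip"
  let ?D = "Cond (NPos (NRead ''reach'' (NVar ''i''))) (NAssign ''rep'' (NVar ''i'')
      (NVar ''x'')) Skip"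
  have first: "wt (For ''i'' ''arcs'' ?C) (2 + 4 * N) (?I m) s"
  proof (rule wt_For[where T = 2 and N = N and I = ?I and n = m])
    fix k s' assume k: "k < m" "?I k s'" "nats s' ''i'' 0 = k"
      and a: "agree (insert ''i'' (nwrites ?C)) (rwrites ?C) s s'"
    have *: "nats s' ''tail'' = t" "nats s' ''head'' = h" "nats s' ''reach'' = nats s ''reach''"
        "reals s' ''eps'' 0 = ?\<epsilon>"
      using a i by (simp_all add: agree_def input_def)
    have e: "nats s ''reach'' (t k) = 0 \<and> 0 < nats s ''reach'' (h k) \<longleftrightarrow> enters k L"
      using reach t_less[OF k(1)] h_less[OF k(1)] unfolding enters_def by simp
    show "wt ?C 2 (?I (Suc k)) s'"
      using k * e by (cases "enters k L") (auto simp: less_Suc_eq)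
  qed (use m_le i in \<open>auto simp: input_def\<close>)
  show ?thesis
    unfolding update_prog_def
  proof (rule wt_SeqI[OF first, where ?T2.0 = "5 + 9 * N"])
    fix s1 assume z1: "?I m s1" and a1: "agree (nwrites (For ''i'' ''arcs'' ?C))
        (rwrites (For ''i'' ''arcs'' ?C)) s s1"
    have inp1: "input s1" using a1 i by (rule input_agree) simp
    let ?s1 = "nupdate ''x'' 0 ?b s1"
    let ?J = "\<lambda>k s'. \<forall>v. nats s' ''rep'' v = (if v < k \<and> v \<in> L then ?b else nats s ''rep'' v)"
    have b: "nats s1 ''rep'' (nats s1 ''best'' 0) = ?b" using a1 by (simp add: agree_def)
    have second: "wt (For ''i'' ''nodes'' ?D) (2 + 4 * N) (?J n) ?s1"
    proof (rule wt_For[where T = 2 and N = N and I = ?J and n = n])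
      show "nats ?s1 ''nodes'' 0 = n" using inp1 by (simp add: input_def)
      show "?J 0 ?s1" using a1 by (simp add: agree_def)
      fix k s' assume k: "k < n" "?J k s'" "nats s' ''i'' 0 = k"
        and a: "agree (insert ''i'' (nwrites ?D)) (rwrites ?D) ?s1 s'"
      have *: "nats s' ''reach'' = nats s ''reach''" "nats s' ''x'' 0 = ?b"
        using a a1 by (simp_all add: agree_def)
      show "wt ?D 2 (?J (Suc k)) s'"
        using k * reach by (cases "k \<in> L") (auto simp: less_Suc_eq)
    qed (use n_le in auto)
    have "wt (Seq (For ''i'' ''nodes'' ?D) ends_prog) (4 + 9 * N)
      (updated L s) ?s1"
    proof (rule wt_SeqI[OF second, where ?T2.0 = "2 + 5 * N"])
      fix s2 assume J: "?J n s2" and a2: "agree (nwrites (For ''i'' ''nodes'' ?D))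
          (rwrites (For ''i'' ''nodes'' ?D)) ?s1 s2"
      have "input s2" using inp1 a2 by (simp add: input_def agree_def)
      from wt_ends[OF this] show "wt ends_prog (2 + 5 * N)
        (updated L s) s2"
      proof (rule wt_mono)
        fix s3 assume e: "ends_updated s2 s3" and a3: "agree (nwrites ends_prog)
            (rwrites ends_prog) s2 s3"
        have "reals s3 ''cost'' = reals s1 ''cost''" "nats s3 ''rep'' = nats s2 ''rep''"
            "nats s2 ''end1'' = nats s ''end1''" "nats s2 ''end2'' = nats s ''end2''"
          using a1 a2 a3 by (simp_all add: agree_def)
        then show "updated L s s3"
          using z1 J e L unfolding ends_updated_def updated_def by auto
      qed simp
    qed simp
    then show "wt (Seq (NSet ''x'' (NRead ''rep'' (NVar ''best'')))
        (Seq (For ''i'' ''nodes'' ?D) ends_prog)) (5 + 9 * N)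
      (updated L s) s1"
      using b by simp
  qed simp
qed

section \<open>Invariant of the ascent loop\<close>

definition dual_inv :: "(nat \<Rightarrow> real) \<Rightarrow> state \<Rightarrow> bool" where
  "dual_inv c s \<longleftrightarrow> (\<exists>F y M \<rho>. dual_state {..<n} {..<m} t h r c (reals s ''cost'') (nats s ''rep'')
     (nats s ''end1'') (nats s ''end2'') F y M \<rho>)"

text \<open>A certificate that no arborescence exists, by
  \<open>no_arb_if_not_entered\<close>.\<close>

definition unentered_set :: bool where
  "unentered_set \<longleftrightarrow> (\<exists>L. L \<subseteq> {..<n} - {r} \<and> L \<noteq> {} \<and> (\<forall>a<m. \<not> enters a L))"

definition main_inv :: "(nat \<Rightarrow> real) \<Rightarrow> state \<Rightarrow> bool" where
  "main_inv c s \<longleftrightarrow> input s \<and> dual_inv c s \<and>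
    (nats s ''go'' 0 = 1 \<and> nats s ''bad'' 0 = 0 \<or>
     nats s ''go'' 0 = 0 \<and> nats s ''bad'' 0 = 0 \<and> (\<forall>v<n. r \<in> anc (reals s ''cost'') v) \<or>
     nats s ''go'' 0 = 0 \<and> nats s ''bad'' 0 = 1 \<and> unentered_set)"

text \<open>A raise lowers the first summand. The second one pays for the last round, which clears
  \<open>go\<close> without changing a cost.\<close>

definition remaining :: "state \<Rightarrow> nat" where
  "remaining s = card {a\<in>{..<m}. 0 < reals s ''cost'' a} + nats s ''go'' 0"

lemma dual_inv_nonneg: "dual_inv c s \<Longrightarrow> a < m \<Longrightarrow> 0 \<le> reals s ''cost'' a"
  unfolding dual_inv_def by (auto dest!: dual_state.z_nonneg)

lemma dual_inv_update:
  assumes d: "dual_inv c s" and b: "found_smallest (reals s ''cost'') (nats s ''best'' 0)"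
    and L: "L = anc (reals s ''cost'') (nats s ''best'' 0)"
    and \<epsilon>: "min_entering (reals s ''cost'') L m (reals s ''eps'' 0)" and u: "updated L s s'"
  shows "dual_inv c s'"
      "card {a\<in>{..<m}. 0 < reals s' ''cost'' a} < card {a\<in>{..<m}. 0 < reals s ''cost'' a}"
proof -
  from d obtain F y M \<rho> where ds: "dual_state {..<n} {..<m} t h r c (reals s ''cost'')
      (nats s ''rep'')
     (nats s ''end1'') (nats s ''end2'') F y M \<rho>" unfolding dual_inv_def by blast
  have R: "anc (reals s ''cost'') v = {u\<in>{..<n}. (u, v) \<in> (tight (reals s ''cost'')
      {..<n})\<^sup>*}" for v
    by (simp add: anc_def)
  have b': "nats s ''best'' 0 \<in> {..<n}" "r \<notin> anc (reals s ''cost'') (nats s ''best'' 0)"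
    "\<And>v. v \<in> {..<n} \<Longrightarrow> r \<notin> anc (reals s ''cost'') v \<Longrightarrow>
      card (anc (reals s ''cost'') (nats s ''best'' 0)) \<le> card (anc (reals s ''cost'') v)"
    using b unfolding found_smallest_def by auto
  note A = smallest_ancestors[of _ "anc (reals s ''cost'')", OF b'(1) R b'(2,3), folded L]
  from \<epsilon> obtain a0 where a0: "a0 \<in> {..<m}" "enters a0 L" "reals s ''cost'' a0 = reals s ''eps'' 0"
    unfolding min_entering_def by auto
  have \<epsilon>le: "reals s ''eps'' 0 \<le> reals s ''cost'' a" if "a \<in> {..<m}" "enters a L" for a
    using \<epsilon> that unfolding min_entering_def by auto
  have u': "\<And>a. a \<in> {..<m} \<Longrightarrow> reals s' ''cost'' a =
      (if enters a L then reals s ''cost'' a - reals s ''eps'' 0 else reals s ''cost'' a)"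
    "\<And>v. v \<in> {..<n} \<Longrightarrow> nats s' ''rep'' v = (if v \<in> L then nats s ''rep'' (nats s ''best'' 0)
        else nats s ''rep'' v)"
    "\<And>a. a \<in> {..<m} \<Longrightarrow> nats s' ''end1'' a =
      (if nats s' ''rep'' (t a) \<noteq> nats s' ''rep'' (h a) then nats s' ''rep'' (t a)
          else nats s ''end1'' a)"
    "\<And>a. a \<in> {..<m} \<Longrightarrow> nats s' ''end2'' a =
      (if nats s' ''rep'' (t a) \<noteq> nats s' ''rep'' (h a) then nats s' ''rep'' (h a)
          else nats s ''end2'' a)"
    using u unfolding updated_def by (simp_all only: lessThan_iff)
  note step = dual_state.dual_state_step[OF ds A(1,2) A(3) A(4) \<epsilon>le a0 u']
  from step(1) show "dual_inv c s'" unfolding dual_inv_def by blast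
  from step(2) show
      "card {a\<in>{..<m}. 0 < reals s' ''cost'' a} < card {a\<in>{..<m}. 0 < reals s ''cost'' a}" .
qed

lemma wt_loop_body:
  assumes I: "main_inv c s" and go: "0 < nats s ''go'' 0"
  shows "wt loop_body (21 + 38 * N + 14 * N * N + 4 * N * N * N)
    (\<lambda>s'. main_inv c s' \<and> remaining s' < remaining s) s"
proof -
  let ?Q = "\<lambda>s'. main_inv c s' \<and> remaining s' < remaining s" and ?z = "reals s ''cost''"
  have i: "input s" and d: "dual_inv c s" and g: "nats s ''go'' 0 = 1" "nats s ''bad'' 0 = 0"
    using I go unfolding main_inv_def by auto
  note z = dual_inv_nonneg[OF d]
  let ?T2 = "17 + (25 * N + 4 * N * N)"
  let ?end = "Seq (NSet ''go'' (NConst 0)) (NSet ''bad'' (NConst 1))"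
  let ?C2 = "Cond (NPos (NVar ''found'')) update_prog ?end"
  let ?C1 = "Cond (NLess (NVar ''nodes'') (NVar ''size'')) (NSet ''go'' (NConst 0))
      (Seq select_prog ?C2)"
  show ?thesis
    unfolding loop_body_def
  proof (rule wt_SeqI[OF wt_search[OF i z], where ?T2.0 = "Suc ?T2"])
    show "a < m \<Longrightarrow> a < m" for a .
    fix s1 assume Q1:
        "if n < nats s1 ''size'' 0 then \<forall>v<n. r \<in> anc ?z v else found_smallest ?z (nats s1 ''best'' 0)"
      and a1: "agree (nwrites search_prog) (rwrites search_prog) s s1"
    have i1: "input s1" using a1 i by (rule input_agree) simp
    have e1: "reals s1 = reals s" "nats s1 ''rep'' = nats s ''rep''" "nats s1 ''end1'' =
        nats s ''end1''"
      "nats s1 ''end2'' = nats s ''end2''" "nats s1 ''go'' 0 = 1" "nats s1 ''bad'' 0 = 0"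
          "nats s1 ''nodes'' 0 = n"
      using a1 g i by (auto simp: agree_def input_def)
    have d1: "dual_inv c s1" using d e1 by (simp add: dual_inv_def)
    have z1: "\<And>a. a < m \<Longrightarrow> 0 \<le> reals s1 ''cost'' a" using z e1 by simp
    show "wt ?C1 (Suc ?T2) ?Q s1"
    proof (cases "n < nats s1 ''size'' 0")
      case True
      then show ?thesis using Q1 i1 d1 e1 g
        by (simp add: main_inv_def remaining_def input_def dual_inv_def)
    next
      case False
      let ?b = "nats s1 ''best'' 0"
      define L where "L = anc ?z ?b"
      have fs: "found_smallest ?z ?b" using Q1 False by simp
      have b: "?b < n" using fs by (simp add: found_smallest_def)
      have L1: "L = anc (reals s1 ''cost'') ?b" by (simp add: L_def e1)
      have "wt (Seq select_prog ?C2) ?T2 ?Q s1"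
      proof (rule wt_SeqI[OF wt_select[OF i1 z1 b L1], where ?T2.0 = "8 + 13 * N"])
        show "a < m \<Longrightarrow> a < m" for a .
        fix s2 assume "(\<forall>u<n. nats s2 ''reach'' u = (if u \<in> L then 1 else 0)) \<and>
          (if 0 < nats s2 ''found'' 0 then min_entering (reals s1 ''cost'') L m (reals s2 ''eps'' 0)
           else \<forall>a<m. \<not> enters a L)"
          and a2: "agree (nwrites select_prog) (rwrites select_prog) s1 s2"
        then have Q2: "\<forall>u<n. nats s2 ''reach'' u = (if u \<in> L then 1 else 0)"
          "0 < nats s2 ''found'' 0 \<Longrightarrow> min_entering ?z L m (reals s2 ''eps'' 0)"
          "\<not> 0 < nats s2 ''found'' 0 \<Longrightarrow> \<forall>a<m. \<not> enters a L" by (simp_all add: e1)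
        have i2: "input s2" using a2 i1 by (rule input_agree) simp
        have e2: "reals s2 ''cost'' = ?z" "nats s2 ''rep'' = nats s ''rep''" "nats s2 ''end1'' =
            nats s ''end1''"
          "nats s2 ''end2'' = nats s ''end2''" "nats s2 ''go'' 0 = 1" "nats s2 ''bad'' 0 = 0"
              "nats s2 ''best'' 0 = ?b"
          using a2 e1 by (simp_all add: agree_def)
        have d2: "dual_inv c s2" using d e2 by (simp add: dual_inv_def)
        have LV: "L \<subseteq> {..<n}" unfolding L_def by (rule anc_subset)
        show "wt ?C2 (8 + 13 * N) ?Q s2"
        proof (cases "0 < nats s2 ''found'' 0")
          case True
          have "wt update_prog (7 + 13 * N) ?Q s2"
          proof (rule wt_mono[OF wt_update[OF i2 LV Q2(1)]])
            fix s3 assume u: "updated L s2 s3" and a3: "agree (nwrites update_prog)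
                (rwrites update_prog) s2 s3"
            have i3: "input s3" using a3 i2 by (rule input_agree) simp
            have e3: "nats s3 ''go'' 0 = 1" "nats s3 ''bad'' 0 = 0" using a3 e2
                by (simp_all add: agree_def)
            have "dual_inv c s3"
                "card {a\<in>{..<m}. 0 < reals s3 ''cost'' a} < card {a\<in>{..<m}. 0 < reals s2 ''cost'' a}"
              using dual_inv_update[OF d2 _ _ _ u] fs Q2(2)[OF True] L_def e2 by simp_all
            then show "?Q s3" using i3 e3 e2 g by (simp add: main_inv_def remaining_def)
          qed simp
          then show ?thesis using True by simp
        next
          case False
          have "L \<subseteq> {..<n} - {r}" using LV fs by (auto simp: found_smallest_def L_def)
          moreover have "L \<noteq> {}" using b by (auto simp: L_def anc_def)
          ultimately have "unentered_set" using Q2(3)[OF False] unfolding unentered_set_def by blast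
          then show ?thesis using False i2 d2 e2 g
            by (simp add: main_inv_def remaining_def input_def dual_inv_def)
        qed
      qed simp
      then show ?thesis using False e1 by simp
    qed
  qed simp
qed

section \<open>What the output guarantees\<close>

definition feasible_output :: "(nat \<Rightarrow> real) \<Rightarrow> state \<Rightarrow> bool" where
  "feasible_output c s \<longleftrightarrow> (\<exists>z rep F y M \<rho>.
     dual_state {..<n} {..<m} t h r c z rep (nats s ''end1'') (nats s ''end2'') F y M \<rho> \<and>
     (\<forall>v<n. (r, v) \<in> (tight z {..<n})\<^sup>*) \<and>
     (\<forall>a<m. nats s ''ground'' a \<noteq> 0 \<longleftrightarrow> z a = 0 \<and> h a \<noteq> r) \<and>
     (\<forall>k. nats s ''bound'' k = (if k < n then 1 else 0)))"

definition infeasible_output :: "state \<Rightarrow> bool" where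
  "infeasible_output s \<longleftrightarrow> unentered_set \<and> nats s ''ground'' = (\<lambda>_. 0)(0 := 1) \<and>
     nats s ''end1'' 0 = 0 \<and> nats s ''end2'' 0 = 1 \<and> nats s ''bound'' = (\<lambda>_. 0)"

definition correct_output :: "(nat \<Rightarrow> real) \<Rightarrow> state \<Rightarrow> bool" where
  "correct_output c s \<longleftrightarrow> nats s ''vertices'' 0 = n \<and> (\<forall>a<m. nats s ''class'' a = h a) \<and>
     (feasible_output c s \<or> infeasible_output s)"

text \<open>The output loops only write ones into \<open>ground\<close> and \<open>bound\<close>, so
  these arrays have to be 0 beforehand.\<close>

lemma wt_output:
  assumes I: "main_inv c s" and go: "nats s ''go'' 0 = 0"
    and init: "nats s ''ground'' = (\<lambda>_. 0)" "nats s ''bound'' = (\<lambda>_. 0)"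
  shows "wt output_prog (8 + 10 * N) (correct_output c) s"
proof -
  have i: "input s" and d: "dual_inv c s" using I by (simp_all add: main_inv_def)
  let ?s = "nupdate ''vertices'' 0 n s" and ?z = "reals s ''cost''"
  let ?class = "NAssign ''class'' (NVar ''i'') (NRead ''head'' (NVar ''i''))"
  let ?ground = "Cond (BAnd zero_cost (NNeq (NRead ''head'' (NVar ''i'')) (NVar ''root'')))
             (NAssign ''ground'' (NVar ''i'') (NConst 1)) Skip"
  let ?bound = "NAssign ''bound'' (NVar ''i'') (NConst 1)"
  let ?inf = "Seq (NSet ''ground'' (NConst 1)) (Seq (NSet ''end1'' (NConst 0))
      (NSet ''end2'' (NConst 1)))"
  let ?feas = "Seq (For ''i'' ''arcs'' ?ground) (For ''i'' ''nodes'' ?bound)"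
  have cls: "wt (For ''i'' ''arcs'' ?class) (2 + 3 * N) (\<lambda>s'. \<forall>a<m. nats s' ''class'' a = h a) ?s"
    by (rule wt_For[where T = 1 and N = N and n = m and I = "\<lambda>k s'. \<forall>a<k. nats s' ''class'' a =
        h a"])
      (use i m_le in \<open>auto simp: input_def less_Suc_eq agree_def\<close>)
  have "wt (Seq (For ''i'' ''arcs'' ?class) (Cond (NPos (NVar ''bad'')) ?inf ?feas))
      (7 + 10 * N) (correct_output c) ?s"
  proof (rule wt_SeqI[OF cls, where ?T2.0 = "5 + 7 * N"])
    fix s1 assume c1: "\<forall>a<m. nats s1 ''class'' a = h a"
      and a1: "agree (nwrites (For ''i'' ''arcs'' ?class)) (rwrites (For ''i'' ''arcs'' ?class))
          ?s s1"
    have e1: "reals s1 = reals s" "nats s1 ''rep'' = nats s ''rep''" "nats s1 ''end1'' =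
        nats s ''end1''"
      "nats s1 ''end2'' = nats s ''end2''" "nats s1 ''bad'' = nats s ''bad''"
          "nats s1 ''vertices'' 0 = n"
      "nats s1 ''ground'' = (\<lambda>_. 0)" "nats s1 ''bound'' = (\<lambda>_. 0)"
      using a1 init by (auto simp: agree_def)
    have i1: "input s1" using a1 i by (simp add: agree_def input_def)
    show "wt (Cond (NPos (NVar ''bad'')) ?inf ?feas) (5 + 7 * N) (correct_output c) s1"
    proof (cases "0 < nats s ''bad'' 0")
      case True
      then have "unentered_set" using I go by (simp add: main_inv_def)
      then show ?thesis using True e1 c1 by (simp add: correct_output_def infeasible_output_def)
    next
      case False
      then have reach: "\<forall>v<n. r \<in> anc ?z v" using I go by (simp add: main_inv_def)
      let ?G = "\<lambda>k s'. \<forall>a. nats s' ''ground'' a \<noteq> 0 \<longleftrightarrow> a < k \<and> ?z a = 0 \<and> h a \<noteq> r"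
      have ground: "wt (For ''i'' ''arcs'' ?ground) (2 + 4 * N) (?G m) s1"
      proof (rule wt_For[where T = 2 and N = N and n = m and I = ?G])
        show "nats s1 ''arcs'' 0 = m" using i1 by (simp add: input_def)
        fix k s' assume k: "k < m" "?G k s'" "nats s' ''i'' 0 = k"
          and a: "agree (insert ''i'' (nwrites ?ground)) (rwrites ?ground) s1 s'"
        have *: "nats s' ''head'' = h" "nats s' ''root'' 0 = r" "reals s' ''cost'' = ?z"
          using a i1 e1 by (simp_all add: agree_def input_def)
        have z: "?z k = 0 \<longleftrightarrow> \<not> 0 < ?z k" using dual_inv_nonneg[OF d k(1)] by auto
        have G: "\<And>a. nats s' ''ground'' a \<noteq> 0 \<longleftrightarrow> a < k \<and> ?z a = 0 \<and> h a \<noteq> r" using k(2) by blast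
        show "wt ?ground 2 (?G (Suc k)) s'"
        proof (cases "?z k = 0 \<and> h k \<noteq> r")
          case True
          have "?G (Suc k) (nupdate ''ground'' k 1 s')"
          proof
            fix a show "(nats (nupdate ''ground'' k 1 s') ''ground'' a \<noteq> 0) = (a < Suc k \<and>
                ?z a = 0 \<and> h a \<noteq> r)"
              using G[of a] True by (cases "a = k") (simp_all add: less_Suc_eq)
          qed
          moreover have "h k < r \<or> r < h k" using True by linarith
          ultimately show ?thesis using True * z k(3) by simp
        next
          case False
          have "?G (Suc k) s'"
          proof
            fix a show "(nats s' ''ground'' a \<noteq> 0) = (a < Suc k \<and> ?z a = 0 \<and> h a \<noteq> r)"
              using G[of a] False by (cases "a = k") (simp_all add: less_Suc_eq)
          qed
          moreover have "\<not> (?z k = 0 \<and> (h k < r \<or> r < h k))" using False by auto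
          ultimately show ?thesis using * z k(3) by (simp add: nat_neq_iff)
        qed
      qed (use m_le e1 in auto)
      have "wt ?feas (4 + 7 * N) (correct_output c) s1"
      proof (rule wt_SeqI[OF ground, where ?T2.0 = "2 + 3 * N"])
        fix s2 assume g2: "?G m s2"
          and a2: "agree (nwrites (For ''i'' ''arcs'' ?ground))
              (rwrites (For ''i'' ''arcs'' ?ground)) s1 s2"
        have e2: "nats s2 ''end1'' = nats s ''end1''"  "nats s2 ''end2'' = nats s ''end2''"
          "nats s2 ''vertices'' 0 = n" "nats s2 ''bound'' = (\<lambda>_. 0)" "nats s2 ''class'' =
              nats s1 ''class''"
          "nats s2 ''nodes'' 0 = n"
          using a2 e1 i1 by (simp_all add: agree_def input_def)
        show "wt (For ''i'' ''nodes'' ?bound) (2 + 3 * N) (correct_output c) s2"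
        proof (rule wt_mono[OF wt_For[where T = 1 and N = N and n = n and s = s2 and C = ?bound and
              I = "\<lambda>k s'. \<forall>v. nats s' ''bound'' v = (if v < k then 1 else 0)"]])
          fix s3 assume b3: "\<forall>v. nats s3 ''bound'' v = (if v < n then 1 else 0)"
            and a3: "agree (nwrites (For ''i'' ''nodes'' ?bound))
                (rwrites (For ''i'' ''nodes'' ?bound)) s2 s3"
          have e3: "nats s3 ''end1'' = nats s ''end1''"  "nats s3 ''end2'' = nats s ''end2''"
            "nats s3 ''vertices'' 0 = n" "nats s3 ''class'' = nats s1 ''class''"
                "nats s3 ''ground'' = nats s2 ''ground''"
            using a3 e2 by (simp_all add: agree_def)
          obtain F y M \<rho> where "dual_state {..<n} {..<m} t h r c ?z (nats s ''rep'')
              (nats s3 ''end1'') (nats s3 ''end2'') F y M \<rho>"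
            using d e3 unfolding dual_inv_def by auto
          moreover have "\<forall>v<n. (r, v) \<in> (tight ?z {..<n})\<^sup>*" using reach by (auto simp: anc_def)
          moreover have "\<forall>a<m. nats s3 ''ground'' a \<noteq> 0 \<longleftrightarrow> ?z a = 0 \<and> h a \<noteq> r" using g2 e3 by simp
          ultimately have "feasible_output c s3" using b3 unfolding feasible_output_def by blast
          then show "correct_output c s3" using c1 e3 by (simp add: correct_output_def)
        qed (use e2 n_le in \<open>auto simp: agree_def less_Suc_eq\<close>)
      qed simp
      then show ?thesis using False e1 by simp
    qed
  qed simp
  then show ?thesis unfolding output_prog_def using i by (simp add: input_def)
qed

theorem wt_main:
  assumes i: "input s" and N: "1 \<le> N"
    and init: "nats s ''ground'' = (\<lambda>_. 0)" "nats s ''bound'' = (\<lambda>_. 0)" "nats s ''bad'' = (\<lambda>_. 0)"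
      "nats s ''end1'' = (\<lambda>_. 0)" "nats s ''end2'' = (\<lambda>_. 0)"
  shows "wt main_prog (202 * N ^ 4) (correct_output (reals s ''cost'')) s"
proof -
  let ?c = "reals s ''cost''"
  let ?T = "21 + 38 * N + 14 * N * N + 4 * N * N * N"
  let ?TW = "1 + (N + 1) * (?T + 1)"
  let ?W = "While (NPos (NVar ''go'')) loop_body"
  have loop: "wt (Seq (NSet ''go'' (NConst 1)) (Seq ?W output_prog)) (1 + (?TW + (8 + 10 * N)))
      (correct_output ?c) s'"
    if I: "input s'" "dual_inv ?c s'" and s': "nats s' ''ground'' = (\<lambda>_. 0)"
        "nats s' ''bound'' = (\<lambda>_. 0)" "nats s' ''bad'' = (\<lambda>_. 0)"
    for s'
  proof -
    let ?s = "nupdate ''go'' 0 1 s'"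
    have "card {a\<in>{..<m}. 0 < reals ?s ''cost'' a} \<le> card {..<m}" by (intro card_mono) auto
    then have rem: "remaining ?s \<le> N + 1" using m_le by (simp add: remaining_def)
    have "wt ?W ?TW (\<lambda>s'. main_inv ?c s' \<and> \<not> bval (NPos (NVar ''go'')) s') ?s"
    proof (rule wt_While[where \<mu> = remaining and T = ?T])
      show "main_inv ?c ?s" using I s' by (simp add: main_inv_def input_def dual_inv_def)
      show "1 + remaining ?s * (?T + 1) \<le> ?TW" by (intro add_left_mono mult_right_mono rem) simp
      fix s1 assume "main_inv ?c s1" "bval (NPos (NVar ''go'')) s1"
      then show "wt loop_body ?T (\<lambda>s''. main_inv ?c s'' \<and> remaining s'' < remaining s1) s1"
        by (intro wt_loop_body) simp_all
    qed
    then have "wt (Seq ?W output_prog) (?TW + (8 + 10 * N)) (correct_output ?c) ?s"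
    proof (rule wt_SeqI)
      fix s1 assume "main_inv ?c s1 \<and> \<not> bval (NPos (NVar ''go'')) s1"
          and "agree (nwrites ?W) (rwrites ?W) ?s s1"
      then show "wt output_prog (8 + 10 * N) (correct_output ?c) s1"
        using s' by (intro wt_output) (simp_all add: agree_def)
    qed simp
    then show ?thesis by simp
  qed
  let ?Time = "(5 + 9 * N) + ((2 + 3 * N) + ((2 + 5 * N) + (1 + (?TW + (8 + 10 * N)))))"
  have "wt main_prog ?Time (correct_output ?c) s"
    unfolding main_prog_def
  proof (rule wt_SeqI[OF wt_shift[OF i]])
    fix s1 assume z1: "\<forall>a<m. 0 \<le> reals s1 ''cost'' a \<and>
        ?c a = reals s1 ''cost'' a + reals s1 ''min'' 0"
      and a1: "agree (nwrites shift_prog) (rwrites shift_prog) s s1"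
    have i1: "input s1" using a1 i by (rule input_agree) simp
    show "wt (Seq init_rep_prog (Seq ends_prog (Seq (NSet ''go'' (NConst 1)) (Seq ?W output_prog))))
        ((2 + 3 * N) + ((2 + 5 * N) + (1 + (?TW + (8 + 10 * N))))) (correct_output ?c) s1"
    proof (rule wt_SeqI[OF wt_init_rep[OF i1]])
      fix s2 assume r2: "\<forall>v<n. nats s2 ''rep'' v = v"
        and a2: "agree (nwrites init_rep_prog) (rwrites init_rep_prog) s1 s2"
      have i2: "input s2" using a2 i1 by (rule input_agree) simp
      show "wt (Seq ends_prog (Seq (NSet ''go'' (NConst 1)) (Seq ?W output_prog)))
        ((2 + 5 * N) + (1 + (?TW + (8 + 10 * N)))) (correct_output ?c) s2"
      proof (rule wt_SeqI[OF wt_ends[OF i2]])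
        fix s3 assume e3: "ends_updated s2 s3" and a3: "agree (nwrites ends_prog)
            (rwrites ends_prog) s2 s3"
        have i3: "input s3" using a3 i2 by (rule input_agree) simp
        have *: "nats s3 ''rep'' = nats s2 ''rep''" "reals s3 ''cost'' = reals s1 ''cost''"
          "nats s2 ''end1'' = (\<lambda>_. 0)" "nats s2 ''end2'' = (\<lambda>_. 0)"
          using a1 a2 a3 init by (simp_all add: agree_def)
        have "dual_state {..<n} {..<m} t h r ?c (reals s3 ''cost'') (nats s3 ''rep'')
            (nats s3 ''end1'') (nats s3 ''end2'')
            {} (\<lambda>_. 0) (reals s1 ''min'' 0) (\<lambda>_. 0)"
          using z1 r2 e3 * t_less h_less r_less
              by (intro dual_state_init) (auto simp: ends_updated_def)
        then have "dual_inv ?c s3" unfolding dual_inv_def by blast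
        then show "wt (Seq (NSet ''go'' (NConst 1)) (Seq ?W output_prog))
            (1 + (?TW + (8 + 10 * N))) (correct_output ?c) s3"
          using i3 a1 a2 a3 init by (intro loop) (simp_all add: agree_def)
      qed simp
    qed simp
  qed simp
  \<comment> \<open>The polynomial \<open>?Time\<close> has degree 4 and coefficients with sum 202.
    The degree comes from \<open>N + 1\<close> rounds of cubic cost.\<close>
  moreover have "?Time \<le> 202 * N ^ 4"
  proof -
    from N obtain k where "N = Suc k" by (cases N) auto
    then show ?thesis by (simp add: algebra_simps power4_eq_xxxx)
  qed
  ultimately show ?thesis by (rule wt_mono)
qed

end

section \<open>From positions to nodes and arcs\<close>

text \<open>With nonempty classes of bound 1, bases of the partition matroid meet every class once.
  There are \<open>card V - 1\<close> classes, so such a set has as many elements as a forest can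
  have, and is a base of the cycle matroid as soon as it is a forest.\<close>

lemma common_base_iff:
  assumes A: "finite A" and V: "finite V" "V \<noteq> {}" and e: "\<forall>a\<in>A. \<exists>x\<in>V. \<exists>y\<in>V. ends a = {x, y}"
    and K: "finite K" "card K = card V - 1" "\<And>a. a \<in> A \<Longrightarrow> cls a \<in> K" "\<And>k. k \<in> K \<Longrightarrow> \<exists>a\<in>A. cls a = k"
    and d: "\<And>k. k \<in> K \<Longrightarrow> d k = 1"
    and B: "B \<subseteq> A"
  shows "matroid_base (cycle_matroid A ends) B \<and> matroid_base (partition_matroid A cls d) B \<longleftrightarrow>
    uforest ends B \<and> (\<forall>k\<in>K. card {a\<in>B. cls a = k} = 1)"
proof
  assume base: "matroid_base (cycle_matroid A ends) B \<and> matroid_base (partition_matroid A cls d) B"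
  then have "uforest ends B" by (simp add: matroid_base_def cycle_matroid_def)
  moreover have "card {a\<in>B. cls a = k} = 1" if k: "k \<in> K" for k
  proof -
    have indep: "card {a\<in>B. cls a = j} \<le> d j" for j
      using base by (simp add: matroid_base_def partition_matroid_def)
    have max: "I = B" if "I \<subseteq> A" "\<And>j. card {a\<in>I. cls a = j} \<le> d j" "B \<subseteq> I" for I
      using base that by (simp add: matroid_base_def partition_matroid_def)
    have "{a\<in>B. cls a = k} \<noteq> {}"
    proof
      assume empty: "{a\<in>B. cls a = k} = {}"
      \<comment> \<open>An element of a missed class could be added without violating any bound,
        against maximality.\<close>
      from K(4)[OF k] obtain a where a: "a \<in> A" "cls a = k" by blast
      have "{b\<in>insert a B. cls b = j} = (if j = k then {a} else {b\<in>B. cls b = j})" for j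
        using a empty by auto
      then have "card {b\<in>insert a B. cls b = j} \<le> d j" for j
        using indep[of j] d[OF k] by simp
      then have "insert a B = B" using a B by (intro max) auto
      then show False using a empty by auto
    qed
    then show ?thesis
      using indep[of k] d[OF k] finite_subset[OF B A] card_gt_0_iff[of "{a\<in>B. cls a = k}"] by simp
  qed
  ultimately show "uforest ends B \<and> (\<forall>k\<in>K. card {a\<in>B. cls a = k} = 1)" by blast
next
  assume r: "uforest ends B \<and> (\<forall>k\<in>K. card {a\<in>B. cls a = k} = 1)"
  have finB: "finite B" using finite_subset[OF B A] .
  have "B = (\<Union>k\<in>K. {a\<in>B. cls a = k})" using K(3) B by auto
  then have "card B = card (\<Union>k\<in>K. {a\<in>B. cls a = k})" by simp
  also have "\<dots> = (\<Sum>k\<in>K. card {a\<in>B. cls a = k})"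
    using K(1) finB by (intro card_UN_disjoint) auto
  finally have cardB: "card B = card V - 1" using r K(2) by simp
  have M1: "matroid_base (cycle_matroid A ends) B"
    unfolding matroid_base_def cycle_matroid_def
  proof (intro conjI ballI impI CollectI)
    fix I assume I: "I \<in> {I. I \<subseteq> A \<and> uforest ends I}" "B \<subseteq> I"
    then have finI: "finite I" using A finite_subset by auto
    have "card I \<le> card V - 1" using I e finI V by (intro uforest_card(1)[of ends]) auto
    then show "I = B" using I(2) cardB finI by (metis card_seteq)
  qed (use r B in auto)
  have "matroid_base (partition_matroid A cls d) B"
    unfolding matroid_base_def partition_matroid_def
  proof (intro conjI ballI impI CollectI allI)
    fix k
    show "card {a\<in>B. cls a = k} \<le> d k"
    proof (cases "k \<in> K")
      case False
      then have "{a\<in>B. cls a = k} = {}" using B K(3) by auto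
      then show ?thesis by (metis card.empty le0)
    qed (use r d in auto)
  next
    fix I assume I: "I \<in> {I. I \<subseteq> A \<and> (\<forall>k. card {a\<in>I. cls a = k} \<le> d k)}" "B \<subseteq> I"
    have "a \<in> B" if a: "a \<in> I" for a
    proof -
      have k: "cls a \<in> K" using a I K(3) by auto
      have "finite I" using I(1) A finite_subset by blast
      then have "finite {b\<in>I. cls b = cls a}" by simp
      moreover have "{b\<in>B. cls b = cls a} \<subseteq> {b\<in>I. cls b = cls a}" using I(2) by auto
      moreover have "card {b\<in>I. cls b = cls a} \<le> card {b\<in>B. cls b = cls a}"
      proof -
        have "card {b\<in>I. cls b = cls a} \<le> d (cls a)" using I(1) by blast
        also have "\<dots> = card {b\<in>B. cls b = cls a}" using r d[OF k] k by simp
        finally show ?thesis .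
      qed
      ultimately have "{b\<in>B. cls b = cls a} = {b\<in>I. cls b = cls a}" by (rule card_seteq)
      then show ?thesis using a by auto
    qed
    then show "I = B" using I(2) by auto
  qed (use B in auto)
  with M1 show "matroid_base (cycle_matroid A ends) B \<and>
      matroid_base (partition_matroid A cls d) B" by blast
qed

section \<open>Transporting connectivity and forests along maps\<close>

lemma uconnected_image:
  assumes "uconnected V ends B" "\<And>b. b \<in> B \<Longrightarrow> f b \<in> B' \<and> ends' (f b) = g ` ends b"
  shows "uconnected (g ` V) ends' B'"
proof -
  have "(g x, g y) \<in> (adj ends' B')\<^sup>*" if "(x, y) \<in> (adj ends B)\<^sup>*" for x y
    using that
  proof induction
    case (step y z)
    then obtain b where "b \<in> B" "ends b = {y, z}" by auto
    with assms(2)[of b] have "(g y, g z) \<in> adj ends' B'" by auto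
    with step.IH show ?case by (rule rtrancl.rtrancl_into_rtrancl)
  qed simp
  then show ?thesis using assms(1) unfolding uconnected_iff by blast
qed

lemma ucycle_map: "inj_on f (set es) \<Longrightarrow> ucycle ends ws (map f es) \<longleftrightarrow> ucycle (\<lambda>a. ends (f a)) ws es"
  by (auto simp: ucycle_def distinct_map)

lemma uforest_image:
  assumes "inj_on f B"
  shows "uforest ends (f ` B) \<longleftrightarrow> uforest (\<lambda>a. ends (f a)) B"
proof -
  have "(\<exists>es. ucycle ends ws es \<and> set es \<subseteq> f ` B) \<longleftrightarrow> (\<exists>es. ucycle (\<lambda>a. ends (f a)) ws es \<and>
      set es \<subseteq> B)" for ws
  proof
    assume "\<exists>es. ucycle ends ws es \<and> set es \<subseteq> f ` B"
    then obtain es where es: "ucycle ends ws es" "set es \<subseteq> f ` B" by blast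
    define es' where "es' = map (inv_into B f) es"
    have "map (f \<circ> inv_into B f) es = es"
      using es(2) by (intro map_idI) (auto simp: f_inv_into_f)
    then have es': "es = map f es'" by (simp add: es'_def)
    have es'B: "set es' \<subseteq> B" using es(2) by (auto simp: es'_def inv_into_into)
    have "ucycle (\<lambda>a. ends (f a)) ws es'" using es(1) ucycle_map[OF inj_on_subset[OF assms es'B]]
      unfolding es' by blast
    then show "\<exists>es. ucycle (\<lambda>a. ends (f a)) ws es \<and> set es \<subseteq> B" using es'B by blast
  next
    assume "\<exists>es. ucycle (\<lambda>a. ends (f a)) ws es \<and> set es \<subseteq> B"
    then obtain es where es: "ucycle (\<lambda>a. ends (f a)) ws es" "set es \<subseteq> B" by blast
    then have "ucycle ends ws (map f es)" using ucycle_map[OF inj_on_subset[OF assms es(2)]]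
        by blast
    then show "\<exists>es. ucycle ends ws es \<and> set es \<subseteq> f ` B" using image_mono[OF es(2), of f]
        by (metis set_map)
  qed
  then show ?thesis unfolding uforest_def by blast
qed

lemma pos_less: "distinct xs \<Longrightarrow> x \<in> set xs \<Longrightarrow> pos xs x < length xs"
  and nth_pos: "distinct xs \<Longrightarrow> x \<in> set xs \<Longrightarrow> xs ! pos xs x = x"
  by (auto simp: in_set_conv_nth pos_nth)

section \<open>The digraph and its positions\<close>

locale enumerated_digraph =
  fixes D :: "('a, 'b) pre_digraph" and r :: 'a and c :: "'b \<Rightarrow> real" and vs ::
      "'a list" and as :: "'b list"
  assumes fin: "fin_digraph D" and r: "r \<in> verts D" and nontrivial: "arcs D \<noteq> {} \<or> verts D = {r}"
    and vs: "enumerates vs (verts D)" and as: "enumerates as (arcs D)"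
begin

abbreviation n :: nat where "n \<equiv> length vs"
abbreviation m :: nat where "m \<equiv> length as"
abbreviation s0 :: state where "s0 \<equiv> input_state D r c vs as"
abbreviation t :: "nat \<Rightarrow> nat" where "t \<equiv> nats s0 ''tail''"
abbreviation h :: "nat \<Rightarrow> nat" where "h \<equiv> nats s0 ''head''"
abbreviation root :: nat where "root \<equiv> pos vs r"

lemma vs': "distinct vs" "set vs = verts D" "card (verts D) = n"
  and as': "distinct as" "set as = arcs D" "card (arcs D) = m"
  using vs as distinct_card[of vs] distinct_card[of as] by (auto simp: enumerates_def)

lemma t_eq: "i < m \<Longrightarrow> t i = pos vs (tail D (as ! i))"
  and h_eq: "i < m \<Longrightarrow> h i = pos vs (head D (as ! i))"
  and c_eq: "i < m \<Longrightarrow> reals s0 ''cost'' i = c (as ! i)"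
  by (simp_all add: input_state_def)

lemma ends_in_verts: "a \<in> arcs D \<Longrightarrow> tail D a \<in> verts D" "a \<in> arcs D \<Longrightarrow> head D a \<in> verts D"
  using fin by (auto simp: fin_digraph_def wf_digraph_def)

lemma pos_arc: "a \<in> arcs D \<Longrightarrow> pos as a < m" "a \<in> arcs D \<Longrightarrow> as ! pos as a = a"
  using pos_less nth_pos as' by metis+

lemma pos_node: "v \<in> verts D \<Longrightarrow> pos vs v < n" "v \<in> verts D \<Longrightarrow> vs ! pos vs v = v"
  using pos_less nth_pos vs' by metis+

lemma nth_arc: "i < m \<Longrightarrow> as ! i \<in> arcs D" "i < m \<Longrightarrow> pos as (as ! i) = i"
  using as' pos_nth nth_mem by metis+

lemma nth_node: "i < n \<Longrightarrow> vs ! i \<in> verts D" "i < n \<Longrightarrow> pos vs (vs ! i) = i"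
  using vs' pos_nth nth_mem by metis+

lemma t_pos: "a \<in> arcs D \<Longrightarrow> t (pos as a) = pos vs (tail D a)"
  and h_pos: "a \<in> arcs D \<Longrightarrow> h (pos as a) = pos vs (head D a)"
  and c_pos: "a \<in> arcs D \<Longrightarrow> reals s0 ''cost'' (pos as a) = c a"
  using t_eq h_eq c_eq pos_arc by simp_all

lemma inj_pos: "inj_on (pos as) (arcs D)"
  using pos_arc by (metis inj_onI)

lemma inj_pos_node: "inj_on (pos vs) (verts D)"
  using pos_node by (metis inj_onI)

end

sublocale enumerated_digraph \<subseteq> network_program "length vs" "length as"
  "nats (input_state D r c vs as) ''tail''" "nats (input_state D r c vs as) ''head''" "pos vs r"
      "length vs + length as"
proof unfold_locales
  show "a \<in> {..<m} \<Longrightarrow> t a \<in> {..<n}" "a \<in> {..<m} \<Longrightarrow> h a \<in> {..<n}" for a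
    using t_eq h_eq nth_arc ends_in_verts pos_node by simp_all
qed (use pos_node r in auto)

context enumerated_digraph
begin

lemma vertex_image: "pos vs ` verts D = {..<n}" "(!) vs ` {..<n} = verts D"
proof -
  show "pos vs ` verts D = {..<n}"
  proof (intro equalityI subsetI)
    fix i assume "i \<in> {..<n}"
    then show "i \<in> pos vs ` verts D" using nth_node[of i] by (metis imageI lessThan_iff)
  qed (use pos_node(1) in auto)
  show "(!) vs ` {..<n} = verts D"
  proof (intro equalityI subsetI)
    fix v assume "v \<in> verts D"
    then show "v \<in> (!) vs ` {..<n}" using pos_node[of v] by (metis imageI lessThan_iff)
  qed (use nth_node(1) in auto)
qed

lemma indegree_one_pos_iff:
  assumes B: "B \<subseteq> arcs D"
  shows "indegree_one (pos as ` B) \<longleftrightarrow> card (in_arcs D r \<inter> B) = 0 \<and>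
      (\<forall>v\<in>verts D - {r}. card (in_arcs D v \<inter> B) = 1)"
proof -
  have finB: "finite B" using B as'(2) finite_subset by (metis List.finite_set)
  have inj: "inj_on (pos as) B" using inj_pos B inj_on_subset by blast
  have "{a \<in> pos as ` B. h a = pos vs v} = pos as ` (in_arcs D v \<inter> B)" if v: "v \<in> verts D" for v
  proof -
    have "h (pos as b) = pos vs v \<longleftrightarrow> head D b = v" if "b \<in> B" for b
    proof -
      have b: "b \<in> arcs D" using that B by auto
      show ?thesis using h_pos[OF b] pos_node(2)[OF v] pos_node(2)[OF ends_in_verts(2)[OF b]]
          by metis
    qed
    then show ?thesis using B by (auto simp: in_arcs_def)
  qed
  then have *: "card {a \<in> pos as ` B. h a = pos vs v} = card (in_arcs D v \<inter> B)"
      if "v \<in> verts D" for v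
    using that inj card_image[OF inj_on_subset[OF inj]] by simp
  have "(\<forall>a\<in>pos as ` B. h a \<noteq> root) \<longleftrightarrow> card {a \<in> pos as ` B. h a = root} = 0"
    using finB by (auto simp: card_eq_0_iff)
  also have "\<dots> \<longleftrightarrow> card (in_arcs D r \<inter> B) = 0" using *[OF r] by simp
  finally have 1: "(\<forall>a\<in>pos as ` B. h a \<noteq> root) \<longleftrightarrow> card (in_arcs D r \<inter> B) = 0" .
  have "{..<n} - {root} = pos vs ` (verts D - {r})"
    using inj_on_image_set_diff[OF inj_pos_node, of "verts D" "{r}"] vertex_image(1) r by auto
  then have 2: "(\<forall>v\<in>{..<n} - {root}. card {a \<in> pos as ` B. h a = v} = 1) \<longleftrightarrow>
      (\<forall>v\<in>verts D - {r}. card (in_arcs D v \<inter> B) = 1)"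
    using * by simp
  have "pos as ` B \<subseteq> {..<m}" using B pos_arc(1) by auto
  then show ?thesis unfolding indegree_one_def 1 2 by simp
qed

lemma uconnected_pos_iff:
  assumes B: "B \<subseteq> arcs D"
  shows "uconnected {..<n} arc_ends (pos as ` B) \<longleftrightarrow>
      uconnected (verts D) (\<lambda>a. {tail D a, head D a}) B"
proof
  assume "uconnected {..<n} arc_ends (pos as ` B)"
  then have "uconnected ((!) vs ` {..<n}) (\<lambda>a. {tail D a, head D a}) B"
  proof (rule uconnected_image[where f = "(!) as"])
    fix i assume "i \<in> pos as ` B"
    then obtain b where b: "b \<in> B" "i = pos as b" by auto
    then have "b \<in> arcs D" using B by auto
    then show "as ! i \<in> B \<and> {tail D (as ! i), head D (as ! i)} = (!) vs ` {t i, h i}"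
      using b t_pos h_pos pos_arc pos_node ends_in_verts by simp
  qed
  then show "uconnected (verts D) (\<lambda>a. {tail D a, head D a}) B" by (simp only: vertex_image)
next
  assume "uconnected (verts D) (\<lambda>a. {tail D a, head D a}) B"
  then have "uconnected (pos vs ` verts D) arc_ends (pos as ` B)"
  proof (rule uconnected_image[where f = "pos as"])
    fix b assume b: "b \<in> B"
    then have "b \<in> arcs D" using B by auto
    then show "pos as b \<in> pos as ` B \<and> {t (pos as b), h (pos as b)} = pos vs ` {tail D b, head D b}"
      using b t_pos h_pos by simp
  qed
  then show "uconnected {..<n} arc_ends (pos as ` B)" by (simp only: vertex_image)
qed

lemma arborescence_iff_arb:
  assumes B: "B \<subseteq> arcs D"
  shows "arborescence D r B \<longleftrightarrow> arb (pos as ` B)"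
proof -
  have finB: "finite B" using B as'(2) finite_subset by (metis List.finite_set)
  have inj: "inj_on (pos as) B" using inj_pos B inj_on_subset by blast
  have "spanning_utree (verts D) (\<lambda>a. {tail D a, head D a}) B \<longleftrightarrow>
      uconnected (verts D) (\<lambda>a. {tail D a, head D a}) B \<and> card B = card (verts D) - 1"
  proof (rule spanning_utree_iff_card)
    show "finite (verts D)" using vs'(2) by (metis List.finite_set)
    show "verts D \<noteq> {}" using r by auto
    show "\<forall>e\<in>B. \<exists>x\<in>verts D. \<exists>y\<in>verts D. {tail D e, head D e} = {x, y}"
      using B ends_in_verts by blast
  qed (rule finB)
  moreover have "card B = card (verts D) - 1" if "indegree_one (pos as ` B)"
    using indegree_one_card[OF that] card_image[OF inj] vs'(3) by simp
  ultimately show ?thesis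
    unfolding arborescence_def arb_def uconnected_pos_iff[OF B]
    using indegree_one_pos_iff[OF B] B by blast
qed

lemma min_cost_arborescence_iff:
  assumes B: "B \<subseteq> arcs D"
  shows "min_cost_arborescence D r c B \<longleftrightarrow> min_arb (reals s0 ''cost'') (pos as ` B)"
proof -
  have sum: "sum (reals s0 ''cost'') (pos as ` B') = sum c B'" if "B' \<subseteq> arcs D" for B'
    using that c_pos inj_on_subset[OF inj_pos that] by (simp add: sum.reindex subset_iff)
  have "(\<forall>B'. arborescence D r B' \<longrightarrow> sum c B \<le> sum c B') \<longleftrightarrow>
      (\<forall>I. arb I \<longrightarrow> sum (reals s0 ''cost'') (pos as ` B) \<le> sum (reals s0 ''cost'') I)"
  proof (intro iffI allI impI)
    fix I assume L: "\<forall>B'. arborescence D r B' \<longrightarrow> sum c B \<le> sum c B'" and I: "arb I"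
    then have Im: "I \<subseteq> {..<m}" by (simp add: arb_def indegree_one_def)
    then have "(!) as ` I \<subseteq> arcs D" using nth_arc by auto
    moreover have "pos as ` (!) as ` I = I" using Im nth_arc(2) by (force simp: image_iff)
    ultimately show "sum (reals s0 ''cost'') (pos as ` B) \<le> sum (reals s0 ''cost'') I"
      using L I sum[OF B] sum[of "(!) as ` I"] arborescence_iff_arb[of "(!) as ` I"] by simp
  next
    fix B' assume R: "\<forall>I. arb I \<longrightarrow> sum (reals s0 ''cost'') (pos as ` B) \<le> sum (reals s0 ''cost'') I"
      and B': "arborescence D r B'"
    then have "B' \<subseteq> arcs D" by (simp add: arborescence_def)
    then show "sum c B \<le> sum c B'" using R B' sum B arborescence_iff_arb by metis
  qed
  then show ?thesis unfolding min_cost_arborescence_def min_arb_def arborescence_iff_arb[OF B]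
      by blast
qed

lemma input_s0: "input s0"
  using vs' as' by (simp add: input_def) (simp add: input_state_def)

lemma finite_ground: "finite (out_ground as s)" and ground_subset: "out_ground as s \<subseteq> arcs D"
  by (simp_all add: out_ground_def as'(2)[symmetric])

text \<open>The class of an arc is its head, and arcs into the root are not in the ground set. So
  the classes are the nodes other than the root, as many as a spanning tree has edges, and
  \<open>common_base_iff\<close> matches \<open>min_arb_iff_new_forest\<close>.\<close>

theorem correct_output_feasible:
  assumes s: "correct_output (reals s0 ''cost'') s" and f: "feasible_output (reals s0 ''cost'') s"
  defines "A' \<equiv> out_ground as s"
  shows "ugraph (out_vertices s) A' (out_ends as s)"
    and "B \<subseteq> arcs D \<Longrightarrow> min_cost_arborescence D r c B \<longleftrightarrow>
      B \<subseteq> A' \<and> matroid_base (cycle_matroid A' (out_ends as s)) B \<and>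
      matroid_base (partition_matroid A' (out_class as s) (out_bound s)) B"
proof -
  from f obtain z rep F y M \<rho> where
    ds: "dual_state {..<n} {..<m} t h root (reals s0 ''cost'') z rep (nats s ''end1'')
        (nats s ''end2'') F y M \<rho>"
    and reach: "\<And>v. v \<in> {..<n} \<Longrightarrow> (root, v) \<in> (tight z {..<n})\<^sup>*"
    and ground: "\<And>a. a < m \<Longrightarrow> nats s ''ground'' a \<noteq> 0 \<longleftrightarrow> z a = 0 \<and> h a \<noteq> root"
    and bound: "\<And>k. nats s ''bound'' k = (if k < n then 1 else 0)"
    unfolding feasible_output_def by auto
  let ?new = "\<lambda>a. {nats s ''end1'' a, nats s ''end2'' a}"
  have V: "out_vertices s = {..<n}" and cls: "\<And>a. a < m \<Longrightarrow> nats s ''class'' a = h a"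
    using s by (simp_all add: correct_output_def out_vertices_def)
  have A': "a \<in> A' \<longleftrightarrow> a \<in> arcs D \<and> z (pos as a) = 0 \<and> h (pos as a) \<noteq> root" for a
    using ground[of "pos as a"] pos_arc(1)[of a] as'(2) by (auto simp: A'_def out_ground_def)
  have ends: "\<forall>a\<in>A'. \<exists>x\<in>{..<n}. \<exists>y\<in>{..<n}. out_ends as s a = {x, y}"
    using dual_state.ends_in_V[OF ds] A' pos_arc(1) unfolding out_ends_def by blast
  then show "ugraph (out_vertices s) A' (out_ends as s)"
    unfolding ugraph_def V using finite_ground by (fastforce simp: A'_def card_insert_if)
  fix B assume B: "B \<subseteq> arcs D"
  have inj: "inj_on (pos as) B" using inj_pos B inj_on_subset by blast
  have base: "matroid_base (cycle_matroid A' (out_ends as s)) B \<and>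
      matroid_base (partition_matroid A' (out_class as s) (out_bound s)) B \<longleftrightarrow>
      uforest (out_ends as s) B \<and> (\<forall>v\<in>{..<n} - {root}. card {a\<in>B. out_class as s a = v} = 1)"
    if BA: "B \<subseteq> A'"
  proof (rule common_base_iff[OF _ _ _ ends _ _ _ _ _ BA])
    show "finite A'" using finite_ground by (simp add: A'_def)
    show "{..<n} \<noteq> {}" using r_less by auto
    show "card ({..<n} - {root}) = card {..<n} - 1" using r_less by (simp add: card_Diff_singleton)
    show "out_class as s a \<in> {..<n} - {root}" if "a \<in> A'" for a
      using that A' cls pos_arc(1) h_less by (simp add: out_class_def)
    show "\<exists>a\<in>A'. out_class as s a = v" if v: "v \<in> {..<n} - {root}" for v
    proof -
      \<comment> \<open>The last arc of a zero walk from the root to \<open>v\<close> has head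
        \<open>v\<close>, so the class of \<open>v\<close> is not empty.\<close>
      have "(root, v) \<in> (tight z {..<n})\<^sup>*" "root \<noteq> v" using reach v by auto
      then obtain u where "(u, v) \<in> tight z {..<n}" by (metis rtranclE)
      then obtain i where i: "i < m" "z i = 0" "h i = v" by (auto simp: tight_def)
      then have "as ! i \<in> A'" using A' nth_arc[OF i(1)] v by simp
      moreover have "out_class as s (as ! i) = v" using i cls nth_arc by (simp add: out_class_def)
      ultimately show ?thesis by blast
    qed
    show "out_bound s v = 1" if "v \<in> {..<n} - {root}" for v
      using that bound by (simp add: out_bound_def)
  qed simp_all
  have forest: "uforest ?new (pos as ` B) \<longleftrightarrow> uforest (out_ends as s) B"
    using uforest_image[OF inj, of ?new] by (simp add: out_ends_def[abs_def])
  have card_class: "card {a \<in> pos as ` B. h a = v} = card {a\<in>B. out_class as s a = v}" for v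
  proof -
    have "{a \<in> pos as ` B. h a = v} = pos as ` {a\<in>B. out_class as s a = v}"
      using B cls pos_arc(1) by (auto simp: out_class_def subset_iff)
    then show ?thesis using card_image[OF inj_on_subset[OF inj]] by simp
  qed
  have sub: "B \<subseteq> A' \<longleftrightarrow> (\<forall>a\<in>pos as ` B. z a = 0) \<and> (\<forall>a\<in>pos as ` B. h a \<noteq> root)"
    using A' B by auto
  have Bm: "pos as ` B \<subseteq> {..<m}" using B pos_arc(1) by auto
  have "min_cost_arborescence D r c B \<longleftrightarrow>
      indegree_one (pos as ` B) \<and> (\<forall>a\<in>pos as ` B. z a = 0) \<and> uforest ?new (pos as ` B)"
    unfolding min_cost_arborescence_iff[OF B]
        by (rule dual_state.min_arb_iff_new_forest[OF ds reach])
  also have "\<dots> \<longleftrightarrow> B \<subseteq> A' \<and> uforest (out_ends as s) B \<and>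
      (\<forall>v\<in>{..<n} - {root}. card {a\<in>B. out_class as s a = v} = 1)"
    unfolding indegree_one_def forest card_class sub using Bm by blast
  finally show "min_cost_arborescence D r c B \<longleftrightarrow>
      B \<subseteq> A' \<and> matroid_base (cycle_matroid A' (out_ends as s)) B \<and>
      matroid_base (partition_matroid A' (out_class as s) (out_bound s)) B"
    using base by blast
qed

theorem correct_output_infeasible:
  assumes s: "correct_output (reals s0 ''cost'') s" and f: "infeasible_output s"
  defines "A' \<equiv> out_ground as s"
  shows "ugraph (out_vertices s) A' (out_ends as s)"
    and "B \<subseteq> arcs D \<Longrightarrow> min_cost_arborescence D r c B \<longleftrightarrow>
      B \<subseteq> A' \<and> matroid_base (cycle_matroid A' (out_ends as s)) B \<and>
      matroid_base (partition_matroid A' (out_class as s) (out_bound s)) B"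
proof -
  from f obtain L where L: "L \<subseteq> {..<n} - {root}" "L \<noteq> {}" "\<And>a. a < m \<Longrightarrow> \<not> enters a L"
    unfolding infeasible_output_def unentered_set_def by blast
  have no_arb: "\<not> arb I" for I
    using L by (intro no_arb_if_not_entered[of L]) auto
  from L(1,2) obtain v where v: "v < n" "v \<noteq> root" by auto
  \<comment> \<open>A nonempty set avoiding the root yields a second node, so 0 and 1 are different
    vertices of the output graph.\<close>
  then have n2: "1 < n" using r_less by linarith
  have "vs ! v \<in> verts D" "vs ! v \<noteq> r" using v nth_node by auto
  \<comment> \<open>Here \<open>nontrivial\<close> is essential. Without arcs the ground set would
    be empty and the empty set a common base, although no arborescence exists.\<close>
  then have m0: "0 < m" using nontrivial as'(2) by auto
  let ?a = "as ! 0"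
  have a: "?a \<in> arcs D" "pos as ?a = 0" using nth_arc m0 by auto
  have A': "A' = {?a}"
  proof -
    have "pos as b = 0 \<longleftrightarrow> b = ?a" if "b \<in> arcs D" for b
      using pos_arc(2)[OF that] a(2) by metis
    moreover have "nats s ''ground'' i \<noteq> 0 \<longleftrightarrow> i = 0" for i
      using f by (simp add: infeasible_output_def)
    ultimately show ?thesis using a(1) unfolding A'_def out_ground_def as'(2) by blast
  qed
  have e: "out_ends as s ?a = {0, 1}" using f a by (simp add: out_ends_def infeasible_output_def)
  have V: "out_vertices s = {..<n}" using s by (simp add: correct_output_def out_vertices_def)
  show "ugraph (out_vertices s) A' (out_ends as s)"
    unfolding ugraph_def V A' using n2 e by (auto simp del: length_greater_0_conv)
  fix B assume B: "B \<subseteq> arcs D"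
  have "\<not> min_cost_arborescence D r c B"
    using no_arb by (simp add: min_cost_arborescence_iff[OF B] min_arb_def)
  moreover have "\<not> (matroid_base (cycle_matroid A' (out_ends as s)) B \<and>
      matroid_base (partition_matroid A' (out_class as s) (out_bound s)) B)"
  proof
    assume b: "matroid_base (cycle_matroid A' (out_ends as s)) B \<and>
      matroid_base (partition_matroid A' (out_class as s) (out_bound s)) B"
    \<comment> \<open>The single arc is not a loop, so it forms the only base of the cycle matroid,
      while its bound 0 excludes it from the partition matroid.\<close>
    have "uforest (out_ends as s) {?a}"
      unfolding uforest_def
    proof (rule notI, elim exE conjE)
      fix ws es assume c: "ucycle (out_ends as s) ws es" "set es \<subseteq> {?a}"
      then have "length es = card (set es)" "es \<noteq> []" by (auto simp: ucycle_def distinct_card)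
      moreover have "card (set es) \<le> 1" using card_mono[OF _ c(2)] by simp
      ultimately have "length es = 1" by (cases es) auto
      then obtain x where "es = [x]" by (auto simp: length_Suc_conv)
      then have "es = [?a]" using c(2) by simp
      then have "{0, 1} = {ws ! 0}" using c(1) e by (auto simp: ucycle_def)
      then show False by (metis insert_iff singletonD zero_neq_one)
    qed
    then have "{?a} \<in> cycle_matroid A' (out_ends as s)" by (simp add: cycle_matroid_def A')
    moreover have "B \<subseteq> {?a}" using b by (simp add: matroid_base_def cycle_matroid_def A')
    ultimately have "B = {?a}" using b unfolding matroid_base_def by metis
    then have "card {b\<in>{?a}. out_class as s b =
        out_class as s ?a} \<le> out_bound s (out_class as s ?a)"
      using b unfolding matroid_base_def partition_matroid_def by blast
    moreover have "{b\<in>{?a}. out_class as s b = out_class as s ?a} = {?a}" by auto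
    ultimately show False using f by (simp add: out_bound_def infeasible_output_def)
  qed
  ultimately show "min_cost_arborescence D r c B \<longleftrightarrow>
      B \<subseteq> A' \<and> matroid_base (cycle_matroid A' (out_ends as s)) B \<and>
      matroid_base (partition_matroid A' (out_class as s) (out_bound s)) B" by blast
qed

lemma main_prog_correct:
  "\<exists>k s. exec main_prog s0 k s \<and> k \<le> 202 * (card (verts D) + card (arcs D)) ^ 4 \<and>
    correct_output (reals s0 ''cost'') s"
proof -
  have "wt main_prog (202 * (n + m) ^ 4) (correct_output (reals s0 ''cost'')) s0"
    by (rule wt_main[OF input_s0]) (use r_less in \<open>auto simp: input_state_def\<close>)
  then show ?thesis using vs'(3) as'(3) by (auto simp: wt_def)
qed

end

theorem theorem7:
  shows "\<exists>(P :: com) (C :: nat) (d :: nat).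
    \<forall>(D :: ('a, 'b) pre_digraph) (r :: 'a) (c :: 'b \<Rightarrow> real) (vs :: 'a list) (as :: 'b list).
      fin_digraph D \<and> r \<in> verts D \<and> (arcs D \<noteq> {} \<or> verts D = {r}) \<and>
      enumerates vs (verts D) \<and> enumerates as (arcs D) \<longrightarrow>
      (\<exists>t s. exec P (input_state D r c vs as) t s \<and>
        t \<le> C * (card (verts D) + card (arcs D)) ^ d \<and>
        (\<exists>A' M1 M2.
          A' = out_ground as s \<and> A' \<subseteq> arcs D \<and>
          ugraph (out_vertices s) A' (out_ends as s) \<and>
          M1 = cycle_matroid A' (out_ends as s) \<and>
          M2 = partition_matroid A' (out_class as s) (out_bound s) \<and>
          (\<forall>B. B \<subseteq> arcs D \<longrightarrow>
            (min_cost_arborescence D r c B \<longleftrightarrow>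
               B \<subseteq> A' \<and> matroid_base M1 B \<and> matroid_base M2 B))))"
proof (rule exI[of _ main_prog], rule exI[of _ 202], rule exI[of _ 4], intro allI impI, elim conjE)
  fix D :: "('a, 'b) pre_digraph" and r :: 'a and c :: "'b \<Rightarrow> real" and vs :: "'a list" and as :: "'b list"
  assume "fin_digraph D" "r \<in> verts D" "arcs D \<noteq> {} \<or> verts D = {r}"
    "enumerates vs (verts D)" "enumerates as (arcs D)"
  then interpret enumerated_digraph D r c vs as by (rule enumerated_digraph.intro)
  from main_prog_correct obtain k s where
    ks: "exec main_prog s0 k s" "k \<le> 202 * (card (verts D) + card (arcs D)) ^ 4"
    and out: "correct_output (reals s0 ''cost'') s" by blast
  have graph: "ugraph (out_vertices s) (out_ground as s) (out_ends as s)"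
    using out correct_output_feasible(1)[OF out] correct_output_infeasible(1)[OF out]
    unfolding correct_output_def by blast
  have bases: "min_cost_arborescence D r c B \<longleftrightarrow>
      B \<subseteq> out_ground as s \<and> matroid_base (cycle_matroid (out_ground as s) (out_ends as s)) B \<and>
      matroid_base (partition_matroid (out_ground as s) (out_class as s) (out_bound s)) B"
    if "B \<subseteq> arcs D" for B
    using out[unfolded correct_output_def] correct_output_feasible(2)[OF out _ that]
      correct_output_infeasible(2)[OF out _ that] by metis
  show "\<exists>t s. exec main_prog (input_state D r c vs as) t s \<and>
        t \<le> 202 * (card (verts D) + card (arcs D)) ^ 4 \<and>
        (\<exists>A' M1 M2.
          A' = out_ground as s \<and> A' \<subseteq> arcs D \<and>
          ugraph (out_vertices s) A' (out_ends as s) \<and>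
          M1 = cycle_matroid A' (out_ends as s) \<and>
          M2 = partition_matroid A' (out_class as s) (out_bound s) \<and>
          (\<forall>B. B \<subseteq> arcs D \<longrightarrow>
            (min_cost_arborescence D r c B \<longleftrightarrow>
               B \<subseteq> A' \<and> matroid_base M1 B \<and> matroid_base M2 B)))"
    by (rule exI[of _ k], rule exI[of _ s], intro conjI ks, rule exI[of _ "out_ground as s"],
        rule exI[of _ "cycle_matroid (out_ground as s) (out_ends as s)"],
        rule exI[of _ "partition_matroid (out_ground as s) (out_class as s) (out_bound s)"],
        intro conjI ground_subset graph refl allI impI bases)
qed

end
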